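(* Consider a purely kinetic Chaplygin system with symmetry group $G$ and $m=\dim(Q/G)\ge 2$, and let $\beta=\sum_{a,b}R^a_{ab}\,dq^b$ be its contraction 1-form on $Q/G$. The following statements are equivalent: 1. There exists (in a neighbourhood of each point of $Q/G$) a locally defined function $f$ that satisfies $$(A')^G\quad G_{bk}R^k_{ac}+G_{ak}R^k_{bc}+g_{bc}\frac{\partial f}{\partial q^a}+g_{ac}\frac{\partial f}{\partial q^b}-2g_{ab}\frac{\partial f}{\partial q^c}=0\quad\text{for all }a,b,c$$ (i.e. there exists a local projective geodesic extension $(\overline g_{ai}=-G_{ai},F=f\circ\pi)$). 2. $\beta$ satisfies $$d\beta=0\quad\text{and}\quad \frac{\beta}{m-1}\wedge\theta_l=\gamma^G.$$
   Context: Setting: $Q$ is an $n$-dimensional manifold with Riemannian metric $g$, $\mathcal D\subset TQ$ is a distribution of rank $m$, $L(v)=\frac12g(v,v)$. The system $(L,\mathcal D)$ is a (purely kinetic) Chaplygin system: a Lie group $G$ acts freely and properly on $Q$, $\pi:Q\to Q/G$ is the principal bundle, $g$ and $\mathcal D$ are $G$-invariant, and $\mathcal D$ is the horizontal distribution of a principal connection on $\pi$ (so $TQ=\mathcal D\oplus V\pi$, with $V\pi=\ker T\pi$, and $\dim Q/G=m$). Indices $a,b,c,d=1,\dots,m$; $i,j,k=1,\dots,n-m$. Summation convention is used. Frames: $V_i$ are the infinitesimal generators of a basis of the Lie algebra of $G$; $X_a$ are the horizontal lifts of the coordinate fields $\partial/\partial q^a$ on $Q/G$. Set $G_{ab}=g(X_a,X_b)$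 (inverse $G^{ab}$), $G_{ai}=g(X_a,V_i)$, $K^b_i=-G^{ab}G_{ai}$, $X_i=V_i+K^b_iX_b$ (so $\{X_i\}$ spans the $g$-orthogonal complement of $\mathcal D$). Write $[X_a,X_b]=R^c_{ab}X_c+R^k_{ab}X_k$ and $g_{ab}=G_{ab}$. The functions $g_{ab}$, $R^c_{ab}$ and $G_{ak}R^k_{bc}$ are $G$-invariant and are regarded as functions on $Q/G$; one has $g_{ad}R^d_{bc}=G_{ak}R^k_{bc}$. The gyroscopic tensor $\mathcal T$ is the $(1,2)$-tensor field on $Q/G$ with $\mathcal T(\partial/\partial q^a,\partial/\partial q^b)=R^d_{ab}\,\partial/\partial q^d$; $\beta$ is the 1-form $\beta(\tilde Y)=\sum_a\langle Z^a,\mathcal T(Z_a,\tilde Y)\rangle$ for any local frame $\{Z_a\}$ on $Q/G$ with dual $\{Z^a\}$. Forms on $T(Q/G)$ with coordinates $(q^a,\dot q^a)$: $\theta_l=g_{ab}\dot q^adq^b$ and $\gamma^G=\frac16\left(-G_{bk}R^k_{ac}+G_{ck}R^k_{ab}-2G_{ak}R^k_{bc}\right)\dot q^a\,dq^b\wedge dq^c$; $\beta$ is pulled back to $T(Q/G)$ where needed. The parenthetical remark in item 1 is terminology: for a symmetric $(0,2)$-tensor field $\overline g$ with $\overline g|_{\mathcal D\times\mathcal D}=g|_{\mathcal D\times\mathcal D}$ and $\overline g_{ai}=\overline g(X_a,X_i)$, the couple $(\overline g_{ai},F)$ is a projective geodesic extension if the nonholonomic trajectories are, up to a reparametrization, geodesics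 of a Riemannian metric $\hat g$ with $\hat g(X_a,X_b)=e^{2F}g_{ab}$, $\hat g(X_a,X_i)=e^{2F}\overline g_{ai}$; for $\overline g_{ai}=-G_{ai}$, $F=f\circ\pi$, this is characterized by $(A')^G$. *)

theory Defs
  imports "HOL-Analysis.Analysis" "HOL-Algebra.Group_Action"
begin

section \<open>Smooth maps between open subsets of Euclidean spaces\<close>

primrec Ck_on :: "nat \<Rightarrow> 'a::euclidean_space set \<Rightarrow> ('a \<Rightarrow> 'b::euclidean_space) \<Rightarrow> bool" where
  "Ck_on 0 S f \<longleftrightarrow> continuous_on S f"
| "Ck_on (Suc k) S f \<longleftrightarrow> (\<forall>x\<in>S. f differentiable (at x)) \<and>
     (\<forall>v. Ck_on k S (\<lambda>x. frechet_derivative f (at x) v))"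

text \<open>Only meaningful for an open set \<open>S\<close>.\<close>

definition smooth_on :: "'a::euclidean_space set \<Rightarrow> ('a \<Rightarrow> 'b::euclidean_space) \<Rightarrow> bool" where
  "smooth_on S f \<longleftrightarrow> (\<forall>k. Ck_on k S f)"


section \<open>Smooth manifolds\<close>

text \<open>A chart is a pair of its domain and the coordinate map; the values of the coordinate map
  outside the domain are irrelevant.  A manifold is given by an atlas, which determines both the
  underlying set and the topology.\<close>

type_synonym ('a, 'e) chart = "'a set \<times> ('a \<Rightarrow> 'e)"
type_synonym ('a, 'e) atlas = "('a, 'e) chart set"

definition chart_inv :: "('a, 'e) chart \<Rightarrow> 'e \<Rightarrow> 'a" where
  "chart_inv c = inv_into (fst c) (snd c)"

definition is_chart :: "('a, 'e::euclidean_space) chart \<Rightarrow> bool" where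
  "is_chart c \<longleftrightarrow> inj_on (snd c) (fst c) \<and> open (snd c ` fst c)"

definition compatible ::
    "('a, 'e::euclidean_space) chart \<Rightarrow> ('a, 'e) chart \<Rightarrow> bool" where
  "compatible c d \<longleftrightarrow>
     open (snd c ` (fst c \<inter> fst d)) \<and> open (snd d ` (fst c \<inter> fst d)) \<and>
     smooth_on (snd c ` (fst c \<inter> fst d)) (snd d \<circ> chart_inv c) \<and>
     smooth_on (snd d ` (fst c \<inter> fst d)) (snd c \<circ> chart_inv d)"

definition mcarrier :: "('a, 'e) atlas \<Rightarrow> 'a set" where
  "mcarrier A = (\<Union>c\<in>A. fst c)"

definition mtopology :: "('a, 'e::euclidean_space) atlas \<Rightarrow> 'a topology" where
  "mtopology A = topology (\<lambda>W. W \<subseteq> mcarrier A \<and> (\<forall>c\<in>A. open (snd c ` (fst c \<inter> W))))"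

definition smooth_atlas :: "('a, 'e::euclidean_space) atlas \<Rightarrow> bool" where
  "smooth_atlas A \<longleftrightarrow> (\<forall>c\<in>A. is_chart c) \<and> (\<forall>c\<in>A. \<forall>d\<in>A. compatible c d)"

definition smooth_manifold :: "('a, 'e::euclidean_space) atlas \<Rightarrow> bool" where
  "smooth_manifold A \<longleftrightarrow> smooth_atlas A \<and>
     Hausdorff_space (mtopology A) \<and> second_countable (mtopology A)"

lemma openin_mtopology:
  assumes "smooth_atlas A"
  shows "openin (mtopology A) W \<longleftrightarrow>
    W \<subseteq> mcarrier A \<and> (\<forall>c\<in>A. open (snd c ` (fst c \<inter> W)))"
proof -
  have "istopology (\<lambda>W. W \<subseteq> mcarrier A \<and> (\<forall>c\<in>A. open (snd c ` (fst c \<inter> W))))"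
    unfolding istopology_def
  proof (intro conjI allI impI ballI)
    fix S T c
    assume S: "S \<subseteq> mcarrier A \<and> (\<forall>c\<in>A. open (snd c ` (fst c \<inter> S)))"
      and T: "T \<subseteq> mcarrier A \<and> (\<forall>c\<in>A. open (snd c ` (fst c \<inter> T)))"
      and c: "c \<in> A"
    have "inj_on (snd c) (fst c)"
      using assms c by (auto simp: smooth_atlas_def is_chart_def)
    then have "snd c ` (fst c \<inter> (S \<inter> T)) = snd c ` (fst c \<inter> S) \<inter> snd c ` (fst c \<inter> T)"
      by (auto simp: inj_on_def)
    then show "open (snd c ` (fst c \<inter> (S \<inter> T)))"
      using S T c by auto
  next
    fix \<K> c
    assume K: "\<forall>W\<in>\<K>. W \<subseteq> mcarrier A \<and> (\<forall>c\<in>A. open (snd c ` (fst c \<inter> W)))" and c: "c \<in> A"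
    have "snd c ` (fst c \<inter> \<Union>\<K>) = (\<Union>W\<in>\<K>. snd c ` (fst c \<inter> W))" by auto
    then show "open (snd c ` (fst c \<inter> \<Union>\<K>))"
      using K c by auto
  qed auto
  then show ?thesis by (simp add: mtopology_def topology_inverse')
qed

text \<open>The charts of the maximal atlas, i.e. all local coordinate systems of the manifold.\<close>

definition charts :: "('a, 'e::euclidean_space) atlas \<Rightarrow> ('a, 'e) atlas" where
  "charts A = {c. fst c \<subseteq> mcarrier A \<and> is_chart c \<and> (\<forall>d\<in>A. compatible c d)}"

definition prod_atlas :: "('a, 'e) atlas \<Rightarrow> ('b, 'f) atlas \<Rightarrow> ('a \<times> 'b, 'e \<times> 'f) atlas" where
  "prod_atlas A B = {(fst c \<times> fst d, map_prod (snd c) (snd d)) | c d. c \<in> A \<and> d \<in> B}"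

definition restrict_atlas :: "('a, 'e::euclidean_space) atlas \<Rightarrow> 'a set \<Rightarrow> ('a, 'e) atlas" where
  "restrict_atlas A W = {c \<in> charts A. fst c \<subseteq> W}"

definition smooth_map ::
    "('a, 'e::euclidean_space) atlas \<Rightarrow> ('b, 'f::euclidean_space) atlas \<Rightarrow> ('a \<Rightarrow> 'b) \<Rightarrow> bool" where
  "smooth_map A B F \<longleftrightarrow> (\<forall>p\<in>mcarrier A. \<exists>c\<in>charts A. \<exists>d\<in>charts B.
     p \<in> fst c \<and> F ` fst c \<subseteq> fst d \<and> smooth_on (snd c ` fst c) (snd d \<circ> F \<circ> chart_inv c))"

definition diffeomorphism ::
    "('a, 'e::euclidean_space) atlas \<Rightarrow> ('b, 'f::euclidean_space) atlas \<Rightarrow> ('a \<Rightarrow> 'b) \<Rightarrow> bool" where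
  "diffeomorphism A B F \<longleftrightarrow> bij_betw F (mcarrier A) (mcarrier B) \<and>
     smooth_map A B F \<and> smooth_map B A (inv_into (mcarrier A) F)"

text \<open>Smoothness of a real function in some neighbourhood of \<open>p\<close>.\<close>

definition smooth_at :: "('a, 'e::euclidean_space) atlas \<Rightarrow> ('a \<Rightarrow> real) \<Rightarrow> 'a \<Rightarrow> bool" where
  "smooth_at A f p \<longleftrightarrow>
     (\<exists>c\<in>charts A. p \<in> fst c \<and> smooth_on (snd c ` fst c) (f \<circ> chart_inv c))"


section \<open>Tangent vectors, vector fields, differential forms\<close>

text \<open>A tangent vector at \<open>p\<close> is a directional derivative acting on the functions that are smooth
  near \<open>p\<close>; on all other functions it takes the value \<open>0\<close>, so that equality of tangent vectors is
  equality of functions.\<close>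

type_synonym 'a tvec = "('a \<Rightarrow> real) \<Rightarrow> real"
type_synonym 'a vfield = "'a \<Rightarrow> 'a tvec"

definition tangent_vector ::
    "('a, 'e::euclidean_space) atlas \<Rightarrow> ('a, 'e) chart \<Rightarrow> 'a \<Rightarrow> 'e \<Rightarrow> 'a tvec" where
  "tangent_vector A c p v = (\<lambda>f. if smooth_at A f p
     then frechet_derivative (f \<circ> chart_inv c) (at (snd c p)) v else 0)"

definition tangent_space :: "('a, 'e::euclidean_space) atlas \<Rightarrow> 'a \<Rightarrow> 'a tvec set" where
  "tangent_space A p = {tangent_vector A c p v | c v. c \<in> charts A \<and> p \<in> fst c}"

text \<open>The tangent map at \<open>p\<close> of a map \<open>F\<close> into the manifold \<open>B\<close>.\<close>

definition tangent_map ::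
    "('b, 'f::euclidean_space) atlas \<Rightarrow> ('a \<Rightarrow> 'b) \<Rightarrow> 'a \<Rightarrow> 'a tvec \<Rightarrow> 'b tvec" where
  "tangent_map B F p v = (\<lambda>h. if smooth_at B h (F p) then v (h \<circ> F) else 0)"

definition lin_comb :: "('i::finite \<Rightarrow> real) \<Rightarrow> ('i \<Rightarrow> 'a tvec) \<Rightarrow> 'a tvec" where
  "lin_comb c E = (\<lambda>f. \<Sum>i\<in>UNIV. c i * E i f)"

definition is_basis :: "('i::finite \<Rightarrow> 'a tvec) \<Rightarrow> 'a tvec set \<Rightarrow> bool" where
  "is_basis E V \<longleftrightarrow> V = range (\<lambda>c. lin_comb c E) \<and>
     (\<forall>c. lin_comb c E = (\<lambda>f. 0) \<longrightarrow> (\<forall>i. c i = 0))"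

definition smooth_vfield_on ::
    "('a, 'e::euclidean_space) atlas \<Rightarrow> 'a set \<Rightarrow> 'a vfield \<Rightarrow> bool" where
  "smooth_vfield_on A W X \<longleftrightarrow> openin (mtopology A) W \<and> (\<forall>p\<in>W. X p \<in> tangent_space A p \<and>
     (\<forall>f. smooth_at A f p \<longrightarrow> smooth_at A (\<lambda>q. X q f) p))"

definition lie_bracket ::
    "('a, 'e::euclidean_space) atlas \<Rightarrow> 'a vfield \<Rightarrow> 'a vfield \<Rightarrow> 'a vfield" where
  "lie_bracket A X Y p = (\<lambda>f. if smooth_at A f p
     then X p (\<lambda>q. Y q f) - Y p (\<lambda>q. X q f) else 0)"

text \<open>A smooth distribution whose rank is the cardinality of the index type \<open>'i\<close>.\<close>

definition smooth_distribution ::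
    "'i::finite itself \<Rightarrow> ('a, 'e::euclidean_space) atlas \<Rightarrow> ('a \<Rightarrow> 'a tvec set) \<Rightarrow> bool" where
  "smooth_distribution _ A D \<longleftrightarrow> (\<forall>p\<in>mcarrier A. \<exists>W (Y :: 'i \<Rightarrow> 'a vfield). p \<in> W \<and>
     (\<forall>a. smooth_vfield_on A W (Y a)) \<and> (\<forall>q\<in>W. is_basis (\<lambda>a. Y a q) (D q)))"

definition riemannian_metric ::
    "('a, 'e::euclidean_space) atlas \<Rightarrow> ('a \<Rightarrow> 'a tvec \<Rightarrow> 'a tvec \<Rightarrow> real) \<Rightarrow> bool" where
  "riemannian_metric A g \<longleftrightarrow>
     (\<forall>p\<in>mcarrier A. \<forall>u\<in>tangent_space A p. \<forall>v\<in>tangent_space A p. \<forall>w\<in>tangent_space A p. \<forall>r.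
        g p u w = g p w u \<and> g p (\<lambda>f. r * u f + v f) w = r * g p u w + g p v w \<and>
        (u \<noteq> (\<lambda>f. 0) \<longrightarrow> 0 < g p u u)) \<and>
     (\<forall>W X Y. smooth_vfield_on A W X \<and> smooth_vfield_on A W Y \<longrightarrow>
        (\<forall>p\<in>W. smooth_at A (\<lambda>q. g q (X q) (Y q)) p))"

type_synonym 'a form1 = "'a \<Rightarrow> 'a tvec \<Rightarrow> real"
type_synonym 'a form2 = "'a \<Rightarrow> 'a tvec \<Rightarrow> 'a tvec \<Rightarrow> real"

text \<open>The differential \<open>df\<close> of a function.\<close>

definition dfun :: "('a \<Rightarrow> real) \<Rightarrow> 'a form1" where
  "dfun f = (\<lambda>p u. u f)"

definition wedge :: "'a form1 \<Rightarrow> 'a form1 \<Rightarrow> 'a form2" where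
  "wedge \<alpha> \<beta> = (\<lambda>p u w. \<alpha> p u * \<beta> p w - \<alpha> p w * \<beta> p u)"

definition pullback :: "('b, 'f::euclidean_space) atlas \<Rightarrow> ('a \<Rightarrow> 'b) \<Rightarrow> 'b form1 \<Rightarrow> 'a form1" where
  "pullback B F \<alpha> = (\<lambda>p u. \<alpha> (F p) (tangent_map B F p u))"

definition coord :: "('a, real^'m) chart \<Rightarrow> 'm \<Rightarrow> 'a \<Rightarrow> real" where
  "coord c a = (\<lambda>x. snd c x $ a)"

text \<open>The coordinate vector field \<open>\<partial>/\<partial>q\<^sup>a\<close>.\<close>

definition coord_field :: "('a, real^'m) atlas \<Rightarrow> ('a, real^'m) chart \<Rightarrow> 'm \<Rightarrow> 'a vfield" where
  "coord_field A c a x = tangent_vector A c x (axis a 1)"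

text \<open>The exterior derivative of a 1-form on a coordinate domain:
  \<open>d(\<Sum>\<^sub>b \<alpha>\<^sub>b dq\<^sup>b) = \<Sum>\<^sub>b d\<alpha>\<^sub>b \<and> dq\<^sup>b\<close>.\<close>

definition ext_deriv ::
    "('a, real^'m) atlas \<Rightarrow> ('a, real^'m) chart \<Rightarrow> 'a form1 \<Rightarrow> 'a form2" where
  "ext_deriv A c \<alpha> = (\<lambda>x u w. \<Sum>b\<in>UNIV.
     wedge (dfun (\<lambda>y. \<alpha> y (coord_field A c b y))) (dfun (coord c b)) x u w)"

text \<open>The tangent bundle, with the charts \<open>(q\<^sup>a, q\<^sup>a-dot)\<close> induced by the charts \<open>(q\<^sup>a)\<close> of the base.
  The bundle projection is \<^term>\<open>fst\<close>.\<close>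

definition velocity :: "('a, real^'m) chart \<Rightarrow> 'm \<Rightarrow> 'a \<times> 'a tvec \<Rightarrow> real" where
  "velocity c a = (\<lambda>P. snd P (coord c a))"

definition tangent_atlas ::
    "('a, real^'m) atlas \<Rightarrow> ('a \<times> 'a tvec, (real^'m) \<times> (real^'m)) atlas" where
  "tangent_atlas A =
     {(Sigma (fst c) (tangent_space A), \<lambda>P. (snd c (fst P), \<chi> a. velocity c a P)) | c. c \<in> charts A}"


section \<open>Lie groups and principal bundles\<close>

definition lie_group :: "('g, 'e::euclidean_space) atlas \<Rightarrow> 'g monoid \<Rightarrow> bool" where
  "lie_group A G \<longleftrightarrow> smooth_manifold A \<and> group G \<and> carrier G = mcarrier A \<and>
     smooth_map (prod_atlas A A) A (\<lambda>(g, h). g \<otimes>\<^bsub>G\<^esub> h) \<and> smooth_map A A (\<lambda>g. inv\<^bsub>G\<^esub> g)"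

definition smooth_action :: "('g, 'e::euclidean_space) atlas \<Rightarrow> 'g monoid \<Rightarrow>
    ('a, 'f::euclidean_space) atlas \<Rightarrow> ('g \<Rightarrow> 'a \<Rightarrow> 'a) \<Rightarrow> bool" where
  "smooth_action AG G A \<Phi> \<longleftrightarrow> group_action G (mcarrier A) \<Phi> \<and>
     smooth_map (prod_atlas AG A) A (\<lambda>(g, p). \<Phi> g p)"

definition free_action :: "'g monoid \<Rightarrow> 'a set \<Rightarrow> ('g \<Rightarrow> 'a \<Rightarrow> 'a) \<Rightarrow> bool" where
  "free_action G E \<Phi> \<longleftrightarrow> (\<forall>p\<in>E. \<forall>g\<in>carrier G. \<Phi> g p = p \<longrightarrow> g = \<one>\<^bsub>G\<^esub>)"

definition proper_action :: "('g, 'e::euclidean_space) atlas \<Rightarrow>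
    ('a, 'f::euclidean_space) atlas \<Rightarrow> ('g \<Rightarrow> 'a \<Rightarrow> 'a) \<Rightarrow> bool" where
  "proper_action AG A \<Phi> \<longleftrightarrow>
     proper_map (prod_topology (mtopology AG) (mtopology A))
       (prod_topology (mtopology A) (mtopology A)) (\<lambda>(g, p). (\<Phi> g p, p))"

text \<open>The base \<open>B\<close> is a manifold structure on the set of orbits and the bundle projection is the
  orbit map; the last clause is equivariant local triviality.\<close>

definition principal_bundle :: "('g, 'e::euclidean_space) atlas \<Rightarrow> 'g monoid \<Rightarrow>
    ('a, 'f::euclidean_space) atlas \<Rightarrow> ('g \<Rightarrow> 'a \<Rightarrow> 'a) \<Rightarrow>
    ('a set, 'h::euclidean_space) atlas \<Rightarrow> bool" where
  "principal_bundle AG G A \<Phi> B \<longleftrightarrow>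
     smooth_manifold B \<and> mcarrier B = orbits G (mcarrier A) \<Phi> \<and> smooth_map A B (orbit G \<Phi>) \<and>
     (\<forall>x\<in>mcarrier B. \<exists>U \<psi>. openin (mtopology B) U \<and> x \<in> U \<and>
        diffeomorphism (restrict_atlas A {p \<in> mcarrier A. orbit G \<Phi> p \<in> U})
          (prod_atlas (restrict_atlas B U) AG) \<psi> \<and>
        (\<forall>p\<in>mcarrier A. orbit G \<Phi> p \<in> U \<longrightarrow> fst (\<psi> p) = orbit G \<Phi> p \<and>
           (\<forall>g\<in>carrier G. snd (\<psi> (\<Phi> g p)) = g \<otimes>\<^bsub>G\<^esub> snd (\<psi> p))))"


section \<open>Purely kinetic Chaplygin systems\<close>

text \<open>The dimensions of \<open>Q\<close>, \<open>Q/G\<close> and \<open>G\<close> are the cardinalities of \<open>'n\<close>, \<open>'m\<close> and \<open>'k\<close>.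
  The Lagrangian \<open>L(v) = g(v,v)/2\<close> is determined by the metric.\<close>

record ('q, 'g, 'n, 'm, 'k) chaplygin_data =
  Qman :: "('q, real^'n) atlas"
  Ggrp :: "'g monoid"
  Gman :: "('g, real^'k) atlas"
  act :: "'g \<Rightarrow> 'q \<Rightarrow> 'q"
  Bman :: "('q set, real^'m) atlas"
  metric :: "'q \<Rightarrow> 'q tvec \<Rightarrow> 'q tvec \<Rightarrow> real"
  distr :: "'q \<Rightarrow> 'q tvec set"

definition proj ::
    "('q, 'g, 'n::finite, 'm::finite, 'k::finite) chaplygin_data \<Rightarrow> 'q \<Rightarrow> 'q set" where
  "proj S = orbit (Ggrp S) (act S)"

definition vertical_space ::
    "('q, 'g, 'n::finite, 'm::finite, 'k::finite) chaplygin_data \<Rightarrow> 'q \<Rightarrow> 'q tvec set" where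
  "vertical_space S p =
     {v \<in> tangent_space (Qman S) p. tangent_map (Bman S) (proj S) p v = (\<lambda>h. 0)}"

text \<open>The last three clauses are the invariance of \<open>g\<close>, the invariance of \<open>D\<close>, and
  \<open>TQ = D \<oplus> V\<pi>\<close>; the last two say that \<open>D\<close> is the horizontal distribution of a principal
  connection.\<close>

definition chaplygin_system ::
    "('q, 'g, 'n::finite, 'm::finite, 'k::finite) chaplygin_data \<Rightarrow> bool" where
  "chaplygin_system S \<longleftrightarrow>
     smooth_manifold (Qman S) \<and> lie_group (Gman S) (Ggrp S) \<and>
     smooth_action (Gman S) (Ggrp S) (Qman S) (act S) \<and>
     free_action (Ggrp S) (mcarrier (Qman S)) (act S) \<and>
     proper_action (Gman S) (Qman S) (act S) \<and>
     principal_bundle (Gman S) (Ggrp S) (Qman S) (act S) (Bman S) \<and>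
     riemannian_metric (Qman S) (metric S) \<and>
     smooth_distribution TYPE('m) (Qman S) (distr S) \<and>
     (\<forall>g\<in>carrier (Ggrp S). \<forall>p\<in>mcarrier (Qman S).
        \<forall>u\<in>tangent_space (Qman S) p. \<forall>v\<in>tangent_space (Qman S) p.
          metric S (act S g p) (tangent_map (Qman S) (act S g) p u)
            (tangent_map (Qman S) (act S g) p v) = metric S p u v) \<and>
     (\<forall>g\<in>carrier (Ggrp S). \<forall>p\<in>mcarrier (Qman S).
        tangent_map (Qman S) (act S g) p ` distr S p = distr S (act S g p)) \<and>
     (\<forall>p\<in>mcarrier (Qman S). distr S p \<subseteq> tangent_space (Qman S) p \<and>
        (\<forall>v\<in>tangent_space (Qman S) p.
           \<exists>!dw. dw \<in> distr S p \<times> vertical_space S p \<and> v = (\<lambda>f. fst dw f + snd dw f)))"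

text \<open>The Lie algebra is the tangent space of \<open>G\<close> at the identity.\<close>

definition lie_algebra_basis :: "('q, 'g, 'n::finite, 'm::finite, 'k::finite) chaplygin_data \<Rightarrow>
    ('k \<Rightarrow> 'g tvec) \<Rightarrow> bool" where
  "lie_algebra_basis S \<xi> \<longleftrightarrow> is_basis \<xi> (tangent_space (Gman S) \<one>\<^bsub>Ggrp S\<^esub>)"

text \<open>In the following, \<open>\<xi>\<close> is a basis of the Lie algebra and \<open>c\<close> is a chart \<open>(q\<^sup>a)\<close> of \<open>Q/G\<close>;
  the objects on \<open>Q\<close> live over its domain.  First the infinitesimal generators \<open>V\<^sub>i\<close>: the tangent
  map at the identity of \<open>g \<mapsto> g p\<close>, applied to \<open>\<xi>\<^sub>i\<close>.\<close>

definition Vgen :: "('q, 'g, 'n::finite, 'm::finite, 'k::finite) chaplygin_data \<Rightarrow>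
    ('k \<Rightarrow> 'g tvec) \<Rightarrow> 'k \<Rightarrow> 'q vfield" where
  "Vgen S \<xi> i p = tangent_map (Qman S) (\<lambda>g. act S g p) \<one>\<^bsub>Ggrp S\<^esub> (\<xi> i)"

text \<open>The horizontal lift \<open>X\<^sub>a\<close> of \<open>\<partial>/\<partial>q\<^sup>a\<close>.\<close>

definition Xhor :: "('q, 'g, 'n::finite, 'm::finite, 'k::finite) chaplygin_data \<Rightarrow>
    ('q set, real^'m) chart \<Rightarrow> 'm \<Rightarrow> 'q vfield" where
  "Xhor S c a p = (THE v. v \<in> distr S p \<and>
     tangent_map (Bman S) (proj S) p v = coord_field (Bman S) c a (proj S p))"

definition Gmat :: "('q, 'g, 'n::finite, 'm::finite, 'k::finite) chaplygin_data \<Rightarrow>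
    ('q set, real^'m) chart \<Rightarrow> 'q \<Rightarrow> real^'m^'m" where
  "Gmat S c p = (\<chi> a b. metric S p (Xhor S c a p) (Xhor S c b p))"

definition Gmix :: "('q, 'g, 'n::finite, 'm::finite, 'k::finite) chaplygin_data \<Rightarrow>
    ('k \<Rightarrow> 'g tvec) \<Rightarrow> ('q set, real^'m) chart \<Rightarrow> 'm \<Rightarrow> 'k \<Rightarrow> 'q \<Rightarrow> real" where
  "Gmix S \<xi> c a i p = metric S p (Xhor S c a p) (Vgen S \<xi> i p)"

definition Kcoeff :: "('q, 'g, 'n::finite, 'm::finite, 'k::finite) chaplygin_data \<Rightarrow>
    ('k \<Rightarrow> 'g tvec) \<Rightarrow> ('q set, real^'m) chart \<Rightarrow> 'm \<Rightarrow> 'k \<Rightarrow> 'q \<Rightarrow> real" where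
  "Kcoeff S \<xi> c b i p = - (\<Sum>a\<in>UNIV. matrix_inv (Gmat S c p) $ a $ b * Gmix S \<xi> c a i p)"

text \<open>\<open>X\<^sub>i = V\<^sub>i + K\<^sup>b\<^sub>i X\<^sub>b\<close>\<close>

definition Xorth :: "('q, 'g, 'n::finite, 'm::finite, 'k::finite) chaplygin_data \<Rightarrow>
    ('k \<Rightarrow> 'g tvec) \<Rightarrow> ('q set, real^'m) chart \<Rightarrow> 'k \<Rightarrow> 'q vfield" where
  "Xorth S \<xi> c i p =
     (\<lambda>f. Vgen S \<xi> i p f + (\<Sum>b\<in>UNIV. Kcoeff S \<xi> c b i p * Xhor S c b p f))"

text \<open>The coefficients of a tangent vector with respect to the frame consisting of the \<open>X\<^sub>a\<close> and
  the \<open>X\<^sub>i\<close>, and with these the coefficients \<open>R\<^sup>d\<^sub>a\<^sub>b\<close> and \<open>R\<^sup>k\<^sub>a\<^sub>b\<close> in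
  \<open>[X\<^sub>a, X\<^sub>b] = R\<^sup>d\<^sub>a\<^sub>b X\<^sub>d + R\<^sup>k\<^sub>a\<^sub>b X\<^sub>k\<close>.\<close>

definition frame_coeffs :: "('q, 'g, 'n::finite, 'm::finite, 'k::finite) chaplygin_data \<Rightarrow>
    ('k \<Rightarrow> 'g tvec) \<Rightarrow> ('q set, real^'m) chart \<Rightarrow> 'q \<Rightarrow> 'q tvec \<Rightarrow> ('m \<Rightarrow> real) \<times> ('k \<Rightarrow> real)" where
  "frame_coeffs S \<xi> c p v = (THE rs. v = (\<lambda>f. (\<Sum>d\<in>UNIV. fst rs d * Xhor S c d p f) +
     (\<Sum>k\<in>UNIV. snd rs k * Xorth S \<xi> c k p f)))"

definition Rhor :: "('q, 'g, 'n::finite, 'm::finite, 'k::finite) chaplygin_data \<Rightarrow>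
    ('k \<Rightarrow> 'g tvec) \<Rightarrow> ('q set, real^'m) chart \<Rightarrow> 'm \<Rightarrow> 'm \<Rightarrow> 'm \<Rightarrow> 'q \<Rightarrow> real" where
  "Rhor S \<xi> c d a b p =
     fst (frame_coeffs S \<xi> c p (lie_bracket (Qman S) (Xhor S c a) (Xhor S c b) p)) d"

definition Rorth :: "('q, 'g, 'n::finite, 'm::finite, 'k::finite) chaplygin_data \<Rightarrow>
    ('k \<Rightarrow> 'g tvec) \<Rightarrow> ('q set, real^'m) chart \<Rightarrow> 'k \<Rightarrow> 'm \<Rightarrow> 'm \<Rightarrow> 'q \<Rightarrow> real" where
  "Rorth S \<xi> c k a b p =
     snd (frame_coeffs S \<xi> c p (lie_bracket (Qman S) (Xhor S c a) (Xhor S c b) p)) k"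

text \<open>The function on \<open>Q/G\<close> induced by a \<open>G\<close>-invariant function \<open>h\<close> on \<open>Q\<close>.  A point of \<open>Q/G\<close> is
  an orbit, i.e. a subset of \<open>Q\<close>.\<close>

definition descend :: "('q \<Rightarrow> real) \<Rightarrow> 'q set \<Rightarrow> real" where
  "descend h x = (THE r. \<forall>p\<in>x. h p = r)"

text \<open>The functions \<open>g\<^sub>a\<^sub>b = G\<^sub>a\<^sub>b\<close>, \<open>R\<^sup>d\<^sub>a\<^sub>b\<close> and \<open>G\<^sub>a\<^sub>k R\<^sup>k\<^sub>b\<^sub>d\<close> on \<open>Q/G\<close>.\<close>

definition g_base :: "('q, 'g, 'n::finite, 'm::finite, 'k::finite) chaplygin_data \<Rightarrow>
    ('q set, real^'m) chart \<Rightarrow> 'm \<Rightarrow> 'm \<Rightarrow> 'q set \<Rightarrow> real" where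
  "g_base S c a b = descend (\<lambda>p. Gmat S c p $ a $ b)"

definition R_base :: "('q, 'g, 'n::finite, 'm::finite, 'k::finite) chaplygin_data \<Rightarrow>
    ('k \<Rightarrow> 'g tvec) \<Rightarrow> ('q set, real^'m) chart \<Rightarrow> 'm \<Rightarrow> 'm \<Rightarrow> 'm \<Rightarrow> 'q set \<Rightarrow> real" where
  "R_base S \<xi> c d a b = descend (Rhor S \<xi> c d a b)"

definition GR_base :: "('q, 'g, 'n::finite, 'm::finite, 'k::finite) chaplygin_data \<Rightarrow>
    ('k \<Rightarrow> 'g tvec) \<Rightarrow> ('q set, real^'m) chart \<Rightarrow> 'm \<Rightarrow> 'm \<Rightarrow> 'm \<Rightarrow> 'q set \<Rightarrow> real" where
  "GR_base S \<xi> c a b d = descend (\<lambda>p. \<Sum>k\<in>UNIV. Gmix S \<xi> c a k p * Rorth S \<xi> c k b d p)"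

text \<open>The gyroscopic tensor \<open>T(\<partial>/\<partial>q\<^sup>a, \<partial>/\<partial>q\<^sup>b) = R\<^sup>d\<^sub>a\<^sub>b \<partial>/\<partial>q\<^sup>d\<close> and its contraction, computed
  in the coordinate frame, i.e. \<open>\<beta> = R\<^sup>a\<^sub>a\<^sub>b dq\<^sup>b\<close>.\<close>

definition gyroscopic_tensor :: "('q, 'g, 'n::finite, 'm::finite, 'k::finite) chaplygin_data \<Rightarrow>
    ('k \<Rightarrow> 'g tvec) \<Rightarrow> ('q set, real^'m) chart \<Rightarrow>
    'q set \<Rightarrow> 'q set tvec \<Rightarrow> 'q set tvec \<Rightarrow> 'q set tvec" where
  "gyroscopic_tensor S \<xi> c x u w = (\<lambda>h. \<Sum>d\<in>UNIV. \<Sum>a\<in>UNIV. \<Sum>b\<in>UNIV.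
     dfun (coord c a) x u * dfun (coord c b) x w * R_base S \<xi> c d a b x *
     coord_field (Bman S) c d x h)"

definition beta :: "('q, 'g, 'n::finite, 'm::finite, 'k::finite) chaplygin_data \<Rightarrow>
    ('k \<Rightarrow> 'g tvec) \<Rightarrow> ('q set, real^'m) chart \<Rightarrow> 'q set form1" where
  "beta S \<xi> c = (\<lambda>x w. \<Sum>a\<in>UNIV.
     dfun (coord c a) x (gyroscopic_tensor S \<xi> c x (coord_field (Bman S) c a x) w))"

text \<open>The forms \<open>\<theta>\<^sub>l = g\<^sub>a\<^sub>b q\<^sup>a-dot dq\<^sup>b\<close> and \<open>\<gamma>\<^sup>G\<close> on the part of \<open>T(Q/G)\<close> over the domain of \<open>c\<close>;
  \<open>coord c b \<circ> fst\<close> is the coordinate function \<open>q\<^sup>b\<close> on \<open>T(Q/G)\<close>.\<close>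

definition theta_l :: "('q, 'g, 'n::finite, 'm::finite, 'k::finite) chaplygin_data \<Rightarrow>
    ('q set, real^'m) chart \<Rightarrow> ('q set \<times> 'q set tvec) form1" where
  "theta_l S c = (\<lambda>P u. \<Sum>a\<in>UNIV. \<Sum>b\<in>UNIV.
     g_base S c a b (fst P) * velocity c a P * dfun (coord c b \<circ> fst) P u)"

definition gamma_G :: "('q, 'g, 'n::finite, 'm::finite, 'k::finite) chaplygin_data \<Rightarrow>
    ('k \<Rightarrow> 'g tvec) \<Rightarrow> ('q set, real^'m) chart \<Rightarrow> ('q set \<times> 'q set tvec) form2" where
  "gamma_G S \<xi> c = (\<lambda>P u w. 1/6 * (\<Sum>a\<in>UNIV. \<Sum>b\<in>UNIV. \<Sum>d\<in>UNIV.
     (- GR_base S \<xi> c b a d (fst P) + GR_base S \<xi> c d a b (fst P) - 2 * GR_base S \<xi> c a b d (fst P)) *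
     velocity c a P * wedge (dfun (coord c b \<circ> fst)) (dfun (coord c d \<circ> fst)) P u w))"

end

theory Submission
  imports Defs
begin

text \<open>Let \<open>E\<^sub>a\<^sub>b\<^sub>d = g(X\<^sub>a, [X\<^sub>b, X\<^sub>d])\<close>.  The bracket of two lifted coordinate fields is vertical, so
  expanding it in the generators \<open>V\<^sub>k\<close> gives \<open>G\<^sub>a\<^sub>k R\<^sup>k\<^sub>b\<^sub>d = E\<^sub>a\<^sub>b\<^sub>d\<close> and \<open>R\<^sup>a\<^sub>b\<^sub>d = G\<^sup>a\<^sup>e E\<^sub>e\<^sub>b\<^sub>d\<close>; everything is
  therefore expressed by \<open>E\<close>, which is \<open>G\<close>-invariant, antisymmetric in \<open>b, d\<close> and tensorial.
  Contracting \<open>(A')\<close> with the inverse metric forces \<open>df = \<beta>/(m - 1)\<close>.  Conversely, if \<open>\<beta>\<close> is closed,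
  such an \<open>f\<close> exists locally, and for \<open>df = \<beta>/(m - 1)\<close> the condition \<open>(A')\<close> at a point is, by
  (anti)symmetrisation, the equality of the coefficients of \<open>\<beta>/(m - 1) \<and> \<theta>\<^sub>l\<close> and \<open>\<gamma>\<^sup>G\<close>.\<close>

section \<open>Calculus of smooth maps\<close>

text \<open>Contracting (A') over a, b yields 2 beta + 2 df - 2 m df = 0, since the last term
  contains the trace of the identity. This is the origin of m - 1, and m >= 2 allows dividing by it.
  The obstacle is that statement 1 asks for (A') in every chart of the base, while a potential f
  comes out of one chart only. So E must be compared in two charts: the inhomogeneous part of the
  transformed bracket is horizontal, whereas the brackets are vertical, so it vanishes. Statement 2
  lives on T(Q/G). It becomes algebra at a point of Q/G because the velocity and the dq-components
  of two tangent vectors there can be prescribed freely. The coefficients of \<gamma>^G are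
  antisymmetric in the two wedge indices, so each pair is counted twice and 1/6 becomes 1/3. The
  lifts X_a and the functions on Q/G are defined by unique choice, point by point. Their smoothness
  has to be recovered: from a local frame of D through an inverse matrix for X_a, from local
  sections of the bundle for functions on Q/G.\<close>

lemma has_derivative_cong_nhds:
  assumes "eventually (\<lambda>y. f y = g y) (nhds x)"
  shows "(f has_derivative D) (at x) \<longleftrightarrow> (g has_derivative D) (at x)"
proof -
  obtain U where "open U" "x \<in> U" "\<And>y. y \<in> U \<Longrightarrow> f y = g y"
    using assms unfolding eventually_nhds by blast
  then show ?thesis
    using has_derivative_transform_within_open[of f D x UNIV U g]
      has_derivative_transform_within_open[of g D x UNIV U f] by auto
qed

lemma frechet_derivative_cong_ev:
  "eventually (\<lambda>y. f y = g y) (nhds x) \<Longrightarrow> frechet_derivative f (at x) = frechet_derivative g (at x)"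
  unfolding frechet_derivative_def by (simp add: has_derivative_cong_nhds)

lemma differentiable_cong_ev:
  "eventually (\<lambda>y. f y = g y) (nhds x) \<Longrightarrow> f differentiable (at x) \<longleftrightarrow> g differentiable (at x)"
  unfolding differentiable_def by (simp add: has_derivative_cong_nhds)

lemma has_derivative_frechet:
  "f differentiable (at x) \<Longrightarrow> (f has_derivative frechet_derivative f (at x)) (at x)"
  by (simp add: frechet_derivative_works)

lemma frechet_eqI: "(f has_derivative D) (at x) \<Longrightarrow> frechet_derivative f (at x) v = D v"
  by (metis frechet_derivative_at)

text \<open>Openness turns equality on \<open>S\<close> into equality near each point of
  \<open>S\<close>. The directional derivatives then agree on \<open>S\<close> as well, and the
  induction applies to them.\<close>

lemma Ck_on_cong:
  assumes "open S" "\<And>x. x \<in> S \<Longrightarrow> f x = g x"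
  shows "Ck_on k S f \<longleftrightarrow> Ck_on k S g"
  using assms(2)
proof (induction k arbitrary: f g)
  case 0
  then show ?case by (auto intro: continuous_on_eq)
next
  case (Suc k)
  have ev: "eventually (\<lambda>y. f y = g y) (nhds x)" if "x \<in> S" for x
    using Suc.prems that assms(1) by (auto simp: eventually_nhds)
  have "Ck_on k S (\<lambda>x. frechet_derivative f (at x) v) \<longleftrightarrow> Ck_on k S (\<lambda>x. frechet_derivative g (at x) v)" for v
    by (rule Suc.IH) (simp add: frechet_derivative_cong_ev[OF ev])
  then show ?case using differentiable_cong_ev[OF ev] by auto
qed

lemma Ck_on_subset: "Ck_on k S f \<Longrightarrow> T \<subseteq> S \<Longrightarrow> Ck_on k T f"
  by (induction k arbitrary: f) (auto intro: continuous_on_subset)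

lemma Ck_on_continuous: "Ck_on (Suc k) S f \<Longrightarrow> continuous_on S f"
  by (auto intro!: continuous_at_imp_continuous_on differentiable_imp_continuous_within)

text \<open>\<open>Ck_on (Suc k)\<close> demands nothing directly at level \<open>k\<close>. At the
  bottom differentiability gives continuity; above it the induction passes to the directional
  derivatives.\<close>

lemma Ck_on_SucD: "Ck_on (Suc k) S f \<Longrightarrow> Ck_on k S f"
proof (induction k arbitrary: f)
  case 0
  then show ?case using Ck_on_continuous[of 0 S f] by simp
next
  case (Suc k)
  have "Ck_on k S (\<lambda>x. frechet_derivative f (at x) v)" for v
    using Suc.prems by (intro Suc.IH) (simp only: Ck_on.simps(2)[of "Suc k"])
  then show ?case using Suc.prems by simp
qed

lemma Ck_on_frechet_derivative: "Ck_on (Suc k) S f \<Longrightarrow> Ck_on k S (\<lambda>x. frechet_derivative f (at x) v)"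
  by simp

text \<open>Permits a derivative in closed form \<open>D\<close> in place of
  \<open>frechet_derivative\<close>; the inductions below all recognise in \<open>D\<close>
  expressions of the same kind one order lower.\<close>

lemma Ck_on_SucI:
  assumes "open S" "\<And>x. x \<in> S \<Longrightarrow> (f has_derivative D x) (at x)" "\<And>v. Ck_on k S (\<lambda>x. D x v)"
  shows "Ck_on (Suc k) S f"
proof -
  have "Ck_on k S (\<lambda>x. frechet_derivative f (at x) v)" for v
    using Ck_on_cong[OF assms(1), of "\<lambda>x. frechet_derivative f (at x) v" "\<lambda>x. D x v" k]
      frechet_eqI[OF assms(2)] assms(3) by auto
  then show ?thesis using assms(2) by (auto simp: differentiable_def)
qed

lemma Ck_on_const: "open S \<Longrightarrow> Ck_on k S (\<lambda>x. c)"
proof (induction k arbitrary: c)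
  case (Suc k)
  then show ?case by (intro Ck_on_SucI[where D="\<lambda>x v. 0"]) (auto intro!: derivative_eq_intros)
qed simp

lemma Ck_on_linear: "open S \<Longrightarrow> bounded_linear f \<Longrightarrow> Ck_on k S f"
proof (cases k)
  case 0
  then show "bounded_linear f \<Longrightarrow> ?thesis" by (simp add: linear_continuous_on)
next
  case (Suc j)
  then show "open S \<Longrightarrow> bounded_linear f \<Longrightarrow> ?thesis"
    unfolding Suc by (intro Ck_on_SucI[where D="\<lambda>x v. f v"] bounded_linear_imp_has_derivative Ck_on_const)
qed

lemma Ck_on_add: "open S \<Longrightarrow> Ck_on k S f \<Longrightarrow> Ck_on k S g \<Longrightarrow> Ck_on k S (\<lambda>x. f x + g x)"
proof (induction k arbitrary: f g)
  case 0
  then show ?case by (auto intro: continuous_intros)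
next
  case (Suc k)
  then show ?case
    by (intro Ck_on_SucI[where D="\<lambda>x v. frechet_derivative f (at x) v + frechet_derivative g (at x) v"])
      (auto intro!: derivative_eq_intros has_derivative_frechet)
qed

lemma Ck_on_sum: "open S \<Longrightarrow> (\<And>i. i \<in> I \<Longrightarrow> Ck_on k S (f i)) \<Longrightarrow> Ck_on k S (\<lambda>x. \<Sum>i\<in>I. f i x)"
  by (induction I rule: infinite_finite_induct) (simp_all add: Ck_on_add Ck_on_const del: Ck_on.simps)

lemma Ck_on_bilinear:
  assumes "bounded_bilinear B" "open S"
  shows "Ck_on k S f \<Longrightarrow> Ck_on k S g \<Longrightarrow> Ck_on k S (\<lambda>x. B (f x) (g x))"
proof (induction k arbitrary: f g)
  case 0
  then show ?case using bounded_bilinear.continuous_on[OF assms(1)] by auto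
next
  case (Suc k)
  show ?case
  proof (rule Ck_on_SucI[where D="\<lambda>x v. B (f x) (frechet_derivative g (at x) v) + B (frechet_derivative f (at x) v) (g x)"])
    fix x assume "x \<in> S"
    then show "((\<lambda>x. B (f x) (g x)) has_derivative (\<lambda>v. B (f x) (frechet_derivative g (at x) v) + B (frechet_derivative f (at x) v) (g x))) (at x)"
      using Suc.prems by (intro bounded_bilinear.FDERIV[OF assms(1)] has_derivative_frechet) auto
  next
    fix v
    show "Ck_on k S (\<lambda>x. B (f x) (frechet_derivative g (at x) v) + B (frechet_derivative f (at x) v) (g x))"
      using Suc.prems Ck_on_SucD[OF Suc.prems(1)] Ck_on_SucD[OF Suc.prems(2)]
      by (intro Ck_on_add assms Suc.IH Ck_on_frechet_derivative) auto
  qed (rule assms)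
qed

lemma Ck_on_compose:
  fixes f :: "'a::euclidean_space \<Rightarrow> 'b::euclidean_space" and g :: "'b \<Rightarrow> 'c::euclidean_space"
  assumes "open S" "open T" "f ` S \<subseteq> T"
  shows "Ck_on k S f \<Longrightarrow> Ck_on k T g \<Longrightarrow> Ck_on k S (\<lambda>x. g (f x))"
proof (induction k arbitrary: g)
  case 0
  then show ?case using assms by (auto intro: continuous_on_compose2)
next
  case (Suc k)
  \<comment> \<open>\<open>Ck_on\<close> controls derivatives only in a fixed direction, but the
    chain rule evaluates the derivative of \<open>g\<close> in a direction that moves with
    \<open>x\<close>. Expanding this direction in the basis leaves products of scalars with
    derivatives in fixed directions.\<close>
  let ?D = "\<lambda>x v. \<Sum>b\<in>Basis. (frechet_derivative f (at x) v \<bullet> b) *\<^sub>R frechet_derivative g (at (f x)) b"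
  show ?case
  proof (rule Ck_on_SucI[where D="?D"])
    fix x assume x: "x \<in> S"
    have d: "(f has_derivative frechet_derivative f (at x)) (at x)"
      "(g has_derivative frechet_derivative g (at (f x))) (at (f x))"
      using x Suc.prems assms by (auto intro!: has_derivative_frechet)
    interpret L: linear "frechet_derivative g (at (f x))"
      using d(2) has_derivative_linear by blast
    have rep: "frechet_derivative g (at (f x)) w = (\<Sum>b\<in>Basis. (w \<bullet> b) *\<^sub>R frechet_derivative g (at (f x)) b)" for w
      by (subst (1) euclidean_representation[symmetric, of w]) (simp only: L.sum L.scale)
    have "(\<lambda>v. frechet_derivative g (at (f x)) (frechet_derivative f (at x) v)) = ?D x"
      by (intro ext rep)
    then show "((\<lambda>x. g (f x)) has_derivative ?D x) (at x)"
      using has_derivative_compose[OF d] by (simp only:)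
  next
    fix v
    have f: "Ck_on k S f" using Ck_on_SucD[OF Suc.prems(1)] .
    show "Ck_on k S (\<lambda>x. ?D x v)"
    proof (intro Ck_on_sum assms Ck_on_bilinear[OF bounded_bilinear_scaleR])
      fix b :: 'b
      show "Ck_on k S (\<lambda>x. frechet_derivative f (at x) v \<bullet> b)"
        using Suc.prems(1) by (intro Ck_on_bilinear[OF bounded_bilinear_inner] assms Ck_on_const Ck_on_frechet_derivative)
      show "Ck_on k S (\<lambda>x. frechet_derivative g (at (f x)) b)"
        using Suc.prems(2) by (intro Suc.IH[OF f] Ck_on_frechet_derivative)
    qed
  qed (rule assms)
qed

text \<open>The derivative is a polynomial in \<open>inverse\<close> itself, so the induction
  hypothesis applies to it.\<close>

lemma Ck_on_inverse: "Ck_on k (- {0}) (inverse :: real \<Rightarrow> real)"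
proof (induction k)
  case 0
  then show ?case by (auto intro!: continuous_intros)
next
  case (Suc k)
  have "Ck_on k (- {0}) (\<lambda>x::real. - v * (inverse x * inverse x))" for v
    by (intro Ck_on_bilinear[OF bounded_bilinear_mult] Suc Ck_on_const) auto
  then show ?case
    by (intro Ck_on_SucI[where D="\<lambda>x v. - v * (inverse x * inverse x)"])
      (auto intro!: derivative_eq_intros)
qed

lemma Ck_on_locally:
  assumes "\<And>x. x \<in> S \<Longrightarrow> \<exists>U. open U \<and> x \<in> U \<and> Ck_on k U f"
  shows "Ck_on k S f"
  using assms
proof (induction k arbitrary: f)
  case 0
  have "continuous (at x) f" if "x \<in> S" for x
    using 0[OF that] by (auto simp: continuous_on_eq_continuous_at)
  then show ?case by (auto intro!: continuous_at_imp_continuous_on)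
next
  case (Suc k)
  have "Ck_on k S (\<lambda>x. frechet_derivative f (at x) v)" for v
    by (rule Suc.IH) (use Suc.prems in fastforce)
  moreover have "f differentiable (at x)" if "x \<in> S" for x
    using Suc.prems[OF that] by auto
  ultimately show ?case by simp
qed

text \<open>The germ form of \<open>smooth_on\<close>. It spares the open domains that would
  otherwise have to be intersected whenever two maps are combined.\<close>

definition smooth_near :: "('a::euclidean_space \<Rightarrow> 'b::euclidean_space) \<Rightarrow> 'a \<Rightarrow> bool" where
  "smooth_near f x \<longleftrightarrow> (\<exists>U. open U \<and> x \<in> U \<and> smooth_on U f)"

lemma smooth_on_iff_near:
  assumes "open S"
  shows "smooth_on S f \<longleftrightarrow> (\<forall>x\<in>S. smooth_near f x)"
proof
  assume "\<forall>x\<in>S. smooth_near f x"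
  then have "Ck_on k S f" for k
    unfolding smooth_near_def smooth_on_def by (intro Ck_on_locally) blast
  then show "smooth_on S f" unfolding smooth_on_def by blast
next
  assume "smooth_on S f"
  with assms show "\<forall>x\<in>S. smooth_near f x" unfolding smooth_near_def by blast
qed

lemma smooth_near_eventually: "smooth_near f x \<Longrightarrow> eventually (smooth_near f) (nhds x)"
  unfolding smooth_near_def eventually_nhds by auto

lemma smooth_near_cong:
  assumes "eventually (\<lambda>y. f y = g y) (nhds x)"
  shows "smooth_near f x \<longleftrightarrow> smooth_near g x"
proof -
  have *: "smooth_near g x" if sm: "smooth_near f x" and ev: "eventually (\<lambda>y. f y = g y) (nhds x)" for f g :: "'a \<Rightarrow> 'b"
  proof -
    obtain U where U: "open U" "x \<in> U" "smooth_on U f"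
      using sm unfolding smooth_near_def by blast
    obtain V where V: "open V" "x \<in> V" "\<forall>y\<in>V. f y = g y"
      using ev unfolding eventually_nhds by blast
    have "smooth_on (U \<inter> V) g"
      unfolding smooth_on_def
    proof
      fix k
      have "Ck_on k (U \<inter> V) f"
        by (rule Ck_on_subset[of k U]) (use U(3) in \<open>simp_all add: smooth_on_def\<close>)
      then show "Ck_on k (U \<inter> V) g"
        using Ck_on_cong[of "U \<inter> V" f g k] U V by auto
    qed
    then show ?thesis unfolding smooth_near_def using U V by (intro exI[of _ "U \<inter> V"]) auto
  qed
  have "eventually (\<lambda>y. g y = f y) (nhds x)" using assms by (rule eventually_mono) simp
  then show ?thesis using *[of f g] *[of g f] assms by blast
qed

lemma smooth_near_differentiable: "smooth_near f x \<Longrightarrow> f differentiable (at x)"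
  unfolding smooth_near_def smooth_on_def by (auto dest!: spec[of _ "Suc 0"])

lemma smooth_near_has_derivative:
  "smooth_near f x \<Longrightarrow> (f has_derivative frechet_derivative f (at x)) (at x)"
  by (intro has_derivative_frechet smooth_near_differentiable)

lemma smooth_near_isCont: "smooth_near f x \<Longrightarrow> isCont f x"
  by (simp add: differentiable_imp_continuous_within smooth_near_differentiable)

lemma smooth_near_deriv:
  "smooth_near f x \<Longrightarrow> smooth_near (\<lambda>y. frechet_derivative f (at y) v) x"
  unfolding smooth_near_def smooth_on_def by (blast intro: Ck_on_frechet_derivative)

lemma smooth_near_const [simp]: "smooth_near (\<lambda>x. c) x"
  unfolding smooth_near_def smooth_on_def by (intro exI[of _ UNIV] conjI allI Ck_on_const) auto

lemma smooth_near_linear: "bounded_linear f \<Longrightarrow> smooth_near f x"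
  unfolding smooth_near_def smooth_on_def by (intro exI[of _ UNIV] conjI allI Ck_on_linear) auto

lemma smooth_near_common_nhd:
  assumes "smooth_near f x" "smooth_near g x"
  obtains U where "open U" "x \<in> U" "\<And>k. Ck_on k U f" "\<And>k. Ck_on k U g"
proof -
  from assms obtain U V where "open U" "x \<in> U" "\<And>k. Ck_on k U f" "open V" "x \<in> V" "\<And>k. Ck_on k V g"
    unfolding smooth_near_def smooth_on_def by auto
  then show ?thesis by (intro that[of "U \<inter> V"]) (auto intro: Ck_on_subset)
qed

lemma smooth_near_add: "smooth_near f x \<Longrightarrow> smooth_near g x \<Longrightarrow> smooth_near (\<lambda>x. f x + g x) x"
  apply (erule (1) smooth_near_common_nhd, unfold smooth_near_def smooth_on_def)
  subgoal for U by (rule exI[of _ U]) (blast intro: Ck_on_add)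
  done

lemma smooth_near_bilinear:
  "bounded_bilinear B \<Longrightarrow> smooth_near f x \<Longrightarrow> smooth_near g x \<Longrightarrow> smooth_near (\<lambda>x. B (f x) (g x)) x"
  apply (erule (1) smooth_near_common_nhd, unfold smooth_near_def smooth_on_def)
  subgoal for U by (rule exI[of _ U]) (blast intro: Ck_on_bilinear)
  done

lemmas smooth_near_mult = smooth_near_bilinear[OF bounded_bilinear_mult]
lemmas smooth_near_scaleR = smooth_near_bilinear[OF bounded_bilinear_scaleR]
lemmas smooth_near_inner = smooth_near_bilinear[OF bounded_bilinear_inner]

lemma smooth_near_sum:
  "(\<And>i. i \<in> I \<Longrightarrow> smooth_near (f i) x) \<Longrightarrow> smooth_near (\<lambda>x. \<Sum>i\<in>I. f i x) x"
  by (induction I rule: infinite_finite_induct) (simp_all add: smooth_near_add)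

lemma smooth_near_compose:
  assumes "smooth_near f x" "smooth_near g (f x)"
  shows "smooth_near (\<lambda>x. g (f x)) x"
proof -
  obtain U V where UV: "open U" "x \<in> U" "\<And>k. Ck_on k U f" "open V" "f x \<in> V" "\<And>k. Ck_on k V g"
    using assms unfolding smooth_near_def smooth_on_def by auto
  have "isCont f x" using assms(1) by (rule smooth_near_isCont)
  then have "eventually (\<lambda>y. f y \<in> V) (nhds x)" using UV
    by (auto simp: isCont_def eventually_nhds_conv_at dest: topological_tendstoD)
  then obtain W where W: "open W" "x \<in> W" "\<forall>y\<in>W. f y \<in> V" unfolding eventually_nhds by blast
  have "Ck_on k (U \<inter> W) (\<lambda>x. g (f x))" for k
    using UV W by (intro Ck_on_compose[of "U \<inter> W" V f k g]) (auto intro: Ck_on_subset)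
  then show ?thesis unfolding smooth_near_def smooth_on_def
    using UV W by (intro exI[of _ "U \<inter> W"]) auto
qed

lemma smooth_near_inverse:
  fixes f :: "'a::euclidean_space \<Rightarrow> real"
  assumes "smooth_near f x" "f x \<noteq> 0"
  shows "smooth_near (\<lambda>x. inverse (f x)) x"
proof (rule smooth_near_compose[OF assms(1)])
  show "smooth_near inverse (f x)"
    unfolding smooth_near_def smooth_on_def using Ck_on_inverse assms(2)
    by (intro exI[of _ "- {0}"]) auto
qed

lemma smooth_near_componentwise:
  "smooth_near f x \<longleftrightarrow> (\<forall>i\<in>Basis. smooth_near (\<lambda>x. f x \<bullet> i) x)"
proof safe
  assume *: "\<forall>i\<in>Basis. smooth_near (\<lambda>x. f x \<bullet> i) x"
  have "smooth_near (\<lambda>x. \<Sum>i\<in>Basis. (f x \<bullet> i) *\<^sub>R i) x"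
    using * by (intro smooth_near_sum smooth_near_scaleR) auto
  then show "smooth_near f x" by (simp add: euclidean_representation)
qed (auto intro: smooth_near_inner[OF _ smooth_near_const])

lemma smooth_near_Pair:
  assumes "smooth_near f x" "smooth_near g x"
  shows "smooth_near (\<lambda>x. (f x, g x)) x"
  unfolding smooth_near_componentwise[of "\<lambda>x. (f x, g x)"]
  using assms by (auto simp: Basis_prod_def intro: smooth_near_inner[OF _ smooth_near_const])

lemma smooth_near_vec_lambda:
  fixes f :: "'a::euclidean_space \<Rightarrow> real^'m"
  assumes "\<And>a. smooth_near (\<lambda>x. f x $ a) x"
  shows "smooth_near f x"
  unfolding smooth_near_componentwise[of f]
  using assms by (auto simp: Basis_vec_def inner_axis)

text \<open>Smoothness jointly in point and direction, as the fibre part of a change of tangent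
  bundle charts requires. By linearity the expression is a finite sum of components of the direction
  times derivatives in fixed directions.\<close>

lemma smooth_near_deriv_apply:
  assumes "smooth_near f x"
  shows "smooth_near (\<lambda>(y, v). frechet_derivative f (at y) v) (x, v)"
proof -
  obtain U where U: "open U" "x \<in> U" "\<And>y. y \<in> U \<Longrightarrow> smooth_near f y"
    using smooth_near_eventually[OF assms] unfolding eventually_nhds by auto
  have eq: "frechet_derivative f (at y) v = (\<Sum>b\<in>Basis. (v \<bullet> b) *\<^sub>R frechet_derivative f (at y) b)"
    if "y \<in> U" for y v
  proof -
    interpret L: linear "frechet_derivative f (at y)"
      using smooth_near_has_derivative[OF U(3)[OF that]] has_derivative_linear by blast
    show ?thesis
      by (subst (1) euclidean_representation[symmetric, of v]) (simp only: L.sum L.scale)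
  qed
  have "eventually (\<lambda>z. (case z of (y, v) \<Rightarrow> frechet_derivative f (at y) v) =
      (\<Sum>b\<in>Basis. (snd z \<bullet> b) *\<^sub>R frechet_derivative f (at (fst z)) b)) (nhds (x, v))"
    unfolding eventually_nhds using U(1,2)
    by (intro exI[of _ "U \<times> UNIV"]) (auto intro!: open_Times eq)
  moreover have "smooth_near (\<lambda>z. \<Sum>b\<in>Basis. (snd z \<bullet> b) *\<^sub>R frechet_derivative f (at (fst z)) b) (x, v)"
  proof (intro smooth_near_sum smooth_near_scaleR smooth_near_inner smooth_near_const)
    show "smooth_near snd (x, v)" by (intro smooth_near_linear bounded_linear_snd)
    fix b
    show "smooth_near (\<lambda>z. frechet_derivative f (at (fst z)) b) (x, v)"
      by (rule smooth_near_compose[OF smooth_near_linear[OF bounded_linear_fst]])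
        (simp add: smooth_near_deriv assms)
  qed
  ultimately show ?thesis by (simp add: smooth_near_cong)
qed

section \<open>Second derivatives and primitives\<close>

lemma smooth_near_has_real_derivative_line:
  fixes f :: "'a::euclidean_space \<Rightarrow> real"
  assumes "smooth_near f (x + s *\<^sub>R v)"
  shows "((\<lambda>s. f (x + s *\<^sub>R v)) has_real_derivative frechet_derivative f (at (x + s *\<^sub>R v)) v) (at s)"
proof -
  note d = smooth_near_has_derivative[OF assms]
  have "((\<lambda>s. x + s *\<^sub>R v) has_derivative (\<lambda>r. r *\<^sub>R v)) (at s)"
    by (auto intro!: derivative_eq_intros)
  from has_derivative_compose[OF this d]
  have "((\<lambda>s. f (x + s *\<^sub>R v)) has_derivative (\<lambda>r. frechet_derivative f (at (x + s *\<^sub>R v)) (r *\<^sub>R v))) (at s)" .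
  moreover have "frechet_derivative f (at (x + s *\<^sub>R v)) (r *\<^sub>R v) = frechet_derivative f (at (x + s *\<^sub>R v)) v * r" for r
    using linear_scale[OF has_derivative_linear[OF d], of r v] by (simp add: mult.commute)
  ultimately show ?thesis unfolding has_field_derivative_def by simp
qed

text \<open>The mean value theorem is used twice: along \<open>v\<close> for the increment of
  \<open>f\<close> in the direction \<open>h *\<^sub>R w\<close>, then along \<open>w\<close> for
  the resulting increment of the \<open>v\<close>-derivative.\<close>

lemma second_difference_mvt:
  fixes f :: "'a::euclidean_space \<Rightarrow> real"
  assumes "h > 0" and sm: "\<And>s t. 0 \<le> s \<Longrightarrow> s \<le> h \<Longrightarrow> 0 \<le> t \<Longrightarrow> t \<le> h \<Longrightarrow> smooth_near f (x + s *\<^sub>R v + t *\<^sub>R w)"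
  shows "\<exists>s t. 0 \<le> s \<and> s \<le> h \<and> 0 \<le> t \<and> t \<le> h \<and>
     f (x + h *\<^sub>R v + h *\<^sub>R w) - f (x + h *\<^sub>R v) - f (x + h *\<^sub>R w) + f x =
     h * h * frechet_derivative (\<lambda>y. frechet_derivative f (at y) v) (at (x + s *\<^sub>R v + t *\<^sub>R w)) w"
proof -
  define g where "g s = f (x + h *\<^sub>R w + s *\<^sub>R v) - f (x + s *\<^sub>R v)" for s
  have "(g has_real_derivative
      frechet_derivative f (at (x + h *\<^sub>R w + s *\<^sub>R v)) v - frechet_derivative f (at (x + s *\<^sub>R v)) v) (at s)"
    if "0 \<le> s" "s \<le> h" for s
    unfolding g_def using sm[OF that, of h] sm[OF that, of 0] assms(1)
    by (intro DERIV_diff smooth_near_has_real_derivative_line) (simp_all add: algebra_simps)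
  then have "\<exists>s. 0 < s \<and> s < h \<and> g h - g 0 = (h - 0) *
      (frechet_derivative f (at (x + h *\<^sub>R w + s *\<^sub>R v)) v - frechet_derivative f (at (x + s *\<^sub>R v)) v)"
    by (intro MVT2 assms)
  then obtain s where s: "0 < s" "s < h" "g h - g 0 = h *
      (frechet_derivative f (at (x + h *\<^sub>R w + s *\<^sub>R v)) v - frechet_derivative f (at (x + s *\<^sub>R v)) v)"
    by auto
  define k where "k t = frechet_derivative f (at (x + s *\<^sub>R v + t *\<^sub>R w)) v" for t
  have "(k has_real_derivative
      frechet_derivative (\<lambda>y. frechet_derivative f (at y) v) (at (x + s *\<^sub>R v + t *\<^sub>R w)) w) (at t)"
    if "0 \<le> t" "t \<le> h" for t
    unfolding k_def using sm[of s t] s that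
    by (intro smooth_near_has_real_derivative_line[where f="\<lambda>y. frechet_derivative f (at y) v"] smooth_near_deriv) auto
  then have "\<exists>t. 0 < t \<and> t < h \<and> k h - k 0 = (h - 0) *
      frechet_derivative (\<lambda>y. frechet_derivative f (at y) v) (at (x + s *\<^sub>R v + t *\<^sub>R w)) w"
    by (intro MVT2 assms)
  then obtain t where t: "0 < t" "t < h" "k h - k 0 = h *
      frechet_derivative (\<lambda>y. frechet_derivative f (at y) v) (at (x + s *\<^sub>R v + t *\<^sub>R w)) w"
    by auto
  have "f (x + h *\<^sub>R v + h *\<^sub>R w) - f (x + h *\<^sub>R v) - f (x + h *\<^sub>R w) + f x = g h - g 0"
    by (simp add: g_def algebra_simps)
  also have "\<dots> = h * (k h - k 0)"
    by (simp add: s(3) k_def algebra_simps)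
  finally show ?thesis using s t by (intro exI[of _ s] exI[of _ t]) simp
qed

text \<open>The second difference is symmetric in \<open>v\<close> and \<open>w\<close>, so it
  equals \<open>h * h\<close> times either mixed derivative at suitable nearby points. If the two
  differed at \<open>x\<close>, continuity would keep these values apart for small
  \<open>h\<close>.\<close>

lemma second_derivative_symmetric:
  fixes f :: "'a::euclidean_space \<Rightarrow> real"
  assumes "smooth_near f x"
  shows "frechet_derivative (\<lambda>y. frechet_derivative f (at y) v) (at x) w =
     frechet_derivative (\<lambda>y. frechet_derivative f (at y) w) (at x) v"
proof (rule ccontr)
  define F where "F = (\<lambda>y. frechet_derivative (\<lambda>y. frechet_derivative f (at y) v) (at y) w)"
  define H where "H = (\<lambda>y. frechet_derivative (\<lambda>y. frechet_derivative f (at y) w) (at y) v)"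
  assume "\<not> ?thesis"
  then have ne: "F x \<noteq> H x" by (simp add: F_def H_def)
  \<comment> \<open>Half the gap, so that the open intervals of radius \<open>e\<close> around
    \<open>F x\<close> and \<open>H x\<close> are disjoint.\<close>
  define e where "e = \<bar>F x - H x\<bar> / 2"
  have e: "e > 0" using ne by (simp add: e_def)
  have "isCont F x" "isCont H x"
    unfolding F_def H_def by (intro smooth_near_isCont smooth_near_deriv assms)+
  then have "eventually (\<lambda>y. dist (F y) (F x) < e) (nhds x)" "eventually (\<lambda>y. dist (H y) (H x) < e) (nhds x)"
    using e by (auto simp: isCont_def eventually_nhds_conv_at dest: tendstoD)
  with smooth_near_eventually[OF assms]
  have "eventually (\<lambda>y. smooth_near f y \<and> dist (F y) (F x) < e \<and> dist (H y) (H x) < e) (nhds x)"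
    by eventually_elim auto
  then obtain d where d: "d > 0" "\<And>y. dist y x < d \<Longrightarrow> smooth_near f y \<and> dist (F y) (F x) < e \<and> dist (H y) (H x) < e"
    unfolding eventually_nhds_metric by auto
  \<comment> \<open>Small enough for the parallelogram spanned by \<open>h *\<^sub>R v\<close> and
    \<open>h *\<^sub>R w\<close> at \<open>x\<close> to stay in the ball of radius \<open>d\<close>;
    the summand 1 keeps the denominator positive when both vectors vanish.\<close>
  define h where "h = d / (2 * (1 + norm v + norm w))"
  have h: "h > 0" using d(1) by (simp add: h_def add_pos_nonneg)
  have small: "dist (x + s *\<^sub>R v + t *\<^sub>R w) x < d" if "0 \<le> s" "s \<le> h" "0 \<le> t" "t \<le> h" for s t
  proof -
    have "norm (s *\<^sub>R v + t *\<^sub>R w) \<le> s * norm v + t * norm w"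
      using norm_triangle_ineq[of "s *\<^sub>R v" "t *\<^sub>R w"] that by simp
    also have "\<dots> \<le> h * norm v + h * norm w"
      using that by (intro add_mono mult_right_mono) auto
    also have "\<dots> \<le> h * (1 + norm v + norm w)" using h by (simp add: algebra_simps)
    also have "\<dots> = d / 2"
    proof -
      have "1 + norm v + norm w \<noteq> 0" by (smt (verit) norm_ge_zero)
      then show ?thesis by (simp add: h_def divide_simps)
    qed
    also have "\<dots> < d" using d(1) by simp
    finally show ?thesis by (simp add: dist_norm add.assoc)
  qed
  have small': "dist (x + s *\<^sub>R w + t *\<^sub>R v) x < d" if "0 \<le> s" "s \<le> h" "0 \<le> t" "t \<le> h" for s t
    using small[of t s] that by (simp add: algebra_simps)
  obtain s t where st: "0 \<le> s" "s \<le> h" "0 \<le> t" "t \<le> h"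
     "f (x + h *\<^sub>R v + h *\<^sub>R w) - f (x + h *\<^sub>R v) - f (x + h *\<^sub>R w) + f x = h * h * F (x + s *\<^sub>R v + t *\<^sub>R w)"
    using second_difference_mvt[OF h, of f x v w] small d(2) unfolding F_def by blast
  obtain s' t' where st': "0 \<le> s'" "s' \<le> h" "0 \<le> t'" "t' \<le> h"
     "f (x + h *\<^sub>R w + h *\<^sub>R v) - f (x + h *\<^sub>R w) - f (x + h *\<^sub>R v) + f x = h * h * H (x + s' *\<^sub>R w + t' *\<^sub>R v)"
    using second_difference_mvt[OF h, of f x w v] small' d(2) unfolding H_def by blast
  have "h * h * F (x + s *\<^sub>R v + t *\<^sub>R w) = h * h * H (x + s' *\<^sub>R w + t' *\<^sub>R v)"
    using st(5) st'(5) by (simp add: algebra_simps)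
  then have "F (x + s *\<^sub>R v + t *\<^sub>R w) = H (x + s' *\<^sub>R w + t' *\<^sub>R v)" using h by simp
  moreover have "dist (F (x + s *\<^sub>R v + t *\<^sub>R w)) (F x) < e" "dist (H (x + s' *\<^sub>R w + t' *\<^sub>R v)) (H x) < e"
    using small[OF st(1-4)] small'[OF st'(1-4)] d(2) by auto
  ultimately show False unfolding e_def dist_real_def by (auto simp: abs_if split: if_splits)
qed

text \<open>The primitive is the usual line integral \<open>f y = \<integral>\<^sub>0\<^sup>1 B (x + t (y - x)) \<bullet> (y - x) dt\<close>; by symmetry
  of the derivative of \<open>B\<close>, the gradient of the integrand is the \<open>t\<close>-derivative of \<open>t B (x + t (y - x))\<close>.\<close>

lemma poincare_ball:
  fixes B :: "'a::euclidean_space \<Rightarrow> 'a"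
  assumes sm: "\<And>y. y \<in> ball x r \<Longrightarrow> smooth_near B y"
    and sym: "\<And>y u w. y \<in> ball x r \<Longrightarrow>
      frechet_derivative B (at y) u \<bullet> w = frechet_derivative B (at y) w \<bullet> u"
  shows "\<exists>f. \<forall>y\<in>ball x r. (f has_derivative (\<lambda>v. B y \<bullet> v)) (at y)"
proof -
  define z where "z y t = x + t *\<^sub>R (y - x)" for y :: 'a and t :: real
  have z: "z y t \<in> ball x r" if "y \<in> ball x r" "t \<in> cbox 0 1" for y t
  proof -
    have "norm (t *\<^sub>R (y - x)) \<le> norm (y - x)"
      using that(2) by (simp add: mult_left_le_one_le)
    then show ?thesis using that(1) unfolding z_def by (simp add: dist_norm norm_minus_commute)
  qed
  define D where "D y = frechet_derivative B (at y)" for y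
  define k where "k y t = t *\<^sub>R D (z y t) (y - x) + B (z y t)" for y t
  have D: "(B has_derivative D y) (at y)" if "y \<in> ball x r" for y
    unfolding D_def by (rule smooth_near_has_derivative[OF sm[OF that]])
  have contB: "continuous_on (ball x r) B"
    by (rule continuous_at_imp_continuous_on) (use sm smooth_near_isCont in blast)
  have contD: "continuous_on (ball x r) (\<lambda>y. D y b)" for b
    unfolding D_def
    by (rule continuous_at_imp_continuous_on) (use sm smooth_near_isCont[OF smooth_near_deriv] in blast)
  have contz: "continuous_on S (\<lambda>(y, t). z y t)" for S
    unfolding z_def case_prod_beta by (intro continuous_intros)
  have zim: "(\<lambda>(y, t). z y t) ` (ball x r \<times> cbox 0 1) \<subseteq> ball x r" using z by auto
  have contBz: "continuous_on (ball x r \<times> cbox 0 1) (\<lambda>(y, t). B (z y t))"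
    using continuous_on_compose2[OF contB contz zim] by (simp add: case_prod_beta)
  have contDz: "continuous_on (ball x r \<times> cbox 0 1) (\<lambda>(y, t). D (z y t) b)" for b
    using continuous_on_compose2[OF contD contz zim] by (simp add: case_prod_beta)
  \<comment> \<open>Continuity of \<open>D\<close> is known only for fixed directions; the expansion
    transfers it to the moving direction \<open>y - x\<close>.\<close>
  have Drep: "D (z y t) w = (\<Sum>b\<in>Basis. (w \<bullet> b) *\<^sub>R D (z y t) b)" if "y \<in> ball x r" "t \<in> cbox 0 1" for y t w
  proof -
    interpret L: linear "D (z y t)" using D[OF z[OF that]] has_derivative_linear by blast
    show ?thesis by (subst (1) euclidean_representation[symmetric, of w]) (simp only: L.sum L.scale)
  qed
  have "continuous_on (ball x r \<times> cbox 0 1) (\<lambda>(y, t). (\<Sum>b\<in>Basis. ((y - x) \<bullet> b) *\<^sub>R D (z y t) b))"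
    using contDz unfolding case_prod_beta by (intro continuous_intros) auto
  then have contDz': "continuous_on (ball x r \<times> cbox 0 1) (\<lambda>(y, t). D (z y t) (y - x))"
    by (rule continuous_on_eq) (use Drep in force)
  have contk: "continuous_on (ball x r \<times> cbox 0 1) (\<lambda>(y, t). k y t)"
    using contDz' contBz unfolding k_def case_prod_beta by (intro continuous_intros) auto
  define f where "f y = integral (cbox 0 1) (\<lambda>t. B (z y t) \<bullet> (y - x))" for y
  have "(f has_derivative (\<lambda>v. B y \<bullet> v)) (at y)" if y: "y \<in> ball x r" for y
  proof -
    have sec: "continuous_on (cbox 0 1) (\<lambda>t. g y t)" if "y \<in> ball x r" "continuous_on (ball x r \<times> cbox 0 1) (\<lambda>(y, t). g y t)"
      for y and g :: "'a \<Rightarrow> real \<Rightarrow> 'a"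
    proof -
      have "continuous_on (cbox 0 1) (\<lambda>t. (y, t))" by (intro continuous_intros)
      moreover have "(\<lambda>t. (y, t)) ` cbox 0 1 \<subseteq> ball x r \<times> cbox 0 1" using that(1) by auto
      ultimately show ?thesis using continuous_on_compose2[OF that(2)] by fastforce
    qed
    have kint: "((\<lambda>t. k y t) has_integral B y) (cbox 0 1)"
    proof -
      have "((\<lambda>t. t *\<^sub>R B (z y t)) has_vector_derivative k y t) (at t within {0..1})" if "t \<in> {0..1}" for t
      proof -
        have "((\<lambda>t. z y t) has_derivative (\<lambda>s. s *\<^sub>R (y - x))) (at t within {0..1})"
          unfolding z_def by (auto intro!: derivative_eq_intros)
        moreover have "(B has_derivative D (z y t)) (at (z y t))" using D z y that by simp
        ultimately have "((\<lambda>t. B (z y t)) has_derivative (\<lambda>s. D (z y t) (s *\<^sub>R (y - x)))) (at t within {0..1})"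
          by (rule has_derivative_compose)
        then have "((\<lambda>t. t *\<^sub>R B (z y t)) has_derivative (\<lambda>s. t *\<^sub>R D (z y t) (s *\<^sub>R (y - x)) + s *\<^sub>R B (z y t))) (at t within {0..1})"
          by (auto intro!: derivative_eq_intros)
        moreover have "D (z y t) (s *\<^sub>R (y - x)) = s *\<^sub>R D (z y t) (y - x)" for s
          using that by (intro linear_scale[OF has_derivative_linear[OF D[OF z[OF y]]]]) simp
        ultimately show ?thesis unfolding has_vector_derivative_def k_def
          by (simp add: algebra_simps)
      qed
      then have "((\<lambda>t. k y t) has_integral (1 *\<^sub>R B (z y 1) - 0 *\<^sub>R B (z y 0))) {0..1}"
        by (intro fundamental_theorem_of_calculus) auto
      then show ?thesis by (simp add: z_def)
    qed
    \<comment> \<open>Differentiation under the integral sign. The derivative of the integrand is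
      packaged as the functional \<open>blinfun_inner_right (k y t)\<close>, so that its integral is
      the functional belonging to the integral of \<open>k y\<close>, which is
      \<open>B y\<close>.\<close>
    have "((\<lambda>y. integral (cbox 0 1) (\<lambda>t. B (z y t) \<bullet> (y - x))) has_derivative
        integral (cbox 0 1) (\<lambda>t. blinfun_inner_right (k y t))) (at y within ball x r)"
    proof (rule leibniz_rule)
      fix y' t assume y': "y' \<in> ball x r" and t: "t \<in> cbox 0 (1::real)"
      have "((\<lambda>y. z y t) has_derivative (\<lambda>v. t *\<^sub>R v)) (at y' within ball x r)"
        unfolding z_def by (auto intro!: derivative_eq_intros)
      moreover have "(B has_derivative D (z y' t)) (at (z y' t))" using D z y' t by simp
      ultimately have "((\<lambda>y. B (z y t)) has_derivative (\<lambda>v. D (z y' t) (t *\<^sub>R v))) (at y' within ball x r)"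
        by (rule has_derivative_compose)
      then have "((\<lambda>y. B (z y t) \<bullet> (y - x)) has_derivative
          (\<lambda>v. B (z y' t) \<bullet> v + D (z y' t) (t *\<^sub>R v) \<bullet> (y' - x))) (at y' within ball x r)"
        by (auto intro!: derivative_eq_intros)
      moreover have "B (z y' t) \<bullet> v + D (z y' t) (t *\<^sub>R v) \<bullet> (y' - x) = blinfun_inner_right (k y' t) v" for v
        using sym[OF z[OF y' t], of "t *\<^sub>R v" "y' - x"]
        by (simp add: D_def k_def inner_simps inner_commute)
      ultimately show "((\<lambda>y. B (z y t) \<bullet> (y - x)) has_derivative blinfun_inner_right (k y' t)) (at y' within ball x r)"
        by (simp add: fun_eq_iff)
    next
      fix y' assume y': "y' \<in> ball x r"
      show "(\<lambda>t. B (z y' t) \<bullet> (y' - x)) integrable_on cbox 0 1"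
        by (intro integrable_continuous continuous_intros sec[OF y' contBz])
    next
      show "continuous_on (ball x r \<times> cbox 0 1) (\<lambda>(y, t). blinfun_inner_right (k y t))"
        using contk unfolding case_prod_beta by (intro continuous_intros)
    qed (use y in auto)
    moreover have "integral (cbox 0 1) (\<lambda>t. blinfun_inner_right (k y t)) = blinfun_inner_right (B y)"
      using has_integral_linear[OF kint bounded_linear_blinfun_inner_right]
      by (simp add: o_def integral_unique)
    ultimately have "(f has_derivative (\<lambda>v. B y \<bullet> v)) (at y within ball x r)"
      unfolding f_def by (simp add: fun_eq_iff)
    then show ?thesis using y at_within_open[OF y open_ball] by simp
  qed
  then show ?thesis by blast
qed

section \<open>Charts and tangent vectors\<close>

lemma is_chart_inj: "is_chart c \<Longrightarrow> inj_on (snd c) (fst c)"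
  and is_chart_open: "is_chart c \<Longrightarrow> open (snd c ` fst c)"
  by (simp_all add: is_chart_def)

lemma chart_inv_chart: "is_chart c \<Longrightarrow> p \<in> fst c \<Longrightarrow> chart_inv c (snd c p) = p"
  by (simp add: chart_inv_def is_chart_inj)

lemma chart_chart_inv: "e \<in> snd c ` fst c \<Longrightarrow> snd c (chart_inv c e) = e"
  by (simp add: chart_inv_def f_inv_into_f)

lemma chart_inv_in: "e \<in> snd c ` fst c \<Longrightarrow> chart_inv c e \<in> fst c"
  by (simp add: chart_inv_def inv_into_into)

lemma chartsD:
  assumes "c \<in> charts A"
  shows "fst c \<subseteq> mcarrier A" "is_chart c" "\<And>d. d \<in> A \<Longrightarrow> compatible c d"
  using assms by (auto simp: charts_def)

lemma atlas_subset_charts: "smooth_atlas A \<Longrightarrow> c \<in> A \<Longrightarrow> c \<in> charts A"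
  by (auto simp: charts_def smooth_atlas_def mcarrier_def)

lemma compatible_smooth_near:
  assumes "compatible c d" "is_chart c" "is_chart d" "p \<in> fst c" "p \<in> fst d"
  shows "smooth_near (snd d \<circ> chart_inv c) (snd c p)" "smooth_near (snd c \<circ> chart_inv d) (snd d p)"
  using assms unfolding compatible_def by (auto simp: smooth_on_iff_near)

lemma mcarrier_charts: "p \<in> mcarrier A \<Longrightarrow> smooth_atlas A \<Longrightarrow> \<exists>c\<in>charts A. p \<in> fst c"
  unfolding mcarrier_def using atlas_subset_charts by blast

text \<open>The topology is tested on the charts of the given atlas; this extends the test to the
  maximal atlas. The image is a union of preimages of open sets under the continuous transition maps
  to the charts in \<open>A\<close>.\<close>

lemma open_chart_image:
  assumes A: "smooth_atlas A" and c: "c \<in> charts A"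
    and W: "W \<subseteq> mcarrier A" "\<And>e. e \<in> A \<Longrightarrow> open (snd e ` (fst e \<inter> W))"
  shows "open (snd c ` (fst c \<inter> W))"
proof -
  have "snd c ` (fst c \<inter> W) = (\<Union>e\<in>A. snd c ` (fst c \<inter> fst e) \<inter> (snd e \<circ> chart_inv c) -` (snd e ` (fst e \<inter> W)))"
    (is "?L = ?R")
  proof (intro equalityI subsetI)
    fix x assume "x \<in> ?L"
    then obtain p where p: "x = snd c p" "p \<in> fst c" "p \<in> W" by blast
    then obtain e where "e \<in> A" "p \<in> fst e" using W(1) by (auto simp: mcarrier_def)
    then show "x \<in> ?R" using p chart_inv_chart[OF chartsD(2)[OF c] p(2)] by auto
  next
    fix x assume "x \<in> ?R"
    then obtain e p q where e: "e \<in> A" and p: "x = snd c p" "p \<in> fst c" "p \<in> fst e"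
      and q: "snd e (chart_inv c x) = snd e q" "q \<in> fst e" "q \<in> W" by auto
    have "snd e p = snd e q" using q(1) p chart_inv_chart[OF chartsD(2)[OF c] p(2)] by simp
    moreover have "inj_on (snd e) (fst e)" using A e is_chart_inj[of e] by (simp add: smooth_atlas_def)
    ultimately have "p = q" using p q by (auto dest: inj_onD)
    then show "x \<in> ?L" using p q by auto
  qed
  moreover have "open (snd c ` (fst c \<inter> fst e) \<inter> (snd e \<circ> chart_inv c) -` (snd e ` (fst e \<inter> W)))" if e: "e \<in> A" for e
  proof (rule continuous_open_preimage[unfolded vimage_def, folded vimage_def])
    have "compatible c e" using chartsD(3)[OF c e] .
    then have s: "smooth_on (snd c ` (fst c \<inter> fst e)) (snd e \<circ> chart_inv c)" and
      o: "open (snd c ` (fst c \<inter> fst e))" by (auto simp: compatible_def)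
    show "open (snd c ` (fst c \<inter> fst e))" by (rule o)
    show "continuous_on (snd c ` (fst c \<inter> fst e)) (snd e \<circ> chart_inv c)"
      using s o smooth_near_isCont by (intro continuous_at_imp_continuous_on) (auto simp: smooth_on_iff_near)
    show "open (snd e ` (fst e \<inter> W))" using W(2)[OF e] .
  qed
  ultimately show ?thesis by auto
qed

lemma topspace_mtopology:
  assumes "smooth_atlas A" shows "topspace (mtopology A) = mcarrier A"
proof -
  have "openin (mtopology A) (mcarrier A)"
    unfolding openin_mtopology[OF assms]
  proof (intro conjI ballI)
    fix c assume c: "c \<in> A"
    then have "fst c \<inter> mcarrier A = fst c" by (auto simp: mcarrier_def)
    then show "open (snd c ` (fst c \<inter> mcarrier A))"
      using assms c is_chart_open[of c] by (auto simp: smooth_atlas_def)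
  qed simp
  then show ?thesis
    using openin_mtopology[OF assms, of "topspace (mtopology A)"] openin_subset by blast
qed

lemma openin_charts_image:
  assumes "smooth_atlas A" "c \<in> charts A" "openin (mtopology A) W"
  shows "open (snd c ` (fst c \<inter> W))"
  using assms by (intro open_chart_image[OF assms(1,2)]) (auto simp: openin_mtopology)

lemma openin_chart_domain:
  assumes "smooth_atlas A" "c \<in> charts A"
  shows "openin (mtopology A) (fst c)"
  unfolding openin_mtopology[OF assms(1)]
proof (intro conjI ballI)
  fix d assume "d \<in> A"
  then have "compatible c d" using chartsD(3)[OF assms(2)] by blast
  then show "open (snd d ` (fst d \<inter> fst c))" by (simp add: compatible_def Int_commute)
qed (use chartsD(1)[OF assms(2)] in auto)

text \<open>Charts of the maximal atlas are by definition compatible only with charts in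
  \<open>A\<close>. Near \<open>p\<close> the transition map between two of them is factored through
  a chart \<open>e\<close> in \<open>A\<close>.\<close>

lemma charts_smooth_near:
  assumes A: "smooth_atlas A" and c: "c \<in> charts A" and d: "d \<in> charts A" and p: "p \<in> fst c" "p \<in> fst d"
  shows "smooth_near (snd d \<circ> chart_inv c) (snd c p)"
proof -
  obtain e where e: "e \<in> A" "p \<in> fst e" using chartsD(1)[OF c] p(1) by (auto simp: mcarrier_def)
  have ec: "e \<in> charts A" using A e by (intro atlas_subset_charts)
  have sm: "smooth_near (\<lambda>x. (snd d \<circ> chart_inv e) ((snd e \<circ> chart_inv c) x)) (snd c p)"
  proof (rule smooth_near_compose[where f="snd e \<circ> chart_inv c" and g="snd d \<circ> chart_inv e"])
    show "smooth_near (snd e \<circ> chart_inv c) (snd c p)"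
      by (rule compatible_smooth_near(1)[OF chartsD(3)[OF c e(1)] chartsD(2)[OF c] chartsD(2)[OF ec] p(1) e(2)])
    show "smooth_near (snd d \<circ> chart_inv e) ((snd e \<circ> chart_inv c) (snd c p))"
      using compatible_smooth_near(2)[OF chartsD(3)[OF d e(1)] chartsD(2)[OF d] chartsD(2)[OF ec] p(2) e(2)]
      by (simp add: chart_inv_chart[OF chartsD(2)[OF c] p(1)])
  qed
  have ev: "eventually (\<lambda>x. (snd d \<circ> chart_inv e) ((snd e \<circ> chart_inv c) x) = (snd d \<circ> chart_inv c) x) (nhds (snd c p))"
    unfolding eventually_nhds
    using openin_charts_image[OF A c openin_chart_domain[OF A ec]] e(2) p
    by (intro exI[of _ "snd c ` (fst c \<inter> fst e)"]) (auto simp: chart_inv_chart chartsD(2)[OF c] chartsD(2)[OF ec])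
  show ?thesis using smooth_near_cong[OF ev] sm by blast
qed

lemma openin_chart_preimage:
  assumes A: "smooth_atlas A" and c: "c \<in> charts A" and U: "open U"
  shows "openin (mtopology A) (fst c \<inter> snd c -` U)"
  unfolding openin_mtopology[OF A]
proof (intro conjI ballI)
  fix d assume "d \<in> A"
  then have d: "d \<in> charts A" by (rule atlas_subset_charts[OF A])
  have o: "open (snd d ` (fst d \<inter> fst c))" by (rule openin_charts_image[OF A d openin_chart_domain[OF A c]])
  have "snd d ` (fst d \<inter> (fst c \<inter> snd c -` U)) = snd d ` (fst d \<inter> fst c) \<inter> (snd c \<circ> chart_inv d) -` U"
    using chart_inv_chart[OF chartsD(2)[OF d]] by auto
  moreover have "continuous_on (snd d ` (fst d \<inter> fst c)) (snd c \<circ> chart_inv d)"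
    using charts_smooth_near[OF A d c] smooth_near_isCont by (intro continuous_at_imp_continuous_on) blast
  ultimately show "open (snd d ` (fst d \<inter> (fst c \<inter> snd c -` U)))"
    using continuous_open_preimage[OF _ o U] by metis
qed (use chartsD(1)[OF c] in auto)

section \<open>Neighbourhood filters and smooth functions in charts\<close>

abbreviation mnhds :: "('a, 'e::euclidean_space) atlas \<Rightarrow> 'a \<Rightarrow> 'a filter" where
  "mnhds A p \<equiv> nhdsin (mtopology A) p"

lemma eventually_mnhds:
  "smooth_atlas A \<Longrightarrow> p \<in> mcarrier A \<Longrightarrow>
    eventually P (mnhds A p) \<longleftrightarrow> (\<exists>W. openin (mtopology A) W \<and> p \<in> W \<and> (\<forall>q\<in>W. P q))"
  by (simp add: eventually_nhdsin topspace_mtopology)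

lemma eventually_mnhds_openin:
  "smooth_atlas A \<Longrightarrow> openin (mtopology A) W \<Longrightarrow> p \<in> W \<Longrightarrow> eventually (\<lambda>q. q \<in> W) (mnhds A p)"
  by (auto simp: eventually_nhdsin)

lemma eventually_mnhds_imp: "smooth_atlas A \<Longrightarrow> p \<in> mcarrier A \<Longrightarrow> eventually P (mnhds A p) \<Longrightarrow> P p"
  by (auto simp: eventually_mnhds)

lemma eventually_mnhds_mcarrier: "smooth_atlas A \<Longrightarrow> eventually (\<lambda>q. q \<in> mcarrier A) (mnhds A p)"
  by (auto simp: eventually_nhdsin topspace_mtopology[symmetric])

lemma eventually_mnhds_chart:
  assumes A: "smooth_atlas A" and c: "c \<in> charts A" and p: "p \<in> fst c"
  shows "eventually P (mnhds A p) \<longleftrightarrow> eventually (\<lambda>e. P (chart_inv c e)) (nhds (snd c p))"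
proof -
  have pA: "p \<in> mcarrier A" using chartsD(1)[OF c] p by auto
  show ?thesis unfolding eventually_mnhds[OF A pA]
  proof
    assume "\<exists>W. openin (mtopology A) W \<and> p \<in> W \<and> (\<forall>q\<in>W. P q)"
    then obtain W where W: "openin (mtopology A) W" "p \<in> W" "\<forall>q\<in>W. P q" by blast
    show "eventually (\<lambda>e. P (chart_inv c e)) (nhds (snd c p))"
      unfolding eventually_nhds using openin_charts_image[OF A c W(1)] W p chart_inv_chart[OF chartsD(2)[OF c]]
      by (intro exI[of _ "snd c ` (fst c \<inter> W)"]) auto
  next
    assume "eventually (\<lambda>e. P (chart_inv c e)) (nhds (snd c p))"
    then obtain U where U: "open U" "snd c p \<in> U" "\<forall>e\<in>U. P (chart_inv c e)" unfolding eventually_nhds by blast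
    then show "\<exists>W. openin (mtopology A) W \<and> p \<in> W \<and> (\<forall>q\<in>W. P q)"
      using openin_chart_preimage[OF A c U(1)] p chart_inv_chart[OF chartsD(2)[OF c]]
      by (intro exI[of _ "fst c \<inter> snd c -` U"]) fastforce
  qed
qed

lemma charts_restrict:
  assumes A: "smooth_atlas A" and c: "c \<in> charts A" and W: "openin (mtopology A) W"
  shows "(fst c \<inter> W, snd c) \<in> charts A"
proof -
  let ?c = "(fst c \<inter> W, snd c)"
  have ic: "is_chart c" using chartsD(2)[OF c] .
  have ic': "is_chart ?c"
    using is_chart_inj[OF ic] openin_charts_image[OF A c W] by (auto simp: is_chart_def intro: inj_on_subset)
  \<comment> \<open>\<open>chart_inv\<close> is a choice-based inverse on the chart domain, so
    cutting down the domain changes it; the two inverses agree on the smaller image, which is open,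
    and smoothness at its points sees no more.\<close>
  have inv: "chart_inv ?c x = chart_inv c x" if "x \<in> snd c ` (fst c \<inter> W)" for x
    using that chart_inv_chart[OF ic] chart_inv_chart[OF ic'] by auto
  have "compatible ?c d" if "d \<in> A" for d
  proof -
    have d: "d \<in> charts A" using that by (rule atlas_subset_charts[OF A])
    have 1: "open (snd c ` (fst c \<inter> (W \<inter> fst d)))"
      by (intro openin_charts_image[OF A c] openin_Int W openin_chart_domain[OF A d])
    have 2: "open (snd d ` (fst d \<inter> (fst c \<inter> W)))"
      by (intro openin_charts_image[OF A d] openin_Int W openin_chart_domain[OF A c])
    have 3: "smooth_near (snd d \<circ> chart_inv ?c) (snd c p)" if p: "p \<in> fst c" "p \<in> W" "p \<in> fst d" for p
    proof -
      have "eventually (\<lambda>x. (snd d \<circ> chart_inv ?c) x = (snd d \<circ> chart_inv c) x) (nhds (snd c p))"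
        unfolding eventually_nhds using openin_charts_image[OF A c W] p inv
        by (intro exI[of _ "snd c ` (fst c \<inter> W)"]) auto
      from smooth_near_cong[OF this] show ?thesis using charts_smooth_near[OF A c d p(1,3)] by blast
    qed
    have 4: "smooth_near (snd c \<circ> chart_inv d) (snd d p)" if p: "p \<in> fst c" "p \<in> fst d" for p
      using charts_smooth_near[OF A d c p(2,1)] .
    show ?thesis unfolding compatible_def
      using 1 2 3 4 by (auto simp: smooth_on_iff_near Int_ac)
  qed
  then show ?thesis using ic' chartsD(1)[OF c] by (auto simp: charts_def)
qed

lemma eventually_chart_inv:
  assumes A: "smooth_atlas A" and c: "c \<in> charts A" and p: "p \<in> fst c"
  shows "eventually (\<lambda>e. e \<in> snd c ` fst c) (nhds (snd c p))"
  unfolding eventually_nhds using is_chart_open[OF chartsD(2)[OF c]] p by blast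

lemma chart_change_ev:
  assumes A: "smooth_atlas A" and c: "c \<in> charts A" and d: "d \<in> charts A" and p: "p \<in> fst c" "p \<in> fst d"
  shows "eventually (\<lambda>x. (f \<circ> chart_inv d) ((snd d \<circ> chart_inv c) x) = (f \<circ> chart_inv c) x) (nhds (snd c p))"
  unfolding eventually_nhds
  using openin_charts_image[OF A c openin_chart_domain[OF A d]] p
  by (intro exI[of _ "snd c ` (fst c \<inter> fst d)"]) (auto simp: chart_inv_chart chartsD(2)[OF c] chartsD(2)[OF d])

lemma smooth_near_chart_change:
  assumes A: "smooth_atlas A" and c: "c \<in> charts A" and d: "d \<in> charts A" and p: "p \<in> fst c" "p \<in> fst d"
    and f: "smooth_near (f \<circ> chart_inv d) (snd d p)"
  shows "smooth_near (f \<circ> chart_inv c) (snd c p)"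
proof -
  have "smooth_near (\<lambda>x. (f \<circ> chart_inv d) ((snd d \<circ> chart_inv c) x)) (snd c p)"
    using f p
    by (intro smooth_near_compose[where f="snd d \<circ> chart_inv c" and g="f \<circ> chart_inv d"] charts_smooth_near[OF A c d p])
      (simp add: chart_inv_chart chartsD(2)[OF c])
  then show ?thesis by (subst (asm) smooth_near_cong[OF chart_change_ev[OF A c d p]])
qed

text \<open>\<open>smooth_at\<close> asks for some chart on whose entire domain \<open>f\<close> is
  smooth. One direction changes charts; the other cuts the given chart down to the open set where
  the coordinate expression is still smooth.\<close>

lemma smooth_at_iff:
  assumes A: "smooth_atlas A" and c: "c \<in> charts A" and p: "p \<in> fst c"
  shows "smooth_at A f p \<longleftrightarrow> smooth_near (f \<circ> chart_inv c) (snd c p)"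
proof
  assume "smooth_at A f p"
  then obtain d where d: "d \<in> charts A" "p \<in> fst d" "smooth_on (snd d ` fst d) (f \<circ> chart_inv d)"
    unfolding smooth_at_def by blast
  then have "smooth_near (f \<circ> chart_inv d) (snd d p)"
    using is_chart_open[OF chartsD(2)[OF d(1)]] by (auto simp: smooth_on_iff_near)
  then show "smooth_near (f \<circ> chart_inv c) (snd c p)"
    using smooth_near_chart_change[OF A c d(1) p d(2)] by blast
next
  assume "smooth_near (f \<circ> chart_inv c) (snd c p)"
  then obtain U where U: "open U" "snd c p \<in> U" "\<forall>x\<in>U. smooth_near (f \<circ> chart_inv c) x"
    using smooth_near_eventually unfolding eventually_nhds by blast
  let ?W = "fst c \<inter> snd c -` U" and ?c = "(fst c \<inter> (fst c \<inter> snd c -` U), snd c)"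
  have c': "?c \<in> charts A" by (intro charts_restrict[OF A c] openin_chart_preimage[OF A c U(1)])
  have "smooth_near (f \<circ> chart_inv ?c) (snd c q)" if "q \<in> fst ?c" for q
    using smooth_near_chart_change[OF A c' c that, of f] that U(3) by auto
  then have "smooth_on (snd ?c ` fst ?c) (f \<circ> chart_inv ?c)"
    using smooth_on_iff_near[OF is_chart_open[OF chartsD(2)[OF c']]] by auto
  then show "smooth_at A f p" unfolding smooth_at_def using c' p U(2) by (intro bexI[of _ ?c]) auto
qed

lemma smooth_at_mcarrier: "smooth_at A f p \<Longrightarrow> p \<in> mcarrier A"
  unfolding smooth_at_def using chartsD(1) by blast

lemma smooth_at_cong:
  assumes A: "smooth_atlas A" and ev: "eventually (\<lambda>q. f q = g q) (mnhds A p)"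
  shows "smooth_at A f p \<longleftrightarrow> smooth_at A g p"
proof (cases "p \<in> mcarrier A")
  case True
  then obtain c where c: "c \<in> charts A" "p \<in> fst c" using mcarrier_charts[OF True A] by blast
  have "eventually (\<lambda>x. (f \<circ> chart_inv c) x = (g \<circ> chart_inv c) x) (nhds (snd c p))"
    using ev by (simp add: eventually_mnhds_chart[OF A c])
  then show ?thesis unfolding smooth_at_iff[OF A c] by (rule smooth_near_cong)
qed (auto dest: smooth_at_mcarrier)

lemma smooth_at_eventually:
  assumes A: "smooth_atlas A" and f: "smooth_at A f p"
  shows "eventually (smooth_at A f) (mnhds A p)"
proof -
  obtain c where c: "c \<in> charts A" "p \<in> fst c" "smooth_on (snd c ` fst c) (f \<circ> chart_inv c)"
    using f unfolding smooth_at_def by blast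
  then have "\<forall>q\<in>fst c. smooth_at A f q" unfolding smooth_at_def by blast
  then show ?thesis using eventually_mnhds_openin[OF A openin_chart_domain[OF A c(1)] c(2)]
    by (auto elim: eventually_mono)
qed

lemma smooth_at_obtain_chart:
  assumes "smooth_atlas A" "smooth_at A f p"
  obtains c where "c \<in> charts A" "p \<in> fst c" "smooth_near (f \<circ> chart_inv c) (snd c p)"
  using assms smooth_at_iff mcarrier_charts smooth_at_mcarrier by metis

section \<open>Algebra of functions smooth at a point\<close>

lemma smooth_at_const: "smooth_atlas A \<Longrightarrow> p \<in> mcarrier A \<Longrightarrow> smooth_at A (\<lambda>x. k) p"
  using mcarrier_charts smooth_at_iff[of A _ p "\<lambda>x. k"] by (fastforce simp: o_def)

lemma smooth_at_add:
  assumes "smooth_atlas A" "smooth_at A f p" "smooth_at A g p"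
  shows "smooth_at A (\<lambda>x. f x + g x) p"
proof -
  obtain c where c: "c \<in> charts A" "p \<in> fst c" using smooth_at_obtain_chart[OF assms(1,2)] .
  then show ?thesis using assms smooth_near_add[of "f \<circ> chart_inv c" _ "g \<circ> chart_inv c"]
    by (simp add: smooth_at_iff o_def)
qed

lemma smooth_at_mult:
  assumes "smooth_atlas A" "smooth_at A f p" "smooth_at A g p"
  shows "smooth_at A (\<lambda>x. f x * g x) p"
proof -
  obtain c where c: "c \<in> charts A" "p \<in> fst c" using smooth_at_obtain_chart[OF assms(1,2)] .
  then show ?thesis using assms smooth_near_mult[of "f \<circ> chart_inv c" _ "g \<circ> chart_inv c"]
    by (simp add: smooth_at_iff o_def)
qed

lemma smooth_at_inverse:
  assumes "smooth_atlas A" "smooth_at A f p" "f p \<noteq> 0"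
  shows "smooth_at A (\<lambda>x. inverse (f x)) p"
proof -
  obtain c where c: "c \<in> charts A" "p \<in> fst c" using smooth_at_obtain_chart[OF assms(1,2)] .
  then show ?thesis using assms smooth_near_inverse[of "f \<circ> chart_inv c"]
    by (simp add: smooth_at_iff o_def chart_inv_chart chartsD(2))
qed

lemma smooth_at_cmult: "smooth_atlas A \<Longrightarrow> smooth_at A f p \<Longrightarrow> smooth_at A (\<lambda>x. k * f x) p"
  by (intro smooth_at_mult smooth_at_const) (auto intro: smooth_at_mcarrier)

lemma smooth_at_diff:
  "smooth_atlas A \<Longrightarrow> smooth_at A f p \<Longrightarrow> smooth_at A g p \<Longrightarrow> smooth_at A (\<lambda>x. f x - g x) p"
  using smooth_at_add[of A f p "\<lambda>x. -1 * g x"] smooth_at_cmult[of A g p "-1"] by simp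

lemma smooth_at_sum:
  "smooth_atlas A \<Longrightarrow> p \<in> mcarrier A \<Longrightarrow> (\<And>i. i \<in> I \<Longrightarrow> smooth_at A (f i) p) \<Longrightarrow> smooth_at A (\<lambda>x. \<Sum>i\<in>I. f i x) p"
  by (induction I rule: infinite_finite_induct) (simp_all add: smooth_at_const smooth_at_add)

lemma smooth_at_prod:
  "smooth_atlas A \<Longrightarrow> p \<in> mcarrier A \<Longrightarrow> (\<And>i. i \<in> I \<Longrightarrow> smooth_at A (f i) p) \<Longrightarrow> smooth_at A (\<lambda>x. \<Prod>i\<in>I. f i x) p"
  by (induction I rule: infinite_finite_induct) (simp_all add: smooth_at_const smooth_at_mult)

lemma chart_fun_ev:
  assumes A: "smooth_atlas A" and c: "c \<in> charts A" and p: "p \<in> fst c"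
  shows "eventually (\<lambda>x. ((\<lambda>q. h (snd c q)) \<circ> chart_inv c) x = h x) (nhds (snd c p))"
  using eventually_chart_inv[OF A c p] by eventually_elim (simp add: chart_chart_inv)

lemma smooth_at_chart_fun:
  assumes A: "smooth_atlas A" and c: "c \<in> charts A" and p: "p \<in> fst c" and h: "smooth_near h (snd c p)"
  shows "smooth_at A (\<lambda>q. h (snd c q)) p"
  unfolding smooth_at_iff[OF A c p] using h smooth_near_cong[OF chart_fun_ev[OF A c p]] by blast

lemma smooth_at_chart_inner:
  "smooth_atlas A \<Longrightarrow> c \<in> charts A \<Longrightarrow> p \<in> fst c \<Longrightarrow> smooth_at A (\<lambda>q. snd c q \<bullet> b) p"
  by (rule smooth_at_chart_fun) (auto intro!: smooth_near_linear bounded_linear_inner_left)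

lemma smooth_at_coord:
  "smooth_atlas A \<Longrightarrow> c \<in> charts A \<Longrightarrow> p \<in> fst c \<Longrightarrow> smooth_at A (coord c a) p"
  unfolding coord_def by (rule smooth_at_chart_fun) (auto intro!: smooth_near_linear bounded_linear_vec_nth)

lemma smooth_near_coords:
  fixes F :: "'a \<Rightarrow> 'f::euclidean_space"
  assumes A: "smooth_atlas A" and c: "c \<in> charts A" and p: "p \<in> fst c"
    and F: "\<And>b. b \<in> Basis \<Longrightarrow> smooth_at A (\<lambda>q. F q \<bullet> b) p"
  shows "smooth_near (F \<circ> chart_inv c) (snd c p)"
  unfolding smooth_near_componentwise[of "F \<circ> _"] using F by (auto simp: smooth_at_iff[OF A c p] o_def)

section \<open>Tangent vectors as derivations\<close>

lemma tangent_vector_smooth: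
  "smooth_at A f p \<Longrightarrow> tangent_vector A c p v f = frechet_derivative (f \<circ> chart_inv c) (at (snd c p)) v"
  by (simp add: tangent_vector_def)

text \<open>The chain rule through the transition map. On functions that are not smooth at
  \<open>p\<close> both sides are 0, because \<open>smooth_at\<close> does not refer to the
  chart.\<close>

lemma tangent_vector_change:
  assumes A: "smooth_atlas A" and c: "c \<in> charts A" and d: "d \<in> charts A" and p: "p \<in> fst c" "p \<in> fst d"
  shows "tangent_vector A c p v =
    tangent_vector A d p (frechet_derivative (snd d \<circ> chart_inv c) (at (snd c p)) v)"
proof
  fix f
  show "tangent_vector A c p v f = tangent_vector A d p (frechet_derivative (snd d \<circ> chart_inv c) (at (snd c p)) v) f"
  proof (cases "smooth_at A f p")
    case True
    have x: "(snd d \<circ> chart_inv c) (snd c p) = snd d p" using chart_inv_chart[OF chartsD(2)[OF c]] p by simp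
    have "smooth_near (f \<circ> chart_inv d) ((snd d \<circ> chart_inv c) (snd c p))"
      unfolding x using True smooth_at_iff[OF A d p(2)] by blast
    from has_derivative_compose[OF smooth_near_has_derivative[OF charts_smooth_near[OF A c d p]] smooth_near_has_derivative[OF this]]
    have "((f \<circ> chart_inv c) has_derivative (\<lambda>v. frechet_derivative (f \<circ> chart_inv d) (at (snd d p))
        (frechet_derivative (snd d \<circ> chart_inv c) (at (snd c p)) v))) (at (snd c p))"
      unfolding x has_derivative_cong_nhds[OF chart_change_ev[OF A c d p]] .
    then show ?thesis using True by (simp add: tangent_vector_smooth frechet_eqI)
  qed (simp add: tangent_vector_def)
qed

lemma tangent_space_chart:
  assumes A: "smooth_atlas A" and c: "c \<in> charts A" and p: "p \<in> fst c"
  shows "tangent_space A p = range (tangent_vector A c p)"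
  unfolding tangent_space_def using c p tangent_vector_change[OF A _ c _ p] by blast

lemma tangent_space_mcarrier: "u \<in> tangent_space A p \<Longrightarrow> p \<in> mcarrier A"
  unfolding tangent_space_def using chartsD(1) by blast

lemma tangent_space_obtain_chart:
  assumes "u \<in> tangent_space A p"
  obtains c v where "c \<in> charts A" "p \<in> fst c" "u = tangent_vector A c p v"
  using assms unfolding tangent_space_def by blast

lemma tv_nonsmooth: "u \<in> tangent_space A p \<Longrightarrow> \<not> smooth_at A f p \<Longrightarrow> u f = 0"
  by (auto simp: tangent_space_def tangent_vector_def)

text \<open>Tangent vectors see only germs. This is what lets a function be replaced, under a
  derivation, by a formula valid merely near \<open>p\<close>. Functions that are not smooth at
  \<open>p\<close> are covered too: then neither germ is smooth and both values are 0.\<close>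

lemma tv_cong:
  assumes A: "smooth_atlas A" and u: "u \<in> tangent_space A p" and ev: "eventually (\<lambda>q. f q = g q) (mnhds A p)"
  shows "u f = u g"
proof -
  obtain c v where c: "c \<in> charts A" "p \<in> fst c" "u = tangent_vector A c p v"
    using tangent_space_obtain_chart[OF u] .
  have "eventually (\<lambda>x. (f \<circ> chart_inv c) x = (g \<circ> chart_inv c) x) (nhds (snd c p))"
    using ev by (simp add: eventually_mnhds_chart[OF A c(1,2)])
  then show ?thesis using smooth_at_cong[OF A ev] frechet_derivative_cong_ev unfolding c(3) tangent_vector_def by metis
qed

lemma tv_add:
  assumes A: "smooth_atlas A" and u: "u \<in> tangent_space A p" and fg: "smooth_at A f p" "smooth_at A g p"
  shows "u (\<lambda>q. f q + g q) = u f + u g"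
proof -
  obtain c v where c: "c \<in> charts A" "p \<in> fst c" "u = tangent_vector A c p v"
    using tangent_space_obtain_chart[OF u] .
  have "((\<lambda>x. (f \<circ> chart_inv c) x + (g \<circ> chart_inv c) x) has_derivative (\<lambda>v.
      frechet_derivative (f \<circ> chart_inv c) (at (snd c p)) v + frechet_derivative (g \<circ> chart_inv c) (at (snd c p)) v)) (at (snd c p))"
    using fg unfolding smooth_at_iff[OF A c(1,2)]
    by (intro has_derivative_add smooth_near_has_derivative)
  then show ?thesis using fg smooth_at_add[OF A fg] unfolding c(3)
    by (simp add: tangent_vector_smooth frechet_eqI o_def)
qed

lemma tv_mult:
  assumes A: "smooth_atlas A" and u: "u \<in> tangent_space A p" and fg: "smooth_at A f p" "smooth_at A g p"
  shows "u (\<lambda>q. f q * g q) = f p * u g + u f * g p"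
proof -
  obtain c v where c: "c \<in> charts A" "p \<in> fst c" "u = tangent_vector A c p v"
    using tangent_space_obtain_chart[OF u] .
  have "((\<lambda>x. (f \<circ> chart_inv c) x * (g \<circ> chart_inv c) x) has_derivative (\<lambda>v.
      (f \<circ> chart_inv c) (snd c p) * frechet_derivative (g \<circ> chart_inv c) (at (snd c p)) v +
      frechet_derivative (f \<circ> chart_inv c) (at (snd c p)) v * (g \<circ> chart_inv c) (snd c p))) (at (snd c p))"
    using fg unfolding smooth_at_iff[OF A c(1,2)]
    by (intro has_derivative_mult smooth_near_has_derivative)
  then show ?thesis using fg smooth_at_mult[OF A fg] chart_inv_chart[OF chartsD(2)[OF c(1)] c(2)] unfolding c(3)
    by (simp add: tangent_vector_smooth frechet_eqI o_def)
qed

lemma tv_const: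
  assumes A: "smooth_atlas A" and u: "u \<in> tangent_space A p"
  shows "u (\<lambda>q. k) = 0"
proof -
  obtain c v where c: "c \<in> charts A" "p \<in> fst c" "u = tangent_vector A c p v"
    using tangent_space_obtain_chart[OF u] .
  show ?thesis unfolding c(3) tangent_vector_def by (simp add: o_def)
qed

lemma tv_cmult:
  assumes A: "smooth_atlas A" and u: "u \<in> tangent_space A p" and f: "smooth_at A f p"
  shows "u (\<lambda>q. k * f q) = k * u f"
  using tv_mult[OF A u smooth_at_const[OF A] f, of k] tv_const[OF A u] smooth_at_mcarrier[OF f] by simp

lemma tv_sum:
  assumes A: "smooth_atlas A" and u: "u \<in> tangent_space A p" and f: "\<And>i. i \<in> I \<Longrightarrow> smooth_at A (f i) p"
  shows "u (\<lambda>q. \<Sum>i\<in>I. f i q) = (\<Sum>i\<in>I. u (f i))"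
  using f
proof (induction I rule: infinite_finite_induct)
  case (insert i I)
  then show ?case
    using tv_add[OF A u, of "f i" "\<lambda>q. \<Sum>i\<in>I. f i q"] smooth_at_sum[OF A tangent_space_mcarrier[OF u], of I f] by simp
qed (simp_all add: tv_const[OF A u])

lemma tangent_vector_chart_fun:
  assumes A: "smooth_atlas A" and c: "c \<in> charts A" and p: "p \<in> fst c" and h: "smooth_near h (snd c p)"
  shows "tangent_vector A c p v (\<lambda>q. h (snd c q)) = frechet_derivative h (at (snd c p)) v"
  unfolding tangent_vector_smooth[OF smooth_at_chart_fun[OF A c p h]]
  using frechet_derivative_cong_ev[OF chart_fun_ev[OF A c p]] by metis

lemma tangent_vector_inner:
  assumes A: "smooth_atlas A" and c: "c \<in> charts A" and p: "p \<in> fst c"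
  shows "tangent_vector A c p v (\<lambda>q. snd c q \<bullet> b) = v \<bullet> b"
proof -
  have "bounded_linear (\<lambda>x. x \<bullet> b)" by (rule bounded_linear_inner_left)
  then show ?thesis using tangent_vector_chart_fun[OF A c p smooth_near_linear]
    by (simp add: frechet_eqI[OF bounded_linear_imp_has_derivative])
qed

lemma coord_inner: "coord c a = (\<lambda>q. snd c q \<bullet> axis a 1)"
  by (simp add: coord_def inner_axis)

lemma tangent_vector_coord:
  assumes "smooth_atlas A" "c \<in> charts A" "p \<in> fst c"
  shows "tangent_vector A c p v (coord c a) = v $ a"
  unfolding coord_inner tangent_vector_inner[OF assms] by (simp add: inner_axis)

lemma tangent_vector_linear:
  assumes A: "smooth_atlas A" and c: "c \<in> charts A" and p: "p \<in> fst c"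
  shows "tangent_vector A c p (r *\<^sub>R v + w) f = r * tangent_vector A c p v f + tangent_vector A c p w f"
proof (cases "smooth_at A f p")
  case True
  interpret L: linear "frechet_derivative (f \<circ> chart_inv c) (at (snd c p))"
    by (rule has_derivative_linear[OF smooth_near_has_derivative[OF iffD1[OF smooth_at_iff[OF A c p] True]]])
  show ?thesis using True by (simp add: tangent_vector_smooth L.add L.scale)
qed (simp add: tangent_vector_def)

text \<open>The values on the linear coordinates are the components of the representing vector in
  the chart \<open>c\<close>.\<close>

lemma tv_ext:
  assumes A: "smooth_atlas A" and c: "c \<in> charts A" and p: "p \<in> fst c"
    and u: "u \<in> tangent_space A p" and w: "w \<in> tangent_space A p"
    and eq: "\<And>b. b \<in> Basis \<Longrightarrow> u (\<lambda>q. snd c q \<bullet> b) = w (\<lambda>q. snd c q \<bullet> b)"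
  shows "u = w"
proof -
  obtain x where x: "u = tangent_vector A c p x"
    using u unfolding tangent_space_chart[OF A c p] by blast
  obtain y where y: "w = tangent_vector A c p y"
    using w unfolding tangent_space_chart[OF A c p] by blast
  note xy = x y
  have "x \<bullet> b = y \<bullet> b" if "b \<in> Basis" for b
    using eq[OF that] unfolding xy tangent_vector_inner[OF A c p] .
  then have "x = y" by (rule euclidean_eqI)
  then show ?thesis using xy by simp
qed

lemma tangent_space_lin:
  assumes A: "smooth_atlas A" and "u \<in> tangent_space A p" "w \<in> tangent_space A p"
  shows "(\<lambda>f. r * u f + w f) \<in> tangent_space A p"
proof -
  obtain c where c: "c \<in> charts A" "p \<in> fst c" using tangent_space_obtain_chart[OF assms(2)] .
  then show ?thesis using assms tangent_vector_linear[OF A c] unfolding tangent_space_chart[OF A c]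
    by (auto simp: image_iff fun_eq_iff) metis
qed

lemma tangent_space_zero:
  assumes A: "smooth_atlas A" and p: "p \<in> mcarrier A"
  shows "(\<lambda>f. 0) \<in> tangent_space A p"
proof -
  obtain c where c: "c \<in> charts A" "p \<in> fst c" using mcarrier_charts[OF p A] by blast
  have "tangent_vector A c p 0 f = 0" for f
    using tangent_vector_linear[OF A c, of "-1" 0 0 f] by simp
  then show ?thesis unfolding tangent_space_chart[OF A c] by (auto simp: image_iff fun_eq_iff)
qed

lemma tangent_space_sum:
  assumes A: "smooth_atlas A" and p: "p \<in> mcarrier A" and E: "\<And>i. i \<in> I \<Longrightarrow> E i \<in> tangent_space A p"
  shows "(\<lambda>f. \<Sum>i\<in>I. k i * E i f) \<in> tangent_space A p"
  using E
proof (induction I rule: infinite_finite_induct)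
  case (insert i I)
  then show ?case using tangent_space_lin[OF A, of "E i" p "\<lambda>f. \<Sum>i\<in>I. k i * E i f" "k i"] by simp
qed (simp_all add: tangent_space_zero[OF A p])

lemma tangent_space_diff:
  "smooth_atlas A \<Longrightarrow> u \<in> tangent_space A p \<Longrightarrow> w \<in> tangent_space A p \<Longrightarrow> (\<lambda>f. u f - w f) \<in> tangent_space A p"
  using tangent_space_lin[of A w p u "-1"] by simp

lemma tv_expand_vec:
  fixes A :: "('a, real^'m) atlas"
  assumes A: "smooth_atlas A" and c: "c \<in> charts A" and p: "p \<in> fst c" and u: "u \<in> tangent_space A p"
  shows "u = (\<lambda>f. \<Sum>a\<in>UNIV. u (coord c a) * coord_field A c a p f)"
proof (rule tv_ext[OF A c p u])
  have pA: "p \<in> mcarrier A" using tangent_space_mcarrier[OF u] .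
  have cf: "coord_field A c a p \<in> tangent_space A p" for a
    unfolding coord_field_def using tangent_space_chart[OF A c p] by blast
  show "(\<lambda>f. \<Sum>a\<in>UNIV. u (coord c a) * coord_field A c a p f) \<in> tangent_space A p"
    using tangent_space_sum[OF A pA, of UNIV "\<lambda>a. coord_field A c a p" "\<lambda>a. u (coord c a)"] cf by simp
  fix b :: "real^'m" assume "b \<in> Basis"
  then obtain i where b: "b = axis i 1" by (auto simp: Basis_vec_def)
  show "u (\<lambda>q. snd c q \<bullet> b) = (\<Sum>a\<in>UNIV. u (coord c a) * coord_field A c a p (\<lambda>q. snd c q \<bullet> b))"
    unfolding coord_field_def b coord_inner[symmetric] tangent_vector_coord[OF A c p]
    by (simp add: axis_def if_distrib cong: if_cong)
qed

section \<open>Tangent maps, open submanifolds and products\<close>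

lemma smooth_near_congI:
  "eventually (\<lambda>y. f y = g y) (nhds x) \<Longrightarrow> smooth_near g x \<Longrightarrow> smooth_near f x"
  by (simp add: smooth_near_cong)

text \<open>Smoothness at one point without charts: continuity there, and pull-back of smooth germs
  to smooth germs. In this form composition is immediate, and the smooth germs are exactly what
  \<open>tangent_map\<close> tests.\<close>

definition smap ::
    "('a, 'e::euclidean_space) atlas \<Rightarrow> ('b, 'f::euclidean_space) atlas \<Rightarrow> ('a \<Rightarrow> 'b) \<Rightarrow> 'a \<Rightarrow> bool" where
  "smap A B F p \<longleftrightarrow> p \<in> mcarrier A \<and> F p \<in> mcarrier B \<and>
     filterlim F (mnhds B (F p)) (mnhds A p) \<and>
     (\<forall>h. smooth_at B h (F p) \<longrightarrow> smooth_at A (\<lambda>q. h (F q)) p)"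

lemma smapD:
  assumes "smap A B F p"
  shows "p \<in> mcarrier A" "F p \<in> mcarrier B" "filterlim F (mnhds B (F p)) (mnhds A p)"
    "smooth_at B h (F p) \<Longrightarrow> smooth_at A (\<lambda>q. h (F q)) p"
  using assms by (auto simp: smap_def)

lemma smap_eventually: "smap A B F p \<Longrightarrow> eventually P (mnhds B (F p)) \<Longrightarrow> eventually (\<lambda>q. P (F q)) (mnhds A p)"
  by (drule smapD(3)) (simp add: filterlim_iff)

lemma smap_comp:
  assumes F: "smap A B F p" and G: "smap B C G (F p)"
  shows "smap A C (\<lambda>q. G (F q)) p"
  unfolding smap_def
  using smapD(1)[OF F] smapD(2)[OF G] filterlim_compose[OF smapD(3)[OF G] smapD(3)[OF F]]
    smapD(4)[OF F] smapD(4)[OF G] by auto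

lemma smapI_chart:
  assumes A: "smooth_atlas A" and B: "smooth_atlas B"
    and c: "c \<in> charts A" "p \<in> fst c" and d: "d \<in> charts B"
    and ev: "eventually (\<lambda>q. F q \<in> fst d) (mnhds A p)"
    and sm: "smooth_near (snd d \<circ> F \<circ> chart_inv c) (snd c p)"
  shows "smap A B F p"
proof -
  have p: "p \<in> mcarrier A" using chartsD(1)[OF c(1)] c(2) by blast
  have Fp: "F p \<in> fst d" using eventually_mnhds_imp[OF A p ev] .
  have pc: "chart_inv c (snd c p) = p" by (rule chart_inv_chart[OF chartsD(2)[OF c(1)] c(2)])
  let ?T = "snd d \<circ> F \<circ> chart_inv c"
  have ev': "eventually (\<lambda>e. F (chart_inv c e) \<in> fst d) (nhds (snd c p))"
    using ev unfolding eventually_mnhds_chart[OF A c] .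
  have eq: "eventually (\<lambda>e. chart_inv d (?T e) = F (chart_inv c e)) (nhds (snd c p))"
    using ev' by eventually_elim (simp add: chart_inv_chart chartsD(2)[OF d])
  have cont: "filterlim ?T (nhds (?T (snd c p))) (nhds (snd c p))"
    using smooth_near_isCont[OF sm] by (simp add: isCont_def tendsto_nhds_iff)
  have "filterlim F (mnhds B (F p)) (mnhds A p)"
    unfolding filterlim_iff
  proof (intro allI impI)
    fix P assume "eventually P (mnhds B (F p))"
    then have "eventually (\<lambda>x. P (chart_inv d x)) (nhds (?T (snd c p)))"
      by (simp add: eventually_mnhds_chart[OF B d Fp] pc)
    then have "eventually (\<lambda>e. P (chart_inv d (?T e))) (nhds (snd c p))"
      using filterlim_iff[THEN iffD1, OF cont] by blast
    with eq have "eventually (\<lambda>e. P (F (chart_inv c e))) (nhds (snd c p))"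
      by eventually_elim simp
    then show "eventually (\<lambda>q. P (F q)) (mnhds A p)" by (simp add: eventually_mnhds_chart[OF A c])
  qed
  moreover have "smooth_at A (\<lambda>q. h (F q)) p" if h: "smooth_at B h (F p)" for h
  proof -
    have "smooth_near (h \<circ> chart_inv d) (?T (snd c p))"
      using h unfolding smooth_at_iff[OF B d Fp] by (simp add: pc)
    from smooth_near_compose[OF sm this]
    have 1: "smooth_near (\<lambda>e. (h \<circ> chart_inv d) (?T e)) (snd c p)" .
    have 2: "eventually (\<lambda>e. (h \<circ> chart_inv d) (?T e) = ((\<lambda>q. h (F q)) \<circ> chart_inv c) e) (nhds (snd c p))"
      using eq by eventually_elim simp
    show ?thesis unfolding smooth_at_iff[OF A c] using 1 smooth_near_cong[OF 2] by blast
  qed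
  moreover have "F p \<in> mcarrier B" using chartsD(1)[OF d] Fp by blast
  ultimately show ?thesis using p by (simp add: smap_def)
qed

lemma smooth_map_smap:
  assumes A: "smooth_atlas A" and B: "smooth_atlas B" and F: "smooth_map A B F" and p: "p \<in> mcarrier A"
  shows "smap A B F p"
proof -
  obtain c d where cd: "c \<in> charts A" "d \<in> charts B" "p \<in> fst c" "F ` fst c \<subseteq> fst d"
    "smooth_on (snd c ` fst c) (snd d \<circ> F \<circ> chart_inv c)"
    using F p unfolding smooth_map_def by blast
  have "eventually (\<lambda>q. F q \<in> fst d) (mnhds A p)"
    using eventually_mnhds_openin[OF A openin_chart_domain[OF A cd(1)] cd(3)]
    by eventually_elim (use cd(4) in blast)
  moreover have "smooth_near (snd d \<circ> F \<circ> chart_inv c) (snd c p)"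
    using cd(5) smooth_on_iff_near[OF is_chart_open[OF chartsD(2)[OF cd(1)]]] cd(3) by blast
  ultimately show ?thesis by (rule smapI_chart[OF A B cd(1,3,2)])
qed

lemma tangent_map_smooth: "smooth_at B h (F p) \<Longrightarrow> tangent_map B F p v h = v (\<lambda>q. h (F q))"
  by (simp add: tangent_map_def o_def)

text \<open>In charts the image is represented by the derivative of the coordinate expression
  \<open>?T\<close> of \<open>F\<close>, applied to the vector representing
  \<open>v\<close>.\<close>

lemma tangent_map_in:
  assumes A: "smooth_atlas A" and B: "smooth_atlas B" and F: "smap A B F p" and v: "v \<in> tangent_space A p"
  shows "tangent_map B F p v \<in> tangent_space B (F p)"
proof -
  obtain c e where c: "c \<in> charts A" "p \<in> fst c" "v = tangent_vector A c p e"
    using tangent_space_obtain_chart[OF v] .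
  obtain d where d: "d \<in> charts B" "F p \<in> fst d" using mcarrier_charts[OF smapD(2)[OF F] B] by blast
  let ?T = "(\<lambda>q. snd d (F q)) \<circ> chart_inv c"
  have pc: "chart_inv c (snd c p) = p" by (rule chart_inv_chart[OF chartsD(2)[OF c(1)] c(2)])
  have sm: "smooth_near ?T (snd c p)"
    by (intro smooth_near_coords[OF A c(1,2)] smapD(4)[OF F] smooth_at_chart_inner[OF B d])
  have "eventually (\<lambda>q. F q \<in> fst d) (mnhds A p)"
    by (rule smap_eventually[OF F eventually_mnhds_openin[OF B openin_chart_domain[OF B d(1)] d(2)]])
  then have ev: "eventually (\<lambda>e. F (chart_inv c e) \<in> fst d) (nhds (snd c p))"
    unfolding eventually_mnhds_chart[OF A c(1,2)] .
  have "tangent_map B F p v = tangent_vector B d (F p) (frechet_derivative ?T (at (snd c p)) e)"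
  proof
    fix h
    show "tangent_map B F p v h = tangent_vector B d (F p) (frechet_derivative ?T (at (snd c p)) e) h"
    proof (cases "smooth_at B h (F p)")
      case True
      have "smooth_near (h \<circ> chart_inv d) (?T (snd c p))"
        using True unfolding smooth_at_iff[OF B d] by (simp add: pc)
      from has_derivative_compose[OF smooth_near_has_derivative[OF sm] smooth_near_has_derivative[OF this]]
      have 1: "((\<lambda>x. (h \<circ> chart_inv d) (?T x)) has_derivative (\<lambda>v. frechet_derivative (h \<circ> chart_inv d) (at (?T (snd c p)))
        (frechet_derivative ?T (at (snd c p)) v))) (at (snd c p))" .
      have "eventually (\<lambda>x. (h \<circ> chart_inv d) (?T x) = ((\<lambda>q. h (F q)) \<circ> chart_inv c) x) (nhds (snd c p))"
        using ev by eventually_elim (simp add: chart_inv_chart chartsD(2)[OF d(1)])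
      from 1[unfolded has_derivative_cong_nhds[OF this]] show ?thesis
        using True smapD(4)[OF F True] by (simp add: tangent_map_smooth c(3) tangent_vector_smooth frechet_eqI pc)
    qed (simp add: tangent_vector_def tangent_map_def)
  qed
  then show ?thesis using tangent_space_chart[OF B d] by blast
qed

text \<open>If \<open>h\<close> is smooth at the image point, then so is its pull-back by
  \<open>G\<close> at \<open>F p\<close>, and the inner tangent map evaluates it by composition.
  Otherwise both sides are 0 by the convention on non-smooth functions.\<close>

lemma tangent_map_comp:
  assumes "smap B C G (F p)"
  shows "tangent_map C (\<lambda>q. G (F q)) p v = tangent_map C G (F p) (tangent_map B F p v)"
  using smapD(4)[OF assms] by (auto simp: tangent_map_def o_def)

lemma tangent_map_cong:
  assumes A: "smooth_atlas A" and v: "v \<in> tangent_space A p" and ev: "eventually (\<lambda>q. F q = F' q) (mnhds A p)"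
  shows "tangent_map B F p v = tangent_map B F' p v"
proof -
  have "F p = F' p" using eventually_mnhds_imp[OF A tangent_space_mcarrier[OF v] ev] .
  moreover have "v (h \<circ> F) = v (h \<circ> F')" for h
    by (rule tv_cong[OF A v]) (use ev in \<open>auto elim: eventually_mono\<close>)
  ultimately show ?thesis by (auto simp: tangent_map_def)
qed

lemma tangent_map_sum:
  "tangent_map B F p (\<lambda>f. \<Sum>i\<in>I. k i * E i f) = (\<lambda>f. \<Sum>i\<in>I. k i * tangent_map B F p (E i) f)"
  by (auto simp: tangent_map_def)

lemma tangent_map_lin_comb:
  "tangent_map B F p (lin_comb k E) = lin_comb k (\<lambda>i. tangent_map B F p (E i))"
  by (simp add: lin_comb_def tangent_map_sum)

lemma tangent_map_add:
  "tangent_map B F p (\<lambda>f. v f + w f) = (\<lambda>f. tangent_map B F p v f + tangent_map B F p w f)"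
  by (auto simp: tangent_map_def)

lemma tangent_map_diff:
  "tangent_map B F p (\<lambda>f. v f - w f) = (\<lambda>f. tangent_map B F p v f - tangent_map B F p w f)"
  by (auto simp: tangent_map_def)

section \<open>Open submanifolds\<close>

lemma restrict_atlas_smooth:
  assumes A: "smooth_atlas A"
  shows "smooth_atlas (restrict_atlas A W)"
proof -
  have "compatible c d" if c: "c \<in> charts A" and d: "d \<in> charts A" for c d
    using openin_charts_image[OF A c openin_chart_domain[OF A d]] openin_charts_image[OF A d openin_chart_domain[OF A c]]
      charts_smooth_near[OF A c d] charts_smooth_near[OF A d c]
    unfolding compatible_def by (auto simp: smooth_on_iff_near Int_commute)
  then show ?thesis unfolding smooth_atlas_def restrict_atlas_def by (auto dest: chartsD(2))
qed

text \<open>A chart common to both maximal atlases: in it smoothness and neighbourhoods for the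
  submanifold and for the whole manifold have the same coordinate description.\<close>

lemma restrict_atlas_chart:
  assumes A: "smooth_atlas A" and W: "openin (mtopology A) W" and p: "p \<in> W"
  obtains c where "c \<in> charts A" "c \<in> charts (restrict_atlas A W)" "p \<in> fst c"
proof -
  have "p \<in> mcarrier A" using openin_subset[OF W] p topspace_mtopology[OF A] by auto
  then obtain c where c: "c \<in> charts A" "p \<in> fst c" using mcarrier_charts[OF _ A] by blast
  let ?c = "(fst c \<inter> W, snd c)"
  have "?c \<in> charts A" by (rule charts_restrict[OF A c(1) W])
  moreover then have "?c \<in> restrict_atlas A W" by (simp add: restrict_atlas_def)
  then have "?c \<in> charts (restrict_atlas A W)" by (rule atlas_subset_charts[OF restrict_atlas_smooth[OF A]])
  ultimately show ?thesis using c(2) p that by auto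
qed

lemma restrict_atlas_mcarrier:
  assumes A: "smooth_atlas A" and W: "openin (mtopology A) W"
  shows "mcarrier (restrict_atlas A W) = W"
proof
  show "W \<subseteq> mcarrier (restrict_atlas A W)"
  proof
    fix p assume "p \<in> W"
    from restrict_atlas_chart[OF A W this] obtain c where "c \<in> charts (restrict_atlas A W)" "p \<in> fst c" .
    then show "p \<in> mcarrier (restrict_atlas A W)" using chartsD(1) by blast
  qed
qed (auto simp: mcarrier_def restrict_atlas_def)

lemma restrict_atlas_smooth_at:
  assumes A: "smooth_atlas A" and W: "openin (mtopology A) W" and p: "p \<in> W"
  shows "smooth_at (restrict_atlas A W) f p \<longleftrightarrow> smooth_at A f p"
proof -
  obtain c where c: "c \<in> charts A" "c \<in> charts (restrict_atlas A W)" "p \<in> fst c" using restrict_atlas_chart[OF assms] .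
  show ?thesis unfolding smooth_at_iff[OF A c(1,3)] smooth_at_iff[OF restrict_atlas_smooth[OF A] c(2,3)] ..
qed

lemma restrict_atlas_mnhds:
  assumes A: "smooth_atlas A" and W: "openin (mtopology A) W" and p: "p \<in> W"
  shows "mnhds (restrict_atlas A W) p = mnhds A p"
proof -
  obtain c where c: "c \<in> charts A" "c \<in> charts (restrict_atlas A W)" "p \<in> fst c" using restrict_atlas_chart[OF assms] .
  show ?thesis unfolding filter_eq_iff
    unfolding eventually_mnhds_chart[OF A c(1,3)] eventually_mnhds_chart[OF restrict_atlas_smooth[OF A] c(2,3)] by simp
qed

lemma smap_restrict_dom:
  assumes A: "smooth_atlas A" and W: "openin (mtopology A) W" and p: "p \<in> W"
  shows "smap (restrict_atlas A W) B F p \<longleftrightarrow> smap A B F p"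
proof -
  have "p \<in> mcarrier A" using openin_subset[OF W] p topspace_mtopology[OF A] by auto
  then show ?thesis unfolding smap_def restrict_atlas_mnhds[OF assms] restrict_atlas_smooth_at[OF assms]
      restrict_atlas_mcarrier[OF A W] using p by simp
qed

lemma smap_restrict_cod:
  assumes B: "smooth_atlas B" and W: "openin (mtopology B) W" and p: "F p \<in> W"
  shows "smap A (restrict_atlas B W) F p \<longleftrightarrow> smap A B F p"
proof -
  have "F p \<in> mcarrier B" using openin_subset[OF W] p topspace_mtopology[OF B] by auto
  then show ?thesis unfolding smap_def restrict_atlas_mnhds[OF assms] restrict_atlas_smooth_at[OF assms]
      restrict_atlas_mcarrier[OF B W] using p by simp
qed

section \<open>Products of manifolds\<close>

definition prod_chart :: "('a, 'e) chart \<Rightarrow> ('b, 'f) chart \<Rightarrow> ('a \<times> 'b, 'e \<times> 'f) chart" where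
  "prod_chart c d = (fst c \<times> fst d, map_prod (snd c) (snd d))"

lemma fst_prod_chart: "fst (prod_chart c d) = fst c \<times> fst d"
  and snd_prod_chart: "snd (prod_chart c d) = map_prod (snd c) (snd d)"
  by (simp_all add: prod_chart_def)

lemma prod_chart_is_chart: "is_chart c \<Longrightarrow> is_chart d \<Longrightarrow> is_chart (prod_chart c d)"
  unfolding is_chart_def prod_chart_def fst_conv snd_conv map_prod_surj_on[OF refl refl]
  by (blast intro: map_prod_inj_on open_Times)

lemma prod_chart_inv:
  assumes "is_chart c" "is_chart d" "x \<in> snd c ` fst c" "y \<in> snd d ` fst d"
  shows "chart_inv (prod_chart c d) (x, y) = (chart_inv c x, chart_inv d y)"
proof -
  have "snd (prod_chart c d) (chart_inv c x, chart_inv d y) = (x, y)"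
    using assms by (simp add: snd_prod_chart chart_chart_inv)
  moreover have "(chart_inv c x, chart_inv d y) \<in> fst (prod_chart c d)"
    using assms by (simp add: fst_prod_chart chart_inv_in)
  ultimately show ?thesis using chart_inv_chart[OF prod_chart_is_chart[OF assms(1,2)]] by metis
qed

lemma prod_chart_compatible:
  fixes c c' :: "('a, 'e::euclidean_space) chart" and d d' :: "('b, 'f::euclidean_space) chart"
  assumes c: "is_chart c" "is_chart c'" "compatible c c'" and d: "is_chart d" "is_chart d'" "compatible d d'"
  shows "compatible (prod_chart c d) (prod_chart c' d')"
proof -
  have o: "open (snd (prod_chart c d) ` (fst (prod_chart c d) \<inter> fst (prod_chart c' d')))"
    if "compatible c c'" "compatible d d'" for c c' :: "('a, 'e) chart" and d d' :: "('b, 'f) chart"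
    using that by (auto simp: compatible_def fst_prod_chart snd_prod_chart Times_Int_Times map_prod_image intro: open_Times)
  have s: "smooth_near (snd (prod_chart c' d') \<circ> chart_inv (prod_chart c d)) (snd (prod_chart c d) P)"
    if c: "is_chart c" "is_chart c'" "compatible c c'" and d: "is_chart d" "is_chart d'" "compatible d d'"
      and P: "P \<in> fst (prod_chart c d)" "P \<in> fst (prod_chart c' d')"
    for c c' :: "('a, 'e) chart" and d d' :: "('b, 'f) chart" and P
  proof -
    obtain p q where Pq: "P = (p, q)" by (cases P)
    then have p: "p \<in> fst c" "p \<in> fst c'" and q: "q \<in> fst d" "q \<in> fst d'" using P by (auto simp: fst_prod_chart)
    have ev: "eventually (\<lambda>z. ((snd c' \<circ> chart_inv c) (fst z), (snd d' \<circ> chart_inv d) (snd z)) =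
       (snd (prod_chart c' d') \<circ> chart_inv (prod_chart c d)) z) (nhds (snd c p, snd d q))"
      unfolding eventually_nhds
    proof (intro exI[of _ "snd c ` fst c \<times> snd d ` fst d"] conjI ballI)
      show "open (snd c ` fst c \<times> snd d ` fst d)" by (intro open_Times is_chart_open c d)
      fix z assume "z \<in> snd c ` fst c \<times> snd d ` fst d"
      then show "((snd c' \<circ> chart_inv c) (fst z), (snd d' \<circ> chart_inv d) (snd z)) =
       (snd (prod_chart c' d') \<circ> chart_inv (prod_chart c d)) z"
        using prod_chart_inv[OF c(1) d(1), of "fst z" "snd z"] by (auto simp: snd_prod_chart)
    qed (use p q in auto)
    have "smooth_near (\<lambda>z. ((snd c' \<circ> chart_inv c) (fst z), (snd d' \<circ> chart_inv d) (snd z))) (snd c p, snd d q)"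
      using compatible_smooth_near(1)[OF c(3,1,2) p] compatible_smooth_near(1)[OF d(3,1,2) q]
      by (intro smooth_near_Pair smooth_near_compose[where f=fst and g="snd c' \<circ> chart_inv c", OF smooth_near_linear[OF bounded_linear_fst]]
           smooth_near_compose[where f=snd and g="snd d' \<circ> chart_inv d", OF smooth_near_linear[OF bounded_linear_snd]])
        simp_all
    then show ?thesis unfolding smooth_near_cong[OF ev] by (simp add: Pq snd_prod_chart)
  qed
  have c': "compatible c' c" "compatible d' d" using c(3) d(3) by (auto simp: compatible_def Int_commute)
  have o': "open (snd (prod_chart c' d') ` (fst (prod_chart c d) \<inter> fst (prod_chart c' d')))"
    unfolding Int_commute[of "fst (prod_chart c d)"] by (rule o[OF c'])
  show ?thesis unfolding compatible_def smooth_on_iff_near[OF o[OF c(3) d(3)]] smooth_on_iff_near[OF o']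
  proof (intro conjI ballI)
    fix x assume "x \<in> snd (prod_chart c d) ` (fst (prod_chart c d) \<inter> fst (prod_chart c' d'))"
    then obtain P where "P \<in> fst (prod_chart c d)" "P \<in> fst (prod_chart c' d')" "x = snd (prod_chart c d) P" by blast
    then show "smooth_near (snd (prod_chart c' d') \<circ> chart_inv (prod_chart c d)) x" using s[OF c d] by simp
  next
    fix x assume "x \<in> snd (prod_chart c' d') ` (fst (prod_chart c d) \<inter> fst (prod_chart c' d'))"
    then obtain P where "P \<in> fst (prod_chart c d)" "P \<in> fst (prod_chart c' d')" "x = snd (prod_chart c' d') P" by blast
    then show "smooth_near (snd (prod_chart c d) \<circ> chart_inv (prod_chart c' d')) x"
      using s[OF c(2,1) c'(1) d(2,1) c'(2)] by simp
  qed (rule o[OF c(3) d(3)], rule o')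
qed

lemma prod_atlas_cases:
  assumes "C \<in> prod_atlas A B" obtains c d where "c \<in> A" "d \<in> B" "C = prod_chart c d"
  using assms unfolding prod_atlas_def prod_chart_def by blast

lemma prod_atlasI: "c \<in> A \<Longrightarrow> d \<in> B \<Longrightarrow> prod_chart c d \<in> prod_atlas A B"
  unfolding prod_atlas_def prod_chart_def by blast

lemma prod_atlas_smooth:
  assumes A: "smooth_atlas A" and B: "smooth_atlas B"
  shows "smooth_atlas (prod_atlas A B)"
  unfolding smooth_atlas_def
proof (intro conjI ballI)
  fix C assume "C \<in> prod_atlas A B"
  then obtain c d where c: "c \<in> A" "d \<in> B" "C = prod_chart c d" by (rule prod_atlas_cases)
  then show "is_chart C" using A B by (simp add: smooth_atlas_def prod_chart_is_chart)
  fix C' assume "C' \<in> prod_atlas A B"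
  then obtain c' d' where "c' \<in> A" "d' \<in> B" "C' = prod_chart c' d'" by (rule prod_atlas_cases)
  then show "compatible C C'" using c A B by (simp add: smooth_atlas_def prod_chart_compatible)
qed

lemma prod_atlas_mcarrier: "mcarrier (prod_atlas A B) = mcarrier A \<times> mcarrier B"
proof (intro equalityI subsetI)
  fix z assume "z \<in> mcarrier A \<times> mcarrier B"
  then obtain c d where "c \<in> A" "fst z \<in> fst c" "d \<in> B" "snd z \<in> fst d" unfolding mcarrier_def mem_Times_iff by blast
  then show "z \<in> mcarrier (prod_atlas A B)" unfolding mcarrier_def
    by (intro UN_I[of "prod_chart c d"] prod_atlasI) (simp_all add: fst_prod_chart mem_Times_iff)
next
  fix z assume "z \<in> mcarrier (prod_atlas A B)"
  then obtain C where "C \<in> prod_atlas A B" and z: "z \<in> fst C" unfolding mcarrier_def by blast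
  then obtain c d where "c \<in> A" "d \<in> B" "C = prod_chart c d" by (auto elim: prod_atlas_cases)
  then show "z \<in> mcarrier A \<times> mcarrier B" using z unfolding mcarrier_def mem_Times_iff
    by (auto simp: fst_prod_chart)
qed

lemma prod_chart_in:
  assumes "smooth_atlas A" "smooth_atlas B" "c \<in> A" "d \<in> B"
  shows "prod_chart c d \<in> charts (prod_atlas A B)"
  using assms by (intro atlas_subset_charts prod_atlas_smooth prod_atlasI)

lemma
  assumes A: "smooth_atlas A" and B: "smooth_atlas B" and P: "p \<in> mcarrier A" "q \<in> mcarrier B"
  shows smap_fst: "smap (prod_atlas A B) A fst (p, q)"
    and smap_snd: "smap (prod_atlas A B) B snd (p, q)"
    and smap_Pair_left: "smap A (prod_atlas A B) (\<lambda>p. (p, q)) p"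
    and smap_Pair_right: "smap B (prod_atlas A B) (\<lambda>q. (p, q)) q"
proof -
  obtain c d where c: "c \<in> A" "p \<in> fst c" and d: "d \<in> B" "q \<in> fst d" using P by (auto simp: mcarrier_def)
  note cc = atlas_subset_charts[OF A c(1)] and dd = atlas_subset_charts[OF B d(1)]
  note AB = prod_atlas_smooth[OF A B]
  note cd = prod_chart_in[OF A B c(1) d(1)]
  note ic = chartsD(2)[OF cc] and id = chartsD(2)[OF dd]
  have pq: "(p, q) \<in> fst (prod_chart c d)" using c d by (simp add: fst_prod_chart)
  have evd: "eventually (\<lambda>z. z \<in> fst (prod_chart c d)) (mnhds (prod_atlas A B) (p, q))"
    by (rule eventually_mnhds_openin[OF AB openin_chart_domain[OF AB cd] pq])
  have evc: "eventually (\<lambda>z. z \<in> snd c ` fst c \<times> snd d ` fst d) (nhds (snd (prod_chart c d) (p, q)))"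
    using eventually_chart_inv[OF AB cd pq] by (simp add: fst_prod_chart snd_prod_chart map_prod_image)
  show "smap (prod_atlas A B) A fst (p, q)"
  proof (rule smapI_chart[OF AB A cd pq cc])
    show "eventually (\<lambda>z. fst z \<in> fst c) (mnhds (prod_atlas A B) (p, q))"
      using evd by eventually_elim (auto simp: fst_prod_chart)
    have "eventually (\<lambda>z. (snd c \<circ> fst \<circ> chart_inv (prod_chart c d)) z = fst z) (nhds (snd (prod_chart c d) (p, q)))"
      using evc by eventually_elim (auto simp: prod_chart_inv[OF ic id] chart_inv_chart[OF ic])
    then show "smooth_near (snd c \<circ> fst \<circ> chart_inv (prod_chart c d)) (snd (prod_chart c d) (p, q))"
      by (rule smooth_near_congI) (rule smooth_near_linear[OF bounded_linear_fst])
  qed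
  show "smap (prod_atlas A B) B snd (p, q)"
  proof (rule smapI_chart[OF AB B cd pq dd])
    show "eventually (\<lambda>z. snd z \<in> fst d) (mnhds (prod_atlas A B) (p, q))"
      using evd by eventually_elim (auto simp: fst_prod_chart)
    have "eventually (\<lambda>z. (snd d \<circ> snd \<circ> chart_inv (prod_chart c d)) z = snd z) (nhds (snd (prod_chart c d) (p, q)))"
      using evc by eventually_elim (auto simp: prod_chart_inv[OF ic id] chart_inv_chart[OF id])
    then show "smooth_near (snd d \<circ> snd \<circ> chart_inv (prod_chart c d)) (snd (prod_chart c d) (p, q))"
      by (rule smooth_near_congI) (rule smooth_near_linear[OF bounded_linear_snd])
  qed
  show "smap A (prod_atlas A B) (\<lambda>p. (p, q)) p"
  proof (rule smapI_chart[OF A AB cc c(2) cd])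
    show "eventually (\<lambda>z. (z, q) \<in> fst (prod_chart c d)) (mnhds A p)"
      using eventually_mnhds_openin[OF A openin_chart_domain[OF A cc] c(2)]
      by eventually_elim (simp add: fst_prod_chart d)
    have "eventually (\<lambda>z. (snd (prod_chart c d) \<circ> (\<lambda>p. (p, q)) \<circ> chart_inv c) z = (z, snd d q)) (nhds (snd c p))"
      using eventually_chart_inv[OF A cc c(2)] by eventually_elim (auto simp: snd_prod_chart chart_inv_chart[OF ic])
    then show "smooth_near (snd (prod_chart c d) \<circ> (\<lambda>p. (p, q)) \<circ> chart_inv c) (snd c p)"
      by (rule smooth_near_congI) (rule smooth_near_Pair[OF smooth_near_linear[OF bounded_linear_ident] smooth_near_const])
  qed
  show "smap B (prod_atlas A B) (\<lambda>q. (p, q)) q"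
  proof (rule smapI_chart[OF B AB dd d(2) cd])
    show "eventually (\<lambda>z. (p, z) \<in> fst (prod_chart c d)) (mnhds B q)"
      using eventually_mnhds_openin[OF B openin_chart_domain[OF B dd] d(2)]
      by eventually_elim (simp add: fst_prod_chart c)
    have "eventually (\<lambda>z. (snd (prod_chart c d) \<circ> (\<lambda>q. (p, q)) \<circ> chart_inv d) z = (snd c p, z)) (nhds (snd d q))"
      using eventually_chart_inv[OF B dd d(2)] by eventually_elim (auto simp: snd_prod_chart chart_inv_chart[OF id])
    then show "smooth_near (snd (prod_chart c d) \<circ> (\<lambda>q. (p, q)) \<circ> chart_inv d) (snd d q)"
      by (rule smooth_near_congI) (rule smooth_near_Pair[OF smooth_near_const smooth_near_linear[OF bounded_linear_ident]])
  qed
qed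

text \<open>Applied below to a vertical vector in a local trivialization. By \<open>tv_ext\<close>
  it is enough to test on linear coordinates; each is a function of the first factor, which
  \<open>u\<close> kills, plus a function of the second, where both sides agree by
  construction.\<close>

lemma tangent_vector_prod_vertical:
  fixes A :: "('a, 'e::euclidean_space) atlas" and B :: "('b, 'f::euclidean_space) atlas"
  assumes A: "smooth_atlas A" and B: "smooth_atlas B"
    and u: "u \<in> tangent_space (prod_atlas A B) (p, q)" and vert: "tangent_map A fst (p, q) u = (\<lambda>h. 0)"
  shows "u = tangent_map (prod_atlas A B) (\<lambda>q. (p, q)) q (tangent_map B snd (p, q) u)"
proof -
  have P: "p \<in> mcarrier A" "q \<in> mcarrier B" using tangent_space_mcarrier[OF u] by (auto simp: prod_atlas_mcarrier)
  obtain c d where c: "c \<in> A" "p \<in> fst c" and d: "d \<in> B" "q \<in> fst d" using P by (auto simp: mcarrier_def)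
  note cc = atlas_subset_charts[OF A c(1)] and dd = atlas_subset_charts[OF B d(1)]
  note AB = prod_atlas_smooth[OF A B]
  note cd = prod_chart_in[OF A B c(1) d(1)]
  have pq: "(p, q) \<in> fst (prod_chart c d)" using c d by (simp add: fst_prod_chart)
  let ?w = "tangent_map B snd (p, q) u"
  have w: "?w \<in> tangent_space B q" using tangent_map_in[OF AB B smap_snd[OF A B P] u] by simp
  show ?thesis
  proof (rule tv_ext[OF AB cd pq u])
    show "tangent_map (prod_atlas A B) (\<lambda>q. (p, q)) q ?w \<in> tangent_space (prod_atlas A B) (p, q)"
      by (rule tangent_map_in[OF B AB smap_Pair_right[OF A B P] w])
    fix b :: "'e \<times> 'f" assume b: "b \<in> Basis"
    have sb: "smooth_at (prod_atlas A B) (\<lambda>z. snd (prod_chart c d) z \<bullet> b) (p, q)"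
      by (rule smooth_at_chart_inner[OF AB cd pq])
    have R: "tangent_map (prod_atlas A B) (\<lambda>q. (p, q)) q ?w (\<lambda>z. snd (prod_chart c d) z \<bullet> b) =
        ?w (\<lambda>q. snd c p \<bullet> fst b + snd d q \<bullet> snd b)"
      unfolding tangent_map_smooth[of "prod_atlas A B" _ "\<lambda>q. (p, q)" q, OF sb] by (simp add: snd_prod_chart inner_prod_def)
    have L: "u (\<lambda>z. snd (prod_chart c d) z \<bullet> b) = u (\<lambda>z. snd c (fst z) \<bullet> fst b + snd d (snd z) \<bullet> snd b)"
      by (simp add: snd_prod_chart inner_prod_def case_prod_beta map_prod_def)
    have s1: "smooth_at A (\<lambda>x. snd c x \<bullet> fst b) p" and s2: "smooth_at B (\<lambda>x. snd d x \<bullet> snd b) q"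
      by (rule smooth_at_chart_inner[OF A cc c(2)] smooth_at_chart_inner[OF B dd d(2)])+
    have s1': "smooth_at (prod_atlas A B) (\<lambda>z. snd c (fst z) \<bullet> fst b) (p, q)"
      and s2': "smooth_at (prod_atlas A B) (\<lambda>z. snd d (snd z) \<bullet> snd b) (p, q)"
      using smapD(4)[OF smap_fst[OF A B P], of "\<lambda>x. snd c x \<bullet> fst b"] s1
        smapD(4)[OF smap_snd[OF A B P], of "\<lambda>x. snd d x \<bullet> snd b"] s2 by auto
    have "u (\<lambda>z. snd c (fst z) \<bullet> fst b) = 0"
      using tangent_map_smooth[of A "\<lambda>x. snd c x \<bullet> fst b" fst "(p, q)" u] s1 vert by simp
    moreover have "?w (\<lambda>x. snd d x \<bullet> snd b) = u (\<lambda>z. snd d (snd z) \<bullet> snd b)"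
      using tangent_map_smooth[of B "\<lambda>x. snd d x \<bullet> snd b" snd "(p, q)" u] s2 by simp
    ultimately show "u (\<lambda>z. snd (prod_chart c d) z \<bullet> b) =
        tangent_map (prod_atlas A B) (\<lambda>q. (p, q)) q ?w (\<lambda>z. snd (prod_chart c d) z \<bullet> b)"
      unfolding L R tv_add[OF AB u s1' s2']
        tv_add[OF B w smooth_at_const[OF B P(2)] s2] using tv_const[OF B w] by simp
  qed
qed

section \<open>Lie brackets\<close>

lemma smooth_at_nonzero_ev:
  assumes A: "smooth_atlas A" and f: "smooth_at A f p" and nz: "f p \<noteq> 0"
  shows "eventually (\<lambda>q. f q \<noteq> 0) (mnhds A p)"
proof -
  obtain c where c: "c \<in> charts A" "p \<in> fst c" "smooth_near (f \<circ> chart_inv c) (snd c p)"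
    using smooth_at_obtain_chart[OF A f] .
  have pc: "(f \<circ> chart_inv c) (snd c p) = f p"
    using chart_inv_chart[OF chartsD(2)[OF c(1)] c(2)] by simp
  have "filterlim (f \<circ> chart_inv c) (nhds (f p)) (nhds (snd c p))"
    using smooth_near_isCont[OF c(3)] pc by (simp add: isCont_def tendsto_nhds_iff)
  then have "eventually (\<lambda>x. (f \<circ> chart_inv c) x \<in> - {0}) (nhds (snd c p))"
    by (rule topological_tendstoD) (use nz in auto)
  then show ?thesis unfolding eventually_mnhds_chart[OF A c(1,2)] by simp
qed

lemma smooth_at_det:
  fixes M :: "'a \<Rightarrow> real^'i^'i"
  assumes "smooth_atlas A" "p \<in> mcarrier A" "\<And>i j. smooth_at A (\<lambda>q. M q $ i $ j) p"
  shows "smooth_at A (\<lambda>q. det (M q)) p"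
  unfolding det_def using assms
  by (intro smooth_at_sum smooth_at_mult smooth_at_const smooth_at_prod)

lemma
  fixes M :: "real^'i^'i"
  assumes "invertible M"
  shows matrix_mul_matrix_inv: "M ** matrix_inv M = mat 1"
    and matrix_inv_matrix_mul: "matrix_inv M ** M = mat 1"
  using someI_ex[OF assms[unfolded invertible_def]] by (simp_all add: matrix_inv_def)

text \<open>\<open>matrix_inv\<close> is defined by choice. Cramer's rule turns its entries into
  quotients of determinants, hence of polynomials in the entries of \<open>M\<close>, for which
  smoothness is known.\<close>

lemma matrix_inv_cramer:
  fixes M :: "real^'i^'i"
  assumes "det M \<noteq> 0"
  shows "matrix_inv M $ k $ l = det (\<chi> i j. if j = k then axis l 1 $ i else M $ i $ j) * inverse (det M)"
proof -
  have "invertible M" using assms by (simp add: invertible_det_nz)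
  then have "M *v (matrix_inv M *v axis l 1) = axis l 1"
    by (simp add: matrix_vector_mul_assoc matrix_mul_matrix_inv)
  then have "matrix_inv M *v axis l 1 = (\<chi> k. det (\<chi> i j. if j = k then axis l 1 $ i else M $ i $ j) / det M)"
    using cramer[OF assms] by blast
  moreover have "(matrix_inv M *v axis l 1) $ k = matrix_inv M $ k $ l"
    by (simp add: matrix_vector_mul_component inner_axis matrix_vector_mult_basis column_def)
  ultimately show ?thesis by (simp add: field_class.field_divide_inverse)
qed

lemma smooth_at_matrix_inv:
  fixes M :: "'a \<Rightarrow> real^'i^'i"
  assumes A: "smooth_atlas A" and M: "\<And>i j. smooth_at A (\<lambda>q. M q $ i $ j) p" and inv: "invertible (M p)"
  shows "smooth_at A (\<lambda>q. matrix_inv (M q) $ k $ l) p"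
proof -
  have p: "p \<in> mcarrier A" using smooth_at_mcarrier[OF M] .
  have sd: "smooth_at A (\<lambda>q. det (M q)) p" by (rule smooth_at_det[OF A p M])
  have nz: "det (M p) \<noteq> 0" using inv by (simp add: invertible_det_nz)
  have ev: "eventually (\<lambda>q. matrix_inv (M q) $ k $ l =
      det (\<chi> i j. if j = k then axis l 1 $ i else M q $ i $ j) * inverse (det (M q))) (mnhds A p)"
    using smooth_at_nonzero_ev[OF A sd nz] by eventually_elim (rule matrix_inv_cramer)
  have "smooth_at A (\<lambda>q. det (\<chi> i j. if j = k then axis l 1 $ i else M q $ i $ j) * inverse (det (M q))) p"
  proof (intro smooth_at_mult[OF A] smooth_at_inverse[OF A sd nz] smooth_at_det[OF A p])
    fix i j :: 'i
    show "smooth_at A (\<lambda>q. (\<chi> i j. if j = k then axis l 1 $ i else M q $ i $ j) $ i $ j) p"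
      using M[of i j] smooth_at_const[OF A p] by (cases "j = k") simp_all
  qed
  then show ?thesis by (rule iffD2[OF smooth_at_cong[OF A ev]])
qed

section \<open>Coordinate fields and brackets of vector fields\<close>

lemma coord_field_tangent:
  "smooth_atlas A \<Longrightarrow> c \<in> charts A \<Longrightarrow> p \<in> fst c \<Longrightarrow> coord_field A c a p \<in> tangent_space A p"
  unfolding coord_field_def by (simp add: tangent_space_chart)

lemma coord_field_coord:
  "smooth_atlas A \<Longrightarrow> c \<in> charts A \<Longrightarrow> p \<in> fst c \<Longrightarrow> coord_field A c a p (coord c b) = (if a = b then 1 else 0)"
  by (auto simp: coord_field_def tangent_vector_coord axis_def)

lemma coord_field_ev:
  assumes A: "smooth_atlas A" and c: "c \<in> charts A" and p: "p \<in> fst c" and f: "smooth_at A f p"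
  shows "eventually (\<lambda>q. coord_field A c a q f =
    frechet_derivative (f \<circ> chart_inv c) (at (snd c q)) (axis a 1)) (mnhds A p)"
  using smooth_at_eventually[OF A f] by eventually_elim (simp add: coord_field_def tangent_vector_smooth)

lemma coord_field_smooth:
  assumes A: "smooth_atlas A" and c: "c \<in> charts A" and p: "p \<in> fst c" and f: "smooth_at A f p"
  shows "smooth_at A (\<lambda>q. coord_field A c a q f) p"
  unfolding smooth_at_cong[OF A coord_field_ev[OF assms]]
  by (rule smooth_at_chart_fun[OF A c p smooth_near_deriv]) (use f smooth_at_iff[OF A c p] in blast)

lemma smooth_vfield_onD:
  assumes "smooth_vfield_on A W X" "p \<in> W"
  shows "X p \<in> tangent_space A p" "smooth_at A f p \<Longrightarrow> smooth_at A (\<lambda>q. X q f) p"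
    "openin (mtopology A) W"
  using assms unfolding smooth_vfield_on_def by blast+

lemma coord_field_commute:
  assumes A: "smooth_atlas A" and c: "c \<in> charts A" and p: "p \<in> fst c" and f: "smooth_at A f p"
  shows "coord_field A c a p (\<lambda>q. coord_field A c b q f) = coord_field A c b p (\<lambda>q. coord_field A c a q f)"
proof -
  have sm: "smooth_near (f \<circ> chart_inv c) (snd c p)" using f smooth_at_iff[OF A c p] by blast
  have "coord_field A c a p (\<lambda>q. coord_field A c b q f) =
     frechet_derivative (\<lambda>x. frechet_derivative (f \<circ> chart_inv c) (at x) (axis b 1)) (at (snd c p)) (axis a 1)" for a b
    unfolding tv_cong[OF A coord_field_tangent[OF A c p] coord_field_ev[OF A c p f]]
    unfolding coord_field_def by (rule tangent_vector_chart_fun[OF A c p smooth_near_deriv[OF sm]])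
  then show ?thesis using second_derivative_symmetric[OF sm] by simp
qed

lemma lie_bracket_smooth:
  "smooth_at A f p \<Longrightarrow> lie_bracket A X Y p f = X p (\<lambda>q. Y q f) - Y p (\<lambda>q. X q f)"
  by (simp add: lie_bracket_def)

text \<open>Separates the first-order part of u(Y f) from the second-order part, which pairs the
  components of \<open>u\<close> and of \<open>Y p\<close> with the Hessian of \<open>f\<close> in
  the chart.\<close>

lemma vfield_second:
  fixes A :: "('a, real^'n) atlas"
  assumes A: "smooth_atlas A" and c: "c \<in> charts A" and p: "p \<in> fst c" and f: "smooth_at A f p"
    and u: "u \<in> tangent_space A p" and Y: "smooth_vfield_on A W Y" "p \<in> W"
  shows "u (\<lambda>q. Y q f) = (\<Sum>b\<in>UNIV. u (\<lambda>q. Y q (coord c b)) * coord_field A c b p f) +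
    (\<Sum>a\<in>UNIV. \<Sum>b\<in>UNIV. u (coord c a) * Y p (coord c b) * coord_field A c a p (\<lambda>q. coord_field A c b q f))"
proof -
  have pA: "p \<in> mcarrier A" using tangent_space_mcarrier[OF u] .
  have "eventually (\<lambda>q. q \<in> W \<and> q \<in> fst c) (mnhds A p)"
    using eventually_mnhds_openin[OF A smooth_vfield_onD(3)[OF Y] Y(2)]
      eventually_mnhds_openin[OF A openin_chart_domain[OF A c] p] by eventually_elim simp
  then have ev: "eventually (\<lambda>q. Y q f = (\<Sum>b\<in>UNIV. Y q (coord c b) * coord_field A c b q f)) (mnhds A p)"
    by eventually_elim (rule fun_cong[OF tv_expand_vec[OF A c _ smooth_vfield_onD(1)[OF Y(1)]]], simp_all)
  have sY: "smooth_at A (\<lambda>q. Y q (coord c b)) p" for b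
    by (rule smooth_vfield_onD(2)[OF Y smooth_at_coord[OF A c p]])
  note sf = coord_field_smooth[OF A c p f]
  have "u (\<lambda>q. Y q f) = (\<Sum>b\<in>UNIV. Y p (coord c b) * u (\<lambda>q. coord_field A c b q f) +
      u (\<lambda>q. Y q (coord c b)) * coord_field A c b p f)"
    unfolding tv_cong[OF A u ev] by (simp add: tv_sum[OF A u smooth_at_mult[OF A sY sf]] tv_mult[OF A u sY sf])
  also have "\<dots> = (\<Sum>b\<in>UNIV. u (\<lambda>q. Y q (coord c b)) * coord_field A c b p f) +
     (\<Sum>b\<in>UNIV. Y p (coord c b) * u (\<lambda>q. coord_field A c b q f))"
    by (simp add: sum.distrib)
  also have "(\<Sum>b\<in>UNIV. Y p (coord c b) * u (\<lambda>q. coord_field A c b q f)) =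
      (\<Sum>b\<in>UNIV. Y p (coord c b) * (\<Sum>a\<in>UNIV. u (coord c a) * coord_field A c a p (\<lambda>q. coord_field A c b q f)))"
    by (intro sum.cong refl arg_cong2[where f="(*)"] fun_cong[OF tv_expand_vec[OF A c p u]])
  also have "\<dots> = (\<Sum>a\<in>UNIV. \<Sum>b\<in>UNIV. u (coord c a) * Y p (coord c b) * coord_field A c a p (\<lambda>q. coord_field A c b q f))"
    by (subst sum.swap) (simp add: sum_distrib_left mult_ac)
  finally show ?thesis .
qed

text \<open>The second-order parts of X(Y f) and Y(X f) agree since the Hessian is symmetric. The
  difference is a combination of coordinate fields with coefficients independent of
  \<open>f\<close>, hence a tangent vector.\<close>

lemma lie_bracket_tangent:
  fixes A :: "('a, real^'n) atlas"
  assumes A: "smooth_atlas A" and X: "smooth_vfield_on A W X" and Y: "smooth_vfield_on A W Y" and pW: "p \<in> W"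
  shows "lie_bracket A X Y p \<in> tangent_space A p"
proof -
  note Xp = smooth_vfield_onD(1)[OF X pW] and Yp = smooth_vfield_onD(1)[OF Y pW]
  have pA: "p \<in> mcarrier A" using tangent_space_mcarrier[OF Xp] .
  obtain c where c: "c \<in> charts A" and p: "p \<in> fst c" using mcarrier_charts[OF pA A] by blast
  have "lie_bracket A X Y p f = (\<Sum>b\<in>UNIV. (X p (\<lambda>q. Y q (coord c b)) - Y p (\<lambda>q. X q (coord c b))) * coord_field A c b p f)" for f
  proof (cases "smooth_at A f p")
    case f: True
    have "(\<Sum>a\<in>UNIV. \<Sum>b\<in>UNIV. Y p (coord c a) * X p (coord c b) * coord_field A c a p (\<lambda>q. coord_field A c b q f)) =
      (\<Sum>a\<in>UNIV. \<Sum>b\<in>UNIV. X p (coord c a) * Y p (coord c b) * coord_field A c a p (\<lambda>q. coord_field A c b q f))"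
      by (subst sum.swap) (simp add: coord_field_commute[OF A c p f] mult.commute)
    then show ?thesis
      unfolding lie_bracket_smooth[OF f] vfield_second[OF A c p f Xp Y pW] vfield_second[OF A c p f Yp X pW]
      by (simp add: left_diff_distrib sum_subtractf)
  next
    case False
    then show ?thesis by (simp add: lie_bracket_def coord_field_def tangent_vector_def)
  qed
  then have "lie_bracket A X Y p = (\<lambda>f. \<Sum>b\<in>UNIV. (X p (\<lambda>q. Y q (coord c b)) - Y p (\<lambda>q. X q (coord c b))) * coord_field A c b p f)"
    by blast
  then show ?thesis
    using tangent_space_sum[OF A pA, of UNIV "\<lambda>b. coord_field A c b p"] coord_field_tangent[OF A c p] by simp
qed

lemma lie_bracket_vfield:
  fixes A :: "('a, real^'n) atlas"
  assumes A: "smooth_atlas A" and X: "smooth_vfield_on A W X" and Y: "smooth_vfield_on A W Y"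
  shows "smooth_vfield_on A W (lie_bracket A X Y)"
  unfolding smooth_vfield_on_def
proof (intro conjI ballI allI impI)
  fix p f assume p: "p \<in> W" and f: "smooth_at A f p"
  have ev: "eventually (\<lambda>q. lie_bracket A X Y q f = X q (\<lambda>q. Y q f) - Y q (\<lambda>q. X q f)) (mnhds A p)"
    using smooth_at_eventually[OF A f] by eventually_elim (rule lie_bracket_smooth)
  have "smooth_at A (\<lambda>q. X q (\<lambda>q. Y q f) - Y q (\<lambda>q. X q f)) p"
    by (intro smooth_at_diff A smooth_vfield_onD(2)[OF X p] smooth_vfield_onD(2)[OF Y p] f)
  then show "smooth_at A (\<lambda>q. lie_bracket A X Y q f) p" by (rule iffD2[OF smooth_at_cong[OF A ev]])
next
  show "openin (mtopology A) W" using X by (simp add: smooth_vfield_on_def)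
qed (rule lie_bracket_tangent[OF A X Y])

lemma smooth_vfield_on_subset:
  "smooth_vfield_on A W X \<Longrightarrow> openin (mtopology A) W' \<Longrightarrow> W' \<subseteq> W \<Longrightarrow> smooth_vfield_on A W' X"
  by (auto simp: smooth_vfield_on_def)

lemma smooth_vfield_on_sum:
  assumes A: "smooth_atlas A" and W: "openin (mtopology A) W"
    and E: "\<And>i. i \<in> I \<Longrightarrow> smooth_vfield_on A W (E i)" and k: "\<And>i p. i \<in> I \<Longrightarrow> p \<in> W \<Longrightarrow> smooth_at A (k i) p"
  shows "smooth_vfield_on A W (\<lambda>p f. \<Sum>i\<in>I. k i p * E i p f)"
  unfolding smooth_vfield_on_def
proof (intro conjI ballI allI impI W)
  fix p assume p: "p \<in> W"
  have pA: "p \<in> mcarrier A" using openin_subset[OF W] p topspace_mtopology[OF A] by auto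
  show "(\<lambda>f. \<Sum>i\<in>I. k i p * E i p f) \<in> tangent_space A p"
    by (rule tangent_space_sum[OF A pA, where k="\<lambda>i. k i p"]) (rule smooth_vfield_onD(1)[OF E p])
  fix f assume f: "smooth_at A f p"
  show "smooth_at A (\<lambda>q. \<Sum>i\<in>I. k i q * E i q f) p"
    by (intro smooth_at_sum[OF A pA] smooth_at_mult[OF A] k p smooth_vfield_onD(2)[OF E p] f)
qed

text \<open>For horizontal lifts all brackets are vertical, so the last sum vanishes: this is why the
  curvature is tensorial.\<close>

lemma lie_bracket_sum:
  fixes A :: "('a, real^'n) atlas"
  assumes A: "smooth_atlas A" and W: "openin (mtopology A) W" and p: "p \<in> W" and f: "smooth_at A f p"
    and E: "\<And>i. i \<in> I \<Longrightarrow> smooth_vfield_on A W (E i)"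
    and k: "\<And>i q. i \<in> I \<Longrightarrow> q \<in> W \<Longrightarrow> smooth_at A (k i) q"
    and l: "\<And>i q. i \<in> I \<Longrightarrow> q \<in> W \<Longrightarrow> smooth_at A (l i) q"
    and X: "\<And>q f. q \<in> W \<Longrightarrow> X q f = (\<Sum>i\<in>I. k i q * E i q f)"
    and Y: "\<And>q f. q \<in> W \<Longrightarrow> Y q f = (\<Sum>i\<in>I. l i q * E i q f)"
  shows "lie_bracket A X Y p f = (\<Sum>i\<in>I. \<Sum>j\<in>I. k i p * l j p * lie_bracket A (E i) (E j) p f) +
     (\<Sum>i\<in>I. (X p (l i) - Y p (k i)) * E i p f)"
proof -
  have pA: "p \<in> mcarrier A" using openin_subset[OF W] p topspace_mtopology[OF A] by auto
  have second: "X p (\<lambda>q. Y q f) = (\<Sum>i\<in>I. \<Sum>j\<in>I. k i p * l j p * E i p (\<lambda>q. E j q f)) + (\<Sum>j\<in>I. X p (l j) * E j p f)"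
    if k: "\<And>i q. i \<in> I \<Longrightarrow> q \<in> W \<Longrightarrow> smooth_at A (k i) q"
    and l: "\<And>i q. i \<in> I \<Longrightarrow> q \<in> W \<Longrightarrow> smooth_at A (l i) q"
    and X: "\<And>q f. q \<in> W \<Longrightarrow> X q f = (\<Sum>i\<in>I. k i q * E i q f)"
    and Y: "\<And>q f. q \<in> W \<Longrightarrow> Y q f = (\<Sum>i\<in>I. l i q * E i q f)" for X Y k l
  proof -
    have Xp: "X p \<in> tangent_space A p"
    proof -
      have "X p = (\<lambda>f. \<Sum>i\<in>I. k i p * E i p f)" using X[OF p] by blast
      then show ?thesis using smooth_vfield_onD(1)[OF smooth_vfield_on_sum[OF A W E k] p] by simp
    qed
    have ev: "eventually (\<lambda>q. Y q f = (\<Sum>j\<in>I. l j q * E j q f)) (mnhds A p)"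
      using eventually_mnhds_openin[OF A W p] by eventually_elim (rule Y)
    have sm: "smooth_at A (\<lambda>q. E j q f) p" if "j \<in> I" for j by (rule smooth_vfield_onD(2)[OF E[OF that] p f])
    have "X p (\<lambda>q. Y q f) = (\<Sum>j\<in>I. X p (\<lambda>q. l j q * E j q f))"
      unfolding tv_cong[OF A Xp ev] by (rule tv_sum[OF A Xp]) (intro smooth_at_mult[OF A] l p sm)
    also have "\<dots> = (\<Sum>j\<in>I. l j p * X p (\<lambda>q. E j q f) + X p (l j) * E j p f)"
      by (intro sum.cong refl tv_mult[OF A Xp] l p sm)
    also have "\<dots> = (\<Sum>j\<in>I. \<Sum>i\<in>I. k i p * l j p * E i p (\<lambda>q. E j q f)) + (\<Sum>j\<in>I. X p (l j) * E j p f)"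
      by (simp add: X[OF p, of "\<lambda>q. E _ q f"] sum.distrib sum_distrib_left mult_ac)
    finally show ?thesis by (subst sum.swap) simp
  qed
  have swap: "(\<Sum>i\<in>I. \<Sum>j\<in>I. l i p * k j p * E i p (\<lambda>q. E j q f)) = (\<Sum>i\<in>I. \<Sum>j\<in>I. k i p * l j p * E j p (\<lambda>q. E i q f))"
    by (subst sum.swap) (simp add: mult_ac)
  have XY: "X p (\<lambda>q. Y q f) = (\<Sum>i\<in>I. \<Sum>j\<in>I. k i p * l j p * E i p (\<lambda>q. E j q f)) + (\<Sum>j\<in>I. X p (l j) * E j p f)"
    by (rule second) (fact k l X Y)+
  have YX: "Y p (\<lambda>q. X q f) = (\<Sum>i\<in>I. \<Sum>j\<in>I. k i p * l j p * E j p (\<lambda>q. E i q f)) + (\<Sum>j\<in>I. Y p (k j) * E j p f)"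
    unfolding swap[symmetric] by (rule second) (fact k l X Y)+
  show ?thesis
    unfolding lie_bracket_smooth[OF f] XY YX
    by (simp add: sum_subtractf left_diff_distrib right_diff_distrib)
qed

section \<open>Principal bundles\<close>

locale chaplygin =
  fixes S :: "('q, 'g, 'n::finite, 'm::finite, 'k::finite) chaplygin_data"
    and \<xi> :: "'k \<Rightarrow> 'g tvec"
  assumes sys: "chaplygin_system S" and basis: "lie_algebra_basis S \<xi>"
begin

abbreviation "Q \<equiv> Qman S"
abbreviation "B \<equiv> Bman S"
abbreviation "GA \<equiv> Gman S"
abbreviation "G \<equiv> Ggrp S"
abbreviation "pr \<equiv> proj S"

lemma Q: "smooth_atlas Q" and GA: "smooth_atlas GA" and B: "smooth_atlas B"
  using sys by (simp_all add: chaplygin_system_def smooth_manifold_def lie_group_def principal_bundle_def)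

lemma group_G: "group G" and carrier_G: "carrier G = mcarrier GA"
  and smooth_mult: "smooth_map (prod_atlas GA GA) GA (\<lambda>(g, h). g \<otimes>\<^bsub>G\<^esub> h)"
  and group_action: "group_action G (mcarrier Q) (act S)"
  and smooth_act: "smooth_map (prod_atlas GA Q) Q (\<lambda>(g, p). act S g p)"
  and mcarrier_B: "mcarrier B = orbits G (mcarrier Q) (act S)"
  and smooth_pr: "smooth_map Q B pr"
  and riem: "riemannian_metric Q (metric S)"
  and smooth_D: "smooth_distribution TYPE('m) Q (distr S)"
  using sys by (simp_all add: chaplygin_system_def lie_group_def smooth_action_def principal_bundle_def proj_def)

lemma chaplygin_invariance:
  "\<forall>g\<in>carrier G. \<forall>p\<in>mcarrier Q. \<forall>u\<in>tangent_space Q p. \<forall>v\<in>tangent_space Q p.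
     metric S (act S g p) (tangent_map Q (act S g) p u) (tangent_map Q (act S g) p v) = metric S p u v"
  "\<forall>g\<in>carrier G. \<forall>p\<in>mcarrier Q. tangent_map Q (act S g) p ` distr S p = distr S (act S g p)"
  "\<forall>p\<in>mcarrier Q. distr S p \<subseteq> tangent_space Q p \<and>
     (\<forall>v\<in>tangent_space Q p. \<exists>!dw. dw \<in> distr S p \<times> vertical_space S p \<and> v = (\<lambda>f. fst dw f + snd dw f))"
  by (insert sys, unfold chaplygin_system_def, elim conjE, assumption)+

lemma metric_invariant: "g \<in> carrier G \<Longrightarrow> p \<in> mcarrier Q \<Longrightarrow> u \<in> tangent_space Q p \<Longrightarrow> v \<in> tangent_space Q p \<Longrightarrow>
    metric S (act S g p) (tangent_map Q (act S g) p u) (tangent_map Q (act S g) p v) = metric S p u v"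
  and distr_invariant: "g \<in> carrier G \<Longrightarrow> p \<in> mcarrier Q \<Longrightarrow>
    tangent_map Q (act S g) p ` distr S p = distr S (act S g p)"
  and distr_tangent: "p \<in> mcarrier Q \<Longrightarrow> distr S p \<subseteq> tangent_space Q p"
  and distr_split: "p \<in> mcarrier Q \<Longrightarrow> v \<in> tangent_space Q p \<Longrightarrow>
     \<exists>!dw. dw \<in> distr S p \<times> vertical_space S p \<and> v = (\<lambda>f. fst dw f + snd dw f)"
  by (simp add: chaplygin_invariance(1), simp add: chaplygin_invariance(2),
      simp add: chaplygin_invariance(3), rule bspec[OF conjunct2[OF bspec[OF chaplygin_invariance(3)]]])

lemma one_carrier: "\<one>\<^bsub>G\<^esub> \<in> mcarrier GA" and mult_carrier: "g \<in> mcarrier GA \<Longrightarrow> h \<in> mcarrier GA \<Longrightarrow> g \<otimes>\<^bsub>G\<^esub> h \<in> mcarrier GA"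
  and inv_carrier: "g \<in> mcarrier GA \<Longrightarrow> inv\<^bsub>G\<^esub> g \<in> mcarrier GA"
  unfolding carrier_G[symmetric]
  by (rule monoid.one_closed[OF group.is_monoid[OF group_G]], rule monoid.m_closed[OF group.is_monoid[OF group_G]],
      assumption+, rule group.inv_closed[OF group_G])

lemma act_carrier: "g \<in> carrier G \<Longrightarrow> p \<in> mcarrier Q \<Longrightarrow> act S g p \<in> mcarrier Q"
  by (rule group_action.element_image[OF group_action _ _ refl])

lemma act_mult: "p \<in> mcarrier Q \<Longrightarrow> g \<in> carrier G \<Longrightarrow> h \<in> carrier G \<Longrightarrow> act S (g \<otimes>\<^bsub>G\<^esub> h) p = act S g (act S h p)"
  by (rule group_action.composition_rule[OF group_action])

lemma act_one: "p \<in> mcarrier Q \<Longrightarrow> act S \<one>\<^bsub>G\<^esub> p = p"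
  using fun_cong[OF group_action.id_eq_one[OF group_action], of p] by simp

lemma pr_mem: "p \<in> mcarrier Q \<Longrightarrow> p \<in> pr p"
  unfolding proj_def orbit_def mem_Collect_eq
  by (rule exI[of _ "\<one>\<^bsub>G\<^esub>"]) (simp add: act_one carrier_G one_carrier)

lemma pr_act: assumes "p \<in> mcarrier Q" "g \<in> carrier G" shows "pr (act S g p) = pr p"
proof -
  have "act S h p \<in> orbit G (act S) (act S g p)" if h: "h \<in> carrier G" for h
  proof -
    have "h \<otimes>\<^bsub>G\<^esub> inv\<^bsub>G\<^esub> g \<in> carrier G" "(h \<otimes>\<^bsub>G\<^esub> inv\<^bsub>G\<^esub> g) \<otimes>\<^bsub>G\<^esub> g = h"
      using h assms group_G
      by (simp_all add: group.is_monoid monoid.m_closed monoid.m_assoc group.l_inv monoid.r_one)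
    then show ?thesis unfolding orbit_def using act_mult[OF assms(1) _ assms(2)] by fastforce
  qed
  moreover have "act S h (act S g p) \<in> orbit G (act S) p" if h: "h \<in> carrier G" for h
    unfolding orbit_def using act_mult[OF assms(1) h assms(2)] monoid.m_closed[OF group.is_monoid[OF group_G] h assms(2)]
    by (auto intro!: exI[of _ "h \<otimes>\<^bsub>G\<^esub> g"])
  ultimately show ?thesis unfolding proj_def
    by (auto simp: orbit_def)
qed

lemma pr_memD: assumes "p \<in> mcarrier Q" "q \<in> pr p" shows "\<exists>g\<in>carrier G. q = act S g p"
  using assms by (auto simp: proj_def orbit_def)

lemma pr_mcarrier: "p \<in> mcarrier Q \<Longrightarrow> pr p \<in> mcarrier B"
  unfolding mcarrier_B orbits_def proj_def by blast

lemma mcarrier_B_E: assumes "y \<in> mcarrier B" obtains p where "p \<in> mcarrier Q" "pr p = y"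
  using assms unfolding mcarrier_B orbits_def proj_def by blast

lemma smap_pr: "p \<in> mcarrier Q \<Longrightarrow> smap Q B pr p"
  by (rule smooth_map_smap[OF Q B smooth_pr])

lemma smap_act: assumes "g \<in> carrier G" "p \<in> mcarrier Q" shows "smap Q Q (act S g) p"
proof -
  have g: "g \<in> mcarrier GA" using assms carrier_G by simp
  have "smap (prod_atlas GA Q) Q (\<lambda>(g, p). act S g p) (g, p)"
    by (rule smooth_map_smap[OF prod_atlas_smooth[OF GA Q] Q smooth_act]) (simp add: prod_atlas_mcarrier g assms)
  from smap_comp[OF smap_Pair_right[OF GA Q g assms(2)] this] show ?thesis by simp
qed

lemma smap_orbit: assumes "g \<in> carrier G" "p \<in> mcarrier Q" shows "smap GA Q (\<lambda>g. act S g p) g"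
proof -
  have g: "g \<in> mcarrier GA" using assms carrier_G by simp
  have "smap (prod_atlas GA Q) Q (\<lambda>(g, p). act S g p) (g, p)"
    by (rule smooth_map_smap[OF prod_atlas_smooth[OF GA Q] Q smooth_act]) (simp add: prod_atlas_mcarrier g assms)
  from smap_comp[OF smap_Pair_left[OF GA Q g assms(2)] this] show ?thesis by simp
qed

lemma smap_right_mult: assumes "g \<in> carrier G" "k \<in> carrier G" shows "smap GA GA (\<lambda>g. g \<otimes>\<^bsub>G\<^esub> k) g"
proof -
  have g: "g \<in> mcarrier GA" "k \<in> mcarrier GA" using assms carrier_G by simp_all
  have "smap (prod_atlas GA GA) GA (\<lambda>(g, h). g \<otimes>\<^bsub>G\<^esub> h) (g, k)"
    by (rule smooth_map_smap[OF prod_atlas_smooth[OF GA GA] GA smooth_mult]) (simp add: prod_atlas_mcarrier g)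
  from smap_comp[OF smap_Pair_left[OF GA GA g] this] show ?thesis by simp
qed

lemma openin_pr_vimage:
  assumes U: "openin (mtopology B) U"
  shows "openin (mtopology Q) {p \<in> mcarrier Q. pr p \<in> U}"
proof (subst openin_subopen, intro ballI)
  fix p assume "p \<in> {p \<in> mcarrier Q. pr p \<in> U}"
  then have p: "p \<in> mcarrier Q" "pr p \<in> U" by auto
  have "eventually (\<lambda>q. pr q \<in> U) (mnhds Q p)"
    by (rule smap_eventually[OF smap_pr[OF p(1)] eventually_mnhds_openin[OF B U p(2)]])
  then obtain W where W: "openin (mtopology Q) W" "p \<in> W" "\<forall>q\<in>W. pr q \<in> U"
    unfolding eventually_mnhds[OF Q p(1)] by blast
  then have "W \<subseteq> mcarrier Q" using openin_subset topspace_mtopology[OF Q] by metis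
  then show "\<exists>W. openin (mtopology Q) W \<and> p \<in> W \<and> W \<subseteq> {p \<in> mcarrier Q. pr p \<in> U}"
    using W by blast
qed

text \<open>A trivialization \<open>\<psi>\<close> with inverse \<open>\<phi>\<close>, restated
  pointwise. Equivariance is recorded twice: for \<open>\<phi>\<close> it describes the orbit map in
  the trivialization (used for the spanning of the generators), for \<open>\<psi>\<close> it
  recovers the group element (used for their independence).\<close>

definition local_triv :: "'q set set \<Rightarrow> ('q \<Rightarrow> 'q set \<times> 'g) \<Rightarrow> ('q set \<times> 'g \<Rightarrow> 'q) \<Rightarrow> 'q \<Rightarrow> bool" where
  "local_triv U \<psi> \<phi> p \<longleftrightarrow> openin (mtopology B) U \<and> pr p \<in> U \<and>
     smap Q (prod_atlas (restrict_atlas B U) GA) \<psi> p \<and>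
     (\<forall>z\<in>U \<times> mcarrier GA. smap (prod_atlas (restrict_atlas B U) GA) Q \<phi> z \<and> pr (\<phi> z) = fst z) \<and>
     (\<forall>q\<in>mcarrier Q. pr q \<in> U \<longrightarrow> \<phi> (\<psi> q) = q \<and> \<psi> q = (pr q, snd (\<psi> q)) \<and> snd (\<psi> q) \<in> mcarrier GA \<and>
        (\<forall>g\<in>carrier G. \<phi> (pr q, g \<otimes>\<^bsub>G\<^esub> snd (\<psi> q)) = act S g q \<and>
           snd (\<psi> (act S g q)) = g \<otimes>\<^bsub>G\<^esub> snd (\<psi> q)))"

lemma local_trivD:
  assumes "local_triv U \<psi> \<phi> p"
  shows "openin (mtopology B) U" "pr p \<in> U"
    "smap Q (prod_atlas (restrict_atlas B U) GA) \<psi> p"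
    "z \<in> U \<times> mcarrier GA \<Longrightarrow> smap (prod_atlas (restrict_atlas B U) GA) Q \<phi> z"
    "z \<in> U \<times> mcarrier GA \<Longrightarrow> pr (\<phi> z) = fst z"
    "q \<in> mcarrier Q \<Longrightarrow> pr q \<in> U \<Longrightarrow> \<phi> (\<psi> q) = q"
    "q \<in> mcarrier Q \<Longrightarrow> pr q \<in> U \<Longrightarrow> \<psi> q = (pr q, snd (\<psi> q)) \<and> snd (\<psi> q) \<in> mcarrier GA"
    "g \<in> carrier G \<Longrightarrow> q \<in> mcarrier Q \<Longrightarrow> pr q \<in> U \<Longrightarrow> \<phi> (pr q, g \<otimes>\<^bsub>G\<^esub> snd (\<psi> q)) = act S g q"
    "g \<in> carrier G \<Longrightarrow> q \<in> mcarrier Q \<Longrightarrow> pr q \<in> U \<Longrightarrow> snd (\<psi> (act S g q)) = g \<otimes>\<^bsub>G\<^esub> snd (\<psi> q)"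
  using assms unfolding local_triv_def by blast+

lemma trivialization:
  assumes p: "p \<in> mcarrier Q"
  shows "\<exists>U \<psi> \<phi>. local_triv U \<psi> \<phi> p"
proof -
  have "\<forall>x\<in>mcarrier B. \<exists>U \<psi>. openin (mtopology B) U \<and> x \<in> U \<and>
        diffeomorphism (restrict_atlas Q {p \<in> mcarrier Q. pr p \<in> U})
          (prod_atlas (restrict_atlas B U) GA) \<psi> \<and>
        (\<forall>p\<in>mcarrier Q. pr p \<in> U \<longrightarrow> fst (\<psi> p) = pr p \<and>
           (\<forall>g\<in>carrier G. snd (\<psi> (act S g p)) = g \<otimes>\<^bsub>G\<^esub> snd (\<psi> p)))"
    using sys unfolding chaplygin_system_def principal_bundle_def proj_def by (elim conjE)
  from bspec[OF this pr_mcarrier[OF p]] obtain U \<psi> where U: "openin (mtopology B) U" "pr p \<in> U"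
    and dif: "diffeomorphism (restrict_atlas Q {p \<in> mcarrier Q. pr p \<in> U}) (prod_atlas (restrict_atlas B U) GA) \<psi>"
    and *: "\<forall>p\<in>mcarrier Q. pr p \<in> U \<longrightarrow> fst (\<psi> p) = pr p \<and>
           (\<forall>g\<in>carrier G. snd (\<psi> (act S g p)) = g \<otimes>\<^bsub>G\<^esub> snd (\<psi> p))" by (elim exE conjE)
  have \<psi>: "fst (\<psi> q) = pr q" "g \<in> carrier G \<Longrightarrow> snd (\<psi> (act S g q)) = g \<otimes>\<^bsub>G\<^esub> snd (\<psi> q)"
    if "q \<in> mcarrier Q" "pr q \<in> U" for g q
    using * that by blast+
  let ?W = "{p \<in> mcarrier Q. pr p \<in> U}"
  let ?T = "prod_atlas (restrict_atlas B U) GA"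
  have W: "openin (mtopology Q) ?W" by (rule openin_pr_vimage[OF U(1)])
  have cW: "mcarrier (restrict_atlas Q ?W) = ?W" by (rule restrict_atlas_mcarrier[OF Q W])
  have cT: "mcarrier ?T = U \<times> mcarrier GA" by (simp add: prod_atlas_mcarrier restrict_atlas_mcarrier[OF B U(1)])
  have sT: "smooth_atlas ?T" by (intro prod_atlas_smooth restrict_atlas_smooth B GA)
  define \<phi> where "\<phi> = inv_into ?W \<psi>"
  have bij: "bij_betw \<psi> ?W (U \<times> mcarrier GA)" and s\<psi>: "smooth_map (restrict_atlas Q ?W) ?T \<psi>"
    and s\<phi>: "smooth_map ?T (restrict_atlas Q ?W) \<phi>"
    using dif unfolding diffeomorphism_def cW cT \<phi>_def by blast+
  have \<phi>W: "\<phi> z \<in> ?W" if "z \<in> U \<times> mcarrier GA" for z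
    unfolding \<phi>_def by (rule inv_into_into) (use that bij_betw_imp_surj_on[OF bij] in simp)
  have \<psi>\<phi>: "\<psi> (\<phi> z) = z" if "z \<in> U \<times> mcarrier GA" for z
    unfolding \<phi>_def using bij_betw_inv_into_right[OF bij that] .
  have \<phi>\<psi>: "\<phi> (\<psi> q) = q" if "q \<in> mcarrier Q" "pr q \<in> U" for q
    unfolding \<phi>_def by (rule bij_betw_inv_into_left[OF bij]) (simp add: that)
  have \<psi>T: "\<psi> q \<in> U \<times> mcarrier GA" if "q \<in> mcarrier Q" "pr q \<in> U" for q
    by (rule bij_betw_apply[OF bij]) (simp add: that)
  have s\<psi>p: "smap Q ?T \<psi> p"
    using smooth_map_smap[OF restrict_atlas_smooth[OF Q] sT s\<psi>, of p] p U(2)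
    by (simp add: cW smap_restrict_dom[OF Q W])
  have s\<phi>z: "smap ?T Q \<phi> z" if "z \<in> U \<times> mcarrier GA" for z
    using smooth_map_smap[OF sT restrict_atlas_smooth[OF Q] s\<phi>, of z] that smap_restrict_cod[OF Q W, of \<phi> z ?T] \<phi>W[OF that]
    by (simp add: cT)
  have act: "\<phi> (pr q, g \<otimes>\<^bsub>G\<^esub> snd (\<psi> q)) = act S g q" if g: "g \<in> carrier G" and q: "q \<in> mcarrier Q" "pr q \<in> U" for g q
  proof -
    have "\<psi> (act S g q) = (pr q, g \<otimes>\<^bsub>G\<^esub> snd (\<psi> q))"
      using \<psi>(1)[of "act S g q"] \<psi>(2)[OF q g] act_carrier[OF g q(1)] pr_act[OF q(1) g] q by (simp add: prod_eq_iff)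
    then show ?thesis using \<phi>\<psi>[of "act S g q"] act_carrier[OF g q(1)] pr_act[OF q(1) g] q by simp
  qed
  have \<psi>2: "\<psi> q = (pr q, snd (\<psi> q)) \<and> snd (\<psi> q) \<in> mcarrier GA" if q: "q \<in> mcarrier Q" "pr q \<in> U" for q
    using \<psi>(1)[OF q] \<psi>T[OF q] by (simp add: prod_eq_iff mem_Times_iff)
  have pr\<phi>: "pr (\<phi> z) = fst z" if z: "z \<in> U \<times> mcarrier GA" for z
    using \<psi>(1)[of "\<phi> z"] \<phi>W[OF z] \<psi>\<phi>[OF z] by simp
  have "local_triv U \<psi> \<phi> p"
    unfolding local_triv_def using U s\<psi>p s\<phi>z \<phi>\<psi> \<psi>2 pr\<phi> act \<psi>(2) by blast
  then show ?thesis by blast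
qed

text \<open>The slice on which the group component is constantly that of \<open>p\<close>. It serves
  for the surjectivity of the tangent map of \<open>pr\<close> and for the smoothness of functions
  that descend to the base.\<close>

lemma local_section:
  assumes p: "p \<in> mcarrier Q"
  obtains \<sigma> where "smap B Q \<sigma> (pr p)" "\<sigma> (pr p) = p" "eventually (\<lambda>y. pr (\<sigma> y) = y) (mnhds B (pr p))"
proof -
  obtain U \<psi> \<phi> where "local_triv U \<psi> \<phi> p" using trivialization[OF p] by blast
  note T = local_trivD[OF this]
  define k where "k = snd (\<psi> p)"
  have k: "k \<in> mcarrier GA" "\<psi> p = (pr p, k)" using T(7)[OF p T(2)] by (auto simp: k_def)
  have "pr p \<in> mcarrier (restrict_atlas B U)" using restrict_atlas_mcarrier[OF B T(1)] T(2) by simp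
  then have "smap (restrict_atlas B U) (prod_atlas (restrict_atlas B U) GA) (\<lambda>y. (y, k)) (pr p)"
    by (rule smap_Pair_left[OF restrict_atlas_smooth[OF B] GA _ k(1)])
  moreover have "smap (prod_atlas (restrict_atlas B U) GA) Q \<phi> (pr p, k)" using T(2,4) k by simp
  ultimately have "smap (restrict_atlas B U) Q (\<lambda>y. \<phi> (y, k)) (pr p)"
    by (rule smap_comp)
  then have 1: "smap B Q (\<lambda>y. \<phi> (y, k)) (pr p)" by (simp add: smap_restrict_dom[OF B T(1,2)])
  have 2: "\<phi> (pr p, k) = p" using T(6)[OF p T(2)] k(2) by simp
  have 3: "eventually (\<lambda>y. pr (\<phi> (y, k)) = y) (mnhds B (pr p))"
    using eventually_mnhds_openin[OF B T(1,2)] by eventually_elim (use T(5) k(1) in simp)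
  from that[OF 1 2 3] show thesis .
qed

abbreviation "Tpr p \<equiv> tangent_map B pr p"

lemma Tpr_tangent: "v \<in> tangent_space Q p \<Longrightarrow> Tpr p v \<in> tangent_space B (pr p)"
  by (rule tangent_map_in[OF Q B smap_pr]) (simp_all add: tangent_space_mcarrier)

lemma Tpr_surj:
  assumes p: "p \<in> mcarrier Q" and u: "u \<in> tangent_space B (pr p)"
  shows "\<exists>v\<in>tangent_space Q p. Tpr p v = u"
proof -
  obtain \<sigma> where s: "smap B Q \<sigma> (pr p)" "\<sigma> (pr p) = p" "eventually (\<lambda>y. pr (\<sigma> y) = y) (mnhds B (pr p))"
    using local_section[OF p] .
  let ?v = "tangent_map Q \<sigma> (pr p) u"
  have "?v \<in> tangent_space Q p" using tangent_map_in[OF B Q s(1) u] s(2) by simp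
  moreover have "Tpr p ?v = u"
  proof
    fix h
    show "Tpr p ?v h = u h"
    proof (cases "smooth_at B h (pr p)")
      case h: True
      have "smooth_at Q (\<lambda>q. h (pr q)) p" by (rule smapD(4)[OF smap_pr[OF p] h])
      then have "Tpr p ?v h = u (\<lambda>y. h (pr (\<sigma> y)))"
        using s(2) by (simp add: tangent_map_smooth[of B h pr p, OF h] tangent_map_smooth)
      also have "\<dots> = u h" by (rule tv_cong[OF B u]) (use s(3) in eventually_elim, simp)
      finally show ?thesis .
    qed (use tv_nonsmooth[OF u] in \<open>simp add: tangent_map_def\<close>)
  qed
  ultimately show ?thesis by blast
qed

section \<open>Vertical vectors and infinitesimal generators\<close>

lemma vertical_spaceD: "v \<in> vertical_space S p \<Longrightarrow> v \<in> tangent_space Q p" "v \<in> vertical_space S p \<Longrightarrow> Tpr p v = (\<lambda>h. 0)"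
  by (simp_all add: vertical_space_def)

lemma tangent_space_one: "tangent_space GA \<one>\<^bsub>G\<^esub> = range (\<lambda>c. lin_comb c \<xi>)"
  and \<xi>_indep: "lin_comb c \<xi> = (\<lambda>f. 0) \<Longrightarrow> c i = 0"
  using basis unfolding lie_algebra_basis_def is_basis_def by blast+

lemma \<xi>_tangent: "\<xi> i \<in> tangent_space GA \<one>\<^bsub>G\<^esub>"
proof -
  have "\<xi> i = lin_comb (\<lambda>j. if j = i then 1 else 0) \<xi>"
    by (auto simp: lin_comb_def if_distrib[of "\<lambda>x. x * _"] cong: if_cong)
  then show ?thesis unfolding tangent_space_one by blast
qed

lemma smap_orbit_one: "p \<in> mcarrier Q \<Longrightarrow> smap GA Q (\<lambda>g. act S g p) \<one>\<^bsub>G\<^esub>"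
  by (rule smap_orbit) (simp_all add: carrier_G one_carrier)

lemma Vgen_tangent: "p \<in> mcarrier Q \<Longrightarrow> Vgen S \<xi> i p \<in> tangent_space Q p"
  using tangent_map_in[OF GA Q smap_orbit_one \<xi>_tangent, of p i] by (simp add: Vgen_def act_one)

lemma Vgen_vertical: assumes p: "p \<in> mcarrier Q" shows "Vgen S \<xi> i p \<in> vertical_space S p"
proof -
  have "Tpr p (Vgen S \<xi> i p) h = 0" for h
  proof (cases "smooth_at B h (pr p)")
    case h: True
    have "smooth_at Q (\<lambda>q. h (pr q)) (act S \<one>\<^bsub>G\<^esub> p)" using smapD(4)[OF smap_pr[OF p] h] by (simp add: act_one p)
    then have "Tpr p (Vgen S \<xi> i p) h = \<xi> i (\<lambda>g. h (pr (act S g p)))"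
      by (simp add: tangent_map_smooth[of B h pr p, OF h] Vgen_def tangent_map_smooth[of Q _ "\<lambda>g. act S g p"])
    also have "\<dots> = \<xi> i (\<lambda>g. h (pr p))"
      by (rule tv_cong[OF GA \<xi>_tangent])
        (use eventually_mnhds_mcarrier[OF GA, of "\<one>\<^bsub>G\<^esub>"] in eventually_elim, simp add: pr_act[OF p] carrier_G)
    also have "\<dots> = 0" by (rule tv_const[OF GA \<xi>_tangent])
    finally show ?thesis .
  qed (simp add: tangent_map_def)
  then show ?thesis using Vgen_tangent[OF p] unfolding vertical_space_def by blast
qed

lemma Vgen_lin_comb: "lin_comb c (\<lambda>i. Vgen S \<xi> i p) = tangent_map Q (\<lambda>g. act S g p) \<one>\<^bsub>G\<^esub> (lin_comb c \<xi>)"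
  by (simp add: Vgen_def tangent_map_lin_comb)

text \<open>In a trivialization with \<open>\<psi> p = (pr p, k)\<close> a vertical vector comes
  from a tangent vector of the group at \<open>k\<close>. Near \<open>k\<close> the map sending g to
  \<open>\<phi> (pr p, g)\<close> is right translation by the inverse of \<open>k\<close> followed
  by the orbit map of \<open>p\<close>, so the vector comes from the Lie algebra through the orbit
  map, as the generators do.\<close>

lemma Vgen_span:
  assumes v: "v \<in> vertical_space S p"
  shows "\<exists>c. v = lin_comb c (\<lambda>i. Vgen S \<xi> i p)"
proof -
  note vT = vertical_spaceD(1)[OF v]
  have p: "p \<in> mcarrier Q" by (rule tangent_space_mcarrier[OF vT])
  obtain U \<psi> \<phi> where "local_triv U \<psi> \<phi> p" using trivialization[OF p] by blast
  note T = local_trivD[OF this]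
  let ?BU = "restrict_atlas B U"
  let ?T = "prod_atlas ?BU GA"
  have BU: "smooth_atlas ?BU" by (rule restrict_atlas_smooth[OF B])
  have sT: "smooth_atlas ?T" by (rule prod_atlas_smooth[OF BU GA])
  define k where "k = snd (\<psi> p)"
  have k: "k \<in> mcarrier GA" "\<psi> p = (pr p, k)" using T(7)[OF p T(2)] by (auto simp: k_def)
  have y: "pr p \<in> mcarrier ?BU" using restrict_atlas_mcarrier[OF B T(1)] T(2) by simp
  define u where "u = tangent_map ?T \<psi> p v"
  have u: "u \<in> tangent_space ?T (pr p, k)" unfolding u_def using tangent_map_in[OF Q sT T(3) vT] k(2) by simp
  have W: "openin (mtopology Q) {q \<in> mcarrier Q. pr q \<in> U}" by (rule openin_pr_vimage[OF T(1)])
  have evW: "eventually (\<lambda>q. q \<in> mcarrier Q \<and> pr q \<in> U) (mnhds Q p)"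
    using eventually_mnhds_openin[OF Q W, of p] p T(2) by simp
  have "tangent_map ?BU fst (pr p, k) u = (\<lambda>h. 0)"
  proof
    fix h
    show "tangent_map ?BU fst (pr p, k) u h = 0"
    proof (cases "smooth_at ?BU h (pr p)")
      case h: True
      have hB: "smooth_at B h (pr p)" using h restrict_atlas_smooth_at[OF B T(1,2)] by blast
      have h1: "smooth_at ?T (\<lambda>z. h (fst z)) (pr p, k)"
        using smapD(4)[OF smap_fst[OF BU GA y k(1)], of h] h by simp
      have "tangent_map ?BU fst (pr p, k) u h = u (\<lambda>z. h (fst z))"
        using tangent_map_smooth[of ?BU h fst "(pr p, k)" u] h by simp
      also have "\<dots> = v (\<lambda>q. h (fst (\<psi> q)))"
        unfolding u_def using tangent_map_smooth[of ?T "\<lambda>z. h (fst z)" \<psi> p v] h1 k(2) by simp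
      also have "\<dots> = v (\<lambda>q. h (pr q))"
        by (rule tv_cong[OF Q vT]) (use evW in eventually_elim, metis T(7) fst_conv)
      also have "\<dots> = Tpr p v h" by (simp add: tangent_map_smooth[of B h pr p, OF hB])
      finally show ?thesis using vertical_spaceD(2)[OF v] by simp
    qed (simp add: tangent_map_def)
  qed
  from tangent_vector_prod_vertical[OF BU GA u this]
  have ueq: "u = tangent_map ?T (\<lambda>q. (pr p, q)) k (tangent_map GA snd (pr p, k) u)" .
  define w where "w = tangent_map GA snd (pr p, k) u"
  have w: "w \<in> tangent_space GA k"
    unfolding w_def using tangent_map_in[OF sT GA smap_snd[OF BU GA y k(1)] u] by simp
  have kG: "k \<in> carrier G" "inv\<^bsub>G\<^esub> k \<in> carrier G" using k(1) inv_carrier carrier_G by simp_all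
  have kk: "k \<otimes>\<^bsub>G\<^esub> inv\<^bsub>G\<^esub> k = \<one>\<^bsub>G\<^esub>" by (rule group.r_inv[OF group_G kG(1)])
  have sR: "smap GA GA (\<lambda>g. g \<otimes>\<^bsub>G\<^esub> inv\<^bsub>G\<^esub> k) k" by (rule smap_right_mult[OF kG])
  \<comment> \<open>Right translation carries the group part of \<open>v\<close> from
    \<open>k\<close> to the identity, where it can be expanded in \<open>\<xi>\<close>.\<close>
  define \<zeta> where "\<zeta> = tangent_map GA (\<lambda>g. g \<otimes>\<^bsub>G\<^esub> inv\<^bsub>G\<^esub> k) k w"
  have \<zeta>: "\<zeta> \<in> tangent_space GA \<one>\<^bsub>G\<^esub>" unfolding \<zeta>_def using tangent_map_in[OF GA GA sR w] kk by simp
  then obtain c where c: "\<zeta> = lin_comb c \<xi>" unfolding tangent_space_one by blast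
  have "v = tangent_map Q (\<lambda>g. act S g p) \<one>\<^bsub>G\<^esub> \<zeta>"
  proof
    fix f
    show "v f = tangent_map Q (\<lambda>g. act S g p) \<one>\<^bsub>G\<^esub> \<zeta> f"
    proof (cases "smooth_at Q f p")
      case f: True
      have s\<phi>: "smap ?T Q \<phi> (pr p, k)" using T(2,4) k(1) by simp
      have \<phi>p: "\<phi> (pr p, k) = p" using T(6)[OF p T(2)] k(2) by simp
      have f1: "smooth_at ?T (\<lambda>z. f (\<phi> z)) (pr p, k)" using smapD(4)[OF s\<phi>] f \<phi>p by simp
      have "v f = v (\<lambda>q. f (\<phi> (\<psi> q)))"
        by (rule tv_cong[OF Q vT]) (use evW in eventually_elim, metis T(6))
      also have "\<dots> = u (\<lambda>z. f (\<phi> z))"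
        unfolding u_def using tangent_map_smooth[of ?T "\<lambda>z. f (\<phi> z)" \<psi> p v] f1 k(2) by simp
      also have "\<dots> = w (\<lambda>g. f (\<phi> (pr p, g)))"
        by (subst ueq) (simp add: w_def tangent_map_smooth[of ?T "\<lambda>z. f (\<phi> z)" "\<lambda>q. (pr p, q)", OF f1])
      also have "\<dots> = w (\<lambda>g. f (act S (g \<otimes>\<^bsub>G\<^esub> inv\<^bsub>G\<^esub> k) p))"
      proof (rule tv_cong[OF GA w])
        show "eventually (\<lambda>g. f (\<phi> (pr p, g)) = f (act S (g \<otimes>\<^bsub>G\<^esub> inv\<^bsub>G\<^esub> k) p)) (mnhds GA k)"
          using eventually_mnhds_mcarrier[OF GA, of k]
        proof eventually_elim
          fix g assume "g \<in> mcarrier GA"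
          then have g: "g \<in> carrier G" by (simp add: carrier_G)
          have gk: "g \<otimes>\<^bsub>G\<^esub> inv\<^bsub>G\<^esub> k \<in> carrier G" using g kG group_G by (simp add: group.is_monoid monoid.m_closed)
          have "(g \<otimes>\<^bsub>G\<^esub> inv\<^bsub>G\<^esub> k) \<otimes>\<^bsub>G\<^esub> k = g"
            using g kG group_G by (simp add: group.is_monoid monoid.m_assoc group.l_inv monoid.r_one)
          then show "f (\<phi> (pr p, g)) = f (act S (g \<otimes>\<^bsub>G\<^esub> inv\<^bsub>G\<^esub> k) p)"
            using T(8)[OF gk p T(2)] by (simp add: k_def)
        qed
      qed
      also have "\<dots> = tangent_map Q (\<lambda>g. act S g p) \<one>\<^bsub>G\<^esub> \<zeta> f"
      proof -
        have f2: "smooth_at Q f (act S \<one>\<^bsub>G\<^esub> p)" using f by (simp add: act_one[OF p])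
        have f3: "smooth_at GA (\<lambda>g. f (act S g p)) (k \<otimes>\<^bsub>G\<^esub> inv\<^bsub>G\<^esub> k)"
          using smapD(4)[OF smap_orbit_one[OF p] f2] by (simp add: kk)
        show ?thesis using tangent_map_smooth[of Q f "\<lambda>g. act S g p" "\<one>\<^bsub>G\<^esub>" \<zeta>] f2
            tangent_map_smooth[of GA "\<lambda>g. f (act S g p)" "\<lambda>g. g \<otimes>\<^bsub>G\<^esub> inv\<^bsub>G\<^esub> k" k w] f3 by (simp add: \<zeta>_def)
      qed
      finally show ?thesis .
    qed (use tv_nonsmooth[OF vT] in \<open>simp add: tangent_map_def act_one[OF p]\<close>)
  qed
  then show ?thesis using c Vgen_lin_comb by metis
qed

text \<open>By equivariance, \<open>snd (\<psi> q)\<close> times the inverse of \<open>k\<close> is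
  a smooth function of \<open>q\<close> that inverts the orbit map of \<open>p\<close> from the
  left. The tangent map of the orbit map is thus injective, and a relation among the generators is
  one among the \<open>\<xi> i\<close>.\<close>

lemma Vgen_indep:
  assumes p: "p \<in> mcarrier Q" and 0: "lin_comb c (\<lambda>i. Vgen S \<xi> i p) = (\<lambda>f. 0)"
  shows "c i = 0"
proof (rule \<xi>_indep)
  obtain U \<psi> \<phi> where "local_triv U \<psi> \<phi> p" using trivialization[OF p] by blast
  note T = local_trivD[OF this]
  let ?BU = "restrict_atlas B U"
  let ?T = "prod_atlas ?BU GA"
  have BU: "smooth_atlas ?BU" by (rule restrict_atlas_smooth[OF B])
  define k where "k = snd (\<psi> p)"
  have k: "k \<in> mcarrier GA" "\<psi> p = (pr p, k)" using T(7)[OF p T(2)] by (auto simp: k_def)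
  have kG: "k \<in> carrier G" "inv\<^bsub>G\<^esub> k \<in> carrier G" using k(1) inv_carrier carrier_G by simp_all
  have y: "pr p \<in> mcarrier ?BU" using restrict_atlas_mcarrier[OF B T(1)] T(2) by simp
  have kk: "k \<otimes>\<^bsub>G\<^esub> inv\<^bsub>G\<^esub> k = \<one>\<^bsub>G\<^esub>" by (rule group.r_inv[OF group_G kG(1)])
  have s1: "smap Q GA (\<lambda>q. snd (\<psi> q)) p"
    using smap_comp[OF T(3)] smap_snd[OF BU GA y k(1)] k(2) by simp
  have sR: "smap GA GA (\<lambda>g. g \<otimes>\<^bsub>G\<^esub> inv\<^bsub>G\<^esub> k) (snd (\<psi> p))"
    unfolding k_def[symmetric] by (rule smap_right_mult[OF kG])
  have s2: "smap Q GA (\<lambda>q. snd (\<psi> q) \<otimes>\<^bsub>G\<^esub> inv\<^bsub>G\<^esub> k) p"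
    by (rule smap_comp[OF s1 sR])
  let ?\<zeta> = "lin_comb c \<xi>"
  have \<zeta>: "?\<zeta> \<in> tangent_space GA \<one>\<^bsub>G\<^esub>" unfolding tangent_space_one by blast
  show "?\<zeta> = (\<lambda>f. 0)"
  proof
    fix h
    show "?\<zeta> h = 0"
    proof (cases "smooth_at GA h \<one>\<^bsub>G\<^esub>")
      case h: True
      let ?f = "\<lambda>q. h (snd (\<psi> q) \<otimes>\<^bsub>G\<^esub> inv\<^bsub>G\<^esub> k)"
      have f: "smooth_at Q ?f p" using smapD(4)[OF s2] h kk by (simp add: k_def)
      then have f': "smooth_at Q ?f (act S \<one>\<^bsub>G\<^esub> p)" by (simp add: act_one p)
      have "?\<zeta> h = ?\<zeta> (\<lambda>g. ?f (act S g p))"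
      proof (rule tv_cong[OF GA \<zeta>])
        show "eventually (\<lambda>g. h g = ?f (act S g p)) (mnhds GA \<one>\<^bsub>G\<^esub>)"
          using eventually_mnhds_mcarrier[OF GA, of "\<one>\<^bsub>G\<^esub>"]
        proof eventually_elim
          fix g assume "g \<in> mcarrier GA"
          then have g: "g \<in> carrier G" by (simp add: carrier_G)
          have "(g \<otimes>\<^bsub>G\<^esub> k) \<otimes>\<^bsub>G\<^esub> inv\<^bsub>G\<^esub> k = g"
            using g kG group_G by (simp add: group.is_monoid monoid.m_assoc group.r_inv monoid.r_one)
          then show "h g = ?f (act S g p)" using T(9)[OF g p T(2)] by (simp add: k_def)
        qed
      qed
      also have "\<dots> = tangent_map Q (\<lambda>g. act S g p) \<one>\<^bsub>G\<^esub> ?\<zeta> ?f"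
        using tangent_map_smooth[of Q ?f "\<lambda>g. act S g p" "\<one>\<^bsub>G\<^esub>" ?\<zeta>] f' by simp
      also have "\<dots> = 0" using 0 by (simp add: Vgen_lin_comb)
      finally show ?thesis .
    qed (rule tv_nonsmooth[OF \<zeta>])
  qed
qed

end

section \<open>Horizontal lifts\<close>

lemma matrix_inv_sym:
  fixes M :: "real^'i^'i"
  assumes inv: "invertible M" and sym: "\<And>i j. M $ i $ j = M $ j $ i"
  shows "matrix_inv M $ i $ j = matrix_inv M $ j $ i"
proof -
  have M: "transpose M = M" using sym by (simp add: transpose_def vec_eq_iff)
  have "M ** transpose (matrix_inv M) = mat 1"
    using arg_cong[OF matrix_inv_matrix_mul[OF inv], of transpose]
    by (simp add: matrix_transpose_mul M)
  then have "matrix_inv M ** (M ** transpose (matrix_inv M)) = matrix_inv M" by simp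
  then have "transpose (matrix_inv M) = matrix_inv M"
    by (simp add: matrix_mul_assoc matrix_inv_matrix_mul[OF inv])
  then have "transpose (matrix_inv M) $ j $ i = matrix_inv M $ j $ i" by simp
  then show ?thesis by (simp add: transpose_def)
qed

context chaplygin
begin

section \<open>Existence, uniqueness and smoothness of horizontal lifts\<close>

lemma zero_vertical: "p \<in> mcarrier Q \<Longrightarrow> (\<lambda>f. 0) \<in> vertical_space S p"
  by (simp add: vertical_space_def tangent_space_zero[OF Q] tangent_map_def)

lemma hor_exists:
  assumes p: "p \<in> mcarrier Q" and u: "u \<in> tangent_space B (pr p)"
  shows "\<exists>d\<in>distr S p. Tpr p d = u"
proof -
  obtain v where v: "v \<in> tangent_space Q p" "Tpr p v = u" using Tpr_surj[OF p u] by blast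
  obtain dw where dw: "dw \<in> distr S p \<times> vertical_space S p" "v = (\<lambda>f. fst dw f + snd dw f)"
    using ex1_implies_ex[OF distr_split[OF p v(1)]] by blast
  have "Tpr p (snd dw) = (\<lambda>h. 0)" using dw(1) vertical_spaceD(2) by (simp add: mem_Times_iff)
  then have "Tpr p (fst dw) = u" using v(2) unfolding dw(2) tangent_map_add by simp
  then show ?thesis using dw(1) by (auto simp: mem_Times_iff)
qed

text \<open>The difference is vertical, so \<open>d\<close> splits both as \<open>d\<close> plus 0
  and as \<open>d'\<close> plus the difference; the splitting is unique.\<close>

lemma hor_unique:
  assumes p: "p \<in> mcarrier Q" and d: "d \<in> distr S p" "d' \<in> distr S p" and eq: "Tpr p d = Tpr p d'"
  shows "d = d'"
proof -
  have dT: "d \<in> tangent_space Q p" "d' \<in> tangent_space Q p" using d distr_tangent[OF p] by auto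
  have "(\<lambda>f. d f - d' f) \<in> vertical_space S p"
    unfolding vertical_space_def using tangent_space_diff[OF Q dT] by (simp add: tangent_map_diff eq)
  then have 1: "(d', \<lambda>f. d f - d' f) \<in> distr S p \<times> vertical_space S p \<and>
      d = (\<lambda>f. fst (d', \<lambda>f. d f - d' f) f + snd (d', \<lambda>f. d f - d' f) f)"
    using d by simp
  have 2: "(d, \<lambda>f. 0) \<in> distr S p \<times> vertical_space S p \<and>
      d = (\<lambda>f. fst (d, \<lambda>f. 0 :: real) f + snd (d, \<lambda>f. 0 :: real) f)"
    using d zero_vertical[OF p] by simp
  have "(d', \<lambda>f. d f - d' f) = (d, \<lambda>f. 0)"
    by (rule trans[OF sym[OF the1_equality[OF distr_split[OF p dT(1)] 1]] the1_equality[OF distr_split[OF p dT(1)] 2]])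
  then show ?thesis by simp
qed

lemma distr_frame:
  assumes p: "p \<in> mcarrier Q"
  shows "\<exists>W (Y :: 'm \<Rightarrow> 'q vfield). p \<in> W \<and>
     (\<forall>a. smooth_vfield_on Q W (Y a)) \<and> (\<forall>q\<in>W. is_basis (\<lambda>a. Y a q) (distr S q))"
  using smooth_D p unfolding smooth_distribution_def by (rule bspec)

text \<open>That \<open>distr S p\<close> is a linear space is not a clause of its own in
  \<open>chaplygin_system\<close>. It follows from the local frames, which present the space as the
  range of \<open>lin_comb\<close>.\<close>

lemma distr_sum:
  fixes E :: "'m \<Rightarrow> 'q tvec"
  assumes p: "p \<in> mcarrier Q" and E: "\<And>i. E i \<in> distr S p"
  shows "(\<lambda>f. \<Sum>i\<in>UNIV. k i * E i f) \<in> distr S p"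
proof -
  from distr_frame[OF p] obtain W and Y :: "'m \<Rightarrow> 'q vfield"
    where "p \<in> W" "\<forall>q\<in>W. is_basis (\<lambda>a. Y a q) (distr S q)" by (elim exE conjE)
  then have D: "distr S p = range (\<lambda>c. lin_comb c (\<lambda>a. Y a p))" unfolding is_basis_def by blast
  have "\<forall>i. \<exists>c. E i = lin_comb c (\<lambda>a. Y a p)" using E unfolding D by blast
  then obtain c where c: "\<And>i. E i = lin_comb (c i) (\<lambda>a. Y a p)" by metis
  have "(\<lambda>f. \<Sum>i\<in>UNIV. k i * E i f) = lin_comb (\<lambda>a. \<Sum>i\<in>UNIV. k i * c i a) (\<lambda>a. Y a p)"
  proof
    fix f
    have "(\<Sum>i\<in>UNIV. k i * E i f) = (\<Sum>i\<in>UNIV. \<Sum>a\<in>UNIV. k i * c i a * Y a p f)"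
      by (simp add: c lin_comb_def sum_distrib_left mult.assoc)
    also have "\<dots> = (\<Sum>a\<in>UNIV. \<Sum>i\<in>UNIV. k i * c i a * Y a p f)" by (rule sum.swap)
    finally show "(\<Sum>i\<in>UNIV. k i * E i f) = lin_comb (\<lambda>a. \<Sum>i\<in>UNIV. k i * c i a) (\<lambda>a. Y a p) f"
      by (simp add: lin_comb_def sum_distrib_right)
  qed
  then show ?thesis unfolding D by blast
qed

definition over :: "('q set, real^'m) chart \<Rightarrow> 'q set" where
  "over c = {p \<in> mcarrier Q. pr p \<in> fst c}"

lemma overD: "p \<in> over c \<Longrightarrow> p \<in> mcarrier Q" "p \<in> over c \<Longrightarrow> pr p \<in> fst c"
  by (simp_all add: over_def)

lemma openin_over: "c \<in> charts B \<Longrightarrow> openin (mtopology Q) (over c)"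
  unfolding over_def by (intro openin_pr_vimage openin_chart_domain[OF B])

lemma act_over: "g \<in> carrier G \<Longrightarrow> p \<in> over c \<Longrightarrow> act S g p \<in> over c"
  by (simp add: over_def act_carrier pr_act)

lemma over_E: assumes "c \<in> charts B" "y \<in> fst c" obtains p where "p \<in> over c" "pr p = y"
  using mcarrier_B_E[of y] chartsD(1)[OF assms(1)] assms(2) unfolding over_def by blast

lemma coord_pr_smooth: "c \<in> charts B \<Longrightarrow> p \<in> over c \<Longrightarrow> smooth_at Q (\<lambda>q. coord c a (pr q)) p"
  by (rule smapD(4)[OF smap_pr smooth_at_coord[OF B]]) (simp_all add: over_def)

context
  fixes c :: "('q set, real^'m) chart"
  assumes c: "c \<in> charts B"
begin

abbreviation "X \<equiv> Xhor S c"

lemma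
  assumes p: "p \<in> over c"
  shows Xhor_distr: "X a p \<in> distr S p" and Tpr_Xhor: "Tpr p (X a p) = coord_field B c a (pr p)"
proof -
  note pQ = overD(1)[OF p] and pc = overD(2)[OF p]
  have "\<exists>!v. v \<in> distr S p \<and> Tpr p v = coord_field B c a (pr p)"
    using hor_exists[OF pQ coord_field_tangent[OF B c pc]] hor_unique[OF pQ] by (metis (no_types, lifting))
  from theI'[OF this] show "X a p \<in> distr S p" "Tpr p (X a p) = coord_field B c a (pr p)"
    unfolding Xhor_def by blast+
qed

lemma Xhor_tangent: "p \<in> over c \<Longrightarrow> X a p \<in> tangent_space Q p"
  using Xhor_distr distr_tangent[OF overD(1)] by blast

lemma Xhor_pr:
  assumes p: "p \<in> over c" and h: "smooth_at B h (pr p)"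
  shows "X a p (\<lambda>q. h (pr q)) = coord_field B c a (pr p) h"
  using tangent_map_smooth[of B h pr p "X a p", OF h] Tpr_Xhor[OF p] by simp

lemma Xhor_coord: "p \<in> over c \<Longrightarrow> X a p (\<lambda>q. coord c b (pr q)) = (if a = b then 1 else 0)"
  using Xhor_pr[of p "coord c b"] smooth_at_coord[OF B c overD(2)] coord_field_coord[OF B c overD(2)] by simp

lemma vertical_coord:
  assumes p: "p \<in> over c" and v: "v \<in> vertical_space S p"
  shows "v (\<lambda>q. coord c b (pr q)) = 0"
  using tangent_map_smooth[of B "coord c b" pr p v, OF smooth_at_coord[OF B c overD(2)[OF p]]] vertical_spaceD(2)[OF v] by simp

text \<open>Both sides are horizontal and have the same projection, which is expanded in the
  coordinate fields of the base.\<close>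

lemma hor_expand:
  assumes p: "p \<in> over c" and d: "d \<in> distr S p"
  shows "d = (\<lambda>f. \<Sum>a\<in>UNIV. d (\<lambda>q. coord c a (pr q)) * X a p f)"
proof (rule hor_unique[OF overD(1)[OF p] d])
  show "(\<lambda>f. \<Sum>a\<in>UNIV. d (\<lambda>q. coord c a (pr q)) * X a p f) \<in> distr S p"
    by (rule distr_sum[OF overD(1)[OF p], where k="\<lambda>a. d (\<lambda>q. coord c a (pr q))"]) (rule Xhor_distr[OF p])
  have dT: "d \<in> tangent_space Q p" using d distr_tangent[OF overD(1)[OF p]] by blast
  have "Tpr p d = (\<lambda>f. \<Sum>a\<in>UNIV. Tpr p d (coord c a) * coord_field B c a (pr p) f)"
    by (rule tv_expand_vec[OF B c overD(2)[OF p] Tpr_tangent[OF dT]])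
  also have "\<dots> = (\<lambda>f. \<Sum>a\<in>UNIV. d (\<lambda>q. coord c a (pr q)) * Tpr p (X a p) f)"
    by (simp add: Tpr_Xhor[OF p] tangent_map_smooth[of B _ pr p, OF smooth_at_coord[OF B c overD(2)[OF p]]])
  also have "\<dots> = Tpr p (\<lambda>f. \<Sum>a\<in>UNIV. d (\<lambda>q. coord c a (pr q)) * X a p f)"
    by (rule tangent_map_sum[symmetric])
  finally show "Tpr p d = Tpr p (\<lambda>f. \<Sum>a\<in>UNIV. d (\<lambda>q. coord c a (pr q)) * X a p f)" .
qed

text \<open>\<open>Xhor\<close> is a pointwise definite description. To see that it is smooth, a
  smooth local frame \<open>Y\<close> of the distribution is expanded in the lifts. Its coefficient
  matrix \<open>M\<close> consists of derivatives of base coordinates, hence is smooth, and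
  inverting it expresses the lifts through \<open>Y\<close>.\<close>

lemma Xhor_vfield: "smooth_vfield_on Q (over c) (X b)"
  unfolding smooth_vfield_on_def
proof (intro conjI ballI allI impI openin_over[OF c] Xhor_tangent)
  fix p f assume p: "p \<in> over c" and f: "smooth_at Q f p"
  from distr_frame[OF overD(1)[OF p]] obtain W and Y :: "'m \<Rightarrow> 'q vfield"
    where W0: "p \<in> W" "\<forall>a. smooth_vfield_on Q W (Y a)" "\<forall>q\<in>W. is_basis (\<lambda>a. Y a q) (distr S q)"
    by (elim exE conjE)
  note W = W0(1) spec[OF W0(2)] bspec[OF W0(3)]
  let ?W = "W \<inter> over c"
  have oW: "openin (mtopology Q) ?W" using W(2) openin_over[OF c] by (auto simp: smooth_vfield_on_def)
  define M :: "'q \<Rightarrow> real^'m^'m" where "M q = (\<chi> a b. Y a q (\<lambda>q'. coord c b (pr q')))" for q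
  have YX: "Y a q f = (\<Sum>b\<in>UNIV. M q $ a $ b * X b q f)" if q: "q \<in> ?W" for a q f
  proof -
    have "Y a q = lin_comb (\<lambda>b. if b = a then 1 else 0) (\<lambda>a. Y a q)"
      by (auto simp: lin_comb_def if_distrib[of "\<lambda>x. x * _"] cong: if_cong)
    then have "Y a q \<in> distr S q" using W(3)[of q] q unfolding is_basis_def by blast
    then have "Y a q = (\<lambda>f. \<Sum>b\<in>UNIV. M q $ a $ b * X b q f)"
      using hor_expand[of q "Y a q"] q by (simp add: M_def)
    then show ?thesis by (rule fun_cong)
  qed
  \<comment> \<open>A vector in the kernel of the transpose of \<open>M q\<close> is a linear
    relation among the \<open>Y a q\<close>, which form a basis of \<open>distr S q\<close>.\<close>
  have inv: "invertible (M q)" if q: "q \<in> ?W" for q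
  proof -
    have "\<forall>x. transpose (M q) *v x = 0 \<longrightarrow> x = 0"
    proof (intro allI impI)
      fix x assume "transpose (M q) *v x = 0"
      then have 0: "(\<Sum>a\<in>UNIV. x $ a * M q $ a $ b) = 0" for b
        by (simp add: vec_eq_iff matrix_vector_mult_def transpose_def mult.commute)
      have "lin_comb (\<lambda>a. x $ a) (\<lambda>a. Y a q) f = 0" for f
      proof -
        have "lin_comb (\<lambda>a. x $ a) (\<lambda>a. Y a q) f = (\<Sum>a\<in>UNIV. \<Sum>b\<in>UNIV. x $ a * M q $ a $ b * X b q f)"
          by (simp add: lin_comb_def YX[OF q] sum_distrib_left mult.assoc)
        also have "\<dots> = (\<Sum>b\<in>UNIV. \<Sum>a\<in>UNIV. x $ a * M q $ a $ b * X b q f)" by (rule sum.swap)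
        also have "\<dots> = 0" by (simp add: sum_distrib_right[symmetric] 0)
        finally show ?thesis .
      qed
      then have "\<forall>a. x $ a = 0" using W(3)[of q] q unfolding is_basis_def by blast
      then show "x = 0" by (simp add: vec_eq_iff)
    qed
    then have "\<exists>N. N ** transpose (M q) = mat 1" by (simp add: matrix_left_invertible_ker)
    then have "invertible (transpose (M q))" by (simp add: invertible_left_inverse)
    then show ?thesis using transpose_invertible[of "transpose (M q)"] by (simp add: transpose_transpose)
  qed
  let ?N = "\<lambda>q. matrix_inv (M q)"
  have XY: "X b q f = (\<Sum>a\<in>UNIV. ?N q $ b $ a * Y a q f)" if q: "q \<in> ?W" for q f
  proof -
    have "(\<Sum>a\<in>UNIV. ?N q $ b $ a * Y a q f) = (\<Sum>a\<in>UNIV. \<Sum>d\<in>UNIV. ?N q $ b $ a * M q $ a $ d * X d q f)"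
      by (simp add: YX[OF q] sum_distrib_left mult.assoc)
    also have "\<dots> = (\<Sum>d\<in>UNIV. \<Sum>a\<in>UNIV. ?N q $ b $ a * M q $ a $ d * X d q f)" by (rule sum.swap)
    also have "\<dots> = (\<Sum>d\<in>UNIV. (?N q ** M q) $ b $ d * X d q f)"
      by (simp add: matrix_matrix_mult_def sum_distrib_right)
    also have "\<dots> = X b q f"
      by (simp add: matrix_inv_matrix_mul[OF inv[OF q]] mat_def if_distrib[of "\<lambda>x. x * _"] cong: if_cong)
    finally show ?thesis by simp
  qed
  have sM: "smooth_at Q (\<lambda>q. M q $ a $ b) q" if q: "q \<in> ?W" for a b q
    using smooth_vfield_onD(2)[OF W(2) _ coord_pr_smooth[OF c], of q] q by (simp add: M_def)
  have "smooth_vfield_on Q ?W (\<lambda>p f. \<Sum>a\<in>UNIV. ?N p $ b $ a * Y a p f)"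
  proof (rule smooth_vfield_on_sum[OF Q oW, where k="\<lambda>a p. ?N p $ b $ a"])
    fix a show "smooth_vfield_on Q ?W (Y a)" by (rule smooth_vfield_on_subset[OF W(2) oW]) simp
  next
    fix a q assume "q \<in> ?W"
    then show "smooth_at Q (\<lambda>q. ?N q $ b $ a) q" by (intro smooth_at_matrix_inv[OF Q] sM inv)
  qed
  from smooth_vfield_onD(2)[OF this, of p] f
  have 1: "smooth_at Q (\<lambda>q. \<Sum>a\<in>UNIV. ?N q $ b $ a * Y a q f) p" using W(1) p by simp
  have "eventually (\<lambda>q. X b q f = (\<Sum>a\<in>UNIV. ?N q $ b $ a * Y a q f)) (mnhds Q p)"
    using eventually_mnhds_openin[OF Q oW, of p] W(1) p
    by (auto elim!: eventually_mono intro: XY)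
  from smooth_at_cong[OF Q this] 1 show "smooth_at Q (\<lambda>q. X b q f) p" by (rule iffD2)
qed

lemma bracket_tangent: "p \<in> over c \<Longrightarrow> lie_bracket Q (X a) (X b) p \<in> tangent_space Q p"
  by (rule lie_bracket_tangent[OF Q Xhor_vfield Xhor_vfield])

lemma eventually_over: "p \<in> over c \<Longrightarrow> eventually (\<lambda>q. q \<in> over c) (mnhds Q p)"
  by (rule eventually_mnhds_openin[OF Q openin_over[OF c]])

text \<open>On pulled-back functions \<open>Xhor S c a\<close> acts as the coordinate field does on
  the base. So on these the bracket is the pull-back of a commutator of coordinate fields, which
  vanishes.\<close>

lemma bracket_vertical:
  assumes p: "p \<in> over c"
  shows "lie_bracket Q (X a) (X b) p \<in> vertical_space S p"
proof -
  have "Tpr p (lie_bracket Q (X a) (X b) p) h = 0" for h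
  proof (cases "smooth_at B h (pr p)")
    case h: True
    have hp: "smooth_at Q (\<lambda>q. h (pr q)) p" by (rule smapD(4)[OF smap_pr[OF overD(1)[OF p]] h])
    have ev: "eventually (\<lambda>q. X b q (\<lambda>q. h (pr q)) = coord_field B c b (pr q) h) (mnhds Q p)" for b
      using eventually_over[OF p] smap_eventually[OF smap_pr[OF overD(1)[OF p]] smooth_at_eventually[OF B h]]
      by eventually_elim (rule Xhor_pr)
    have "X a p (\<lambda>q. X b q (\<lambda>q. h (pr q))) = coord_field B c a (pr p) (\<lambda>y. coord_field B c b y h)" for a b
      unfolding tv_cong[OF Q Xhor_tangent[OF p] ev]
      by (rule Xhor_pr[OF p coord_field_smooth[OF B c overD(2)[OF p] h]])
    then show ?thesis
      using coord_field_commute[OF B c overD(2)[OF p] h, of a b]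
      by (simp add: tangent_map_smooth[of B h pr p, OF h] lie_bracket_smooth[OF hp])
  qed (simp add: tangent_map_def)
  then show ?thesis using bracket_tangent[OF p] unfolding vertical_space_def by blast
qed

text \<open>Invariance of the distribution makes the translated vector horizontal, and translating
  along the orbit leaves the projection unchanged; \<open>hor_unique\<close> then identifies it with
  the lift.\<close>

lemma Xhor_equivariant:
  assumes g: "g \<in> carrier G" and p: "p \<in> over c"
  shows "tangent_map Q (act S g) p (X a p) = X a (act S g p)"
proof (rule hor_unique[OF act_carrier[OF g overD(1)[OF p]]])
  show "tangent_map Q (act S g) p (X a p) \<in> distr S (act S g p)"
    using distr_invariant[OF g overD(1)[OF p]] Xhor_distr[OF p] by blast
  show "X a (act S g p) \<in> distr S (act S g p)" by (rule Xhor_distr[OF act_over[OF g p]])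
  have "Tpr (act S g p) (tangent_map Q (act S g) p (X a p)) = tangent_map B (\<lambda>q. pr (act S g q)) p (X a p)"
    by (rule tangent_map_comp[symmetric, where F="act S g" and G=pr and p=p, OF smap_pr[OF act_carrier[OF g overD(1)[OF p]]]])
  also have "\<dots> = Tpr p (X a p)"
    by (rule tangent_map_cong[OF Q Xhor_tangent[OF p]])
      (use eventually_over[OF p] in eventually_elim, simp add: pr_act[OF overD(1) g])
  also have "\<dots> = Tpr (act S g p) (X a (act S g p))"
    by (simp add: Tpr_Xhor[OF p] Tpr_Xhor[OF act_over[OF g p]] pr_act[OF overD(1)[OF p] g])
  finally show "Tpr (act S g p) (tangent_map Q (act S g) p (X a p)) = Tpr (act S g p) (X a (act S g p))" .
qed

text \<open>Naturality of the bracket: by equivariance of the lifts, X(f o g) = (X f) o g near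
  \<open>p\<close>. Using this for the inner field as an identity of germs, then for the outer one
  at \<open>p\<close>, treats both terms of the commutator.\<close>

lemma bracket_equivariant:
  assumes g: "g \<in> carrier G" and p: "p \<in> over c"
  shows "tangent_map Q (act S g) p (lie_bracket Q (X a) (X b) p) = lie_bracket Q (X a) (X b) (act S g p)"
proof
  fix f
  show "tangent_map Q (act S g) p (lie_bracket Q (X a) (X b) p) f = lie_bracket Q (X a) (X b) (act S g p) f"
  proof (cases "smooth_at Q f (act S g p)")
    case f: True
    note sg = smap_act[OF g overD(1)[OF p]]
    have fg: "smooth_at Q (\<lambda>q. f (act S g q)) p" by (rule smapD(4)[OF sg f])
    have ev: "eventually (\<lambda>q. X b q (\<lambda>q. f (act S g q)) = X b (act S g q) f) (mnhds Q p)" for b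
      using eventually_over[OF p] smap_eventually[OF sg smooth_at_eventually[OF Q f]]
    proof eventually_elim
      fix q assume q: "q \<in> over c" and fq: "smooth_at Q f (act S g q)"
      show "X b q (\<lambda>q. f (act S g q)) = X b (act S g q) f"
        using tangent_map_smooth[of Q f "act S g" q "X b q", OF fq] Xhor_equivariant[OF g q] by simp
    qed
    have "X a p (\<lambda>q. X b q (\<lambda>q. f (act S g q))) = X a (act S g p) (\<lambda>q. X b q f)" for a b
    proof -
      have "smooth_at Q (\<lambda>q. X b q f) (act S g p)"
        by (rule smooth_vfield_onD(2)[OF Xhor_vfield act_over[OF g p] f])
      from tangent_map_smooth[of Q "\<lambda>q. X b q f" "act S g" p "X a p", OF this]
      show ?thesis unfolding tv_cong[OF Q Xhor_tangent[OF p] ev] using Xhor_equivariant[OF g p] by simp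
    qed
    then show ?thesis
      by (simp add: tangent_map_smooth[of Q f "act S g" p, OF f] lie_bracket_smooth[OF fg] lie_bracket_smooth[OF f])
  qed (simp add: tangent_map_def lie_bracket_def)
qed

end

section \<open>The metric as a bilinear form\<close>

lemma metric_properties:
  assumes "p \<in> mcarrier Q" "u \<in> tangent_space Q p" "v \<in> tangent_space Q p" "w \<in> tangent_space Q p"
  shows metric_sym: "metric S p u w = metric S p w u"
    and metric_lin: "metric S p (\<lambda>f. r * u f + v f) w = r * metric S p u w + metric S p v w"
    and metric_pos: "u \<noteq> (\<lambda>f. 0) \<Longrightarrow> 0 < metric S p u u"
  using riem assms unfolding riemannian_metric_def by blast+

lemma metric_zero:
  assumes "p \<in> mcarrier Q" "w \<in> tangent_space Q p" shows "metric S p (\<lambda>f. 0) w = 0"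
  using metric_lin[OF assms(1) tangent_space_zero[OF Q assms(1)] tangent_space_zero[OF Q assms(1)] assms(2), of 1] by simp

lemma metric_sum_left:
  assumes p: "p \<in> mcarrier Q" and w: "w \<in> tangent_space Q p" and E: "\<And>i. i \<in> I \<Longrightarrow> E i \<in> tangent_space Q p"
  shows "metric S p (\<lambda>f. \<Sum>i\<in>I. k i * E i f) w = (\<Sum>i\<in>I. k i * metric S p (E i) w)"
  using E
proof (induction I rule: infinite_finite_induct)
  case (insert i I)
  then show ?case
    using metric_lin[OF p, of "E i" "\<lambda>f. \<Sum>i\<in>I. k i * E i f" w "k i"] tangent_space_sum[OF Q p, of I E k] w by simp
qed (simp_all add: metric_zero[OF p w])

lemma metric_sum_right:
  assumes p: "p \<in> mcarrier Q" and w: "w \<in> tangent_space Q p" and E: "\<And>i. i \<in> I \<Longrightarrow> E i \<in> tangent_space Q p"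
  shows "metric S p w (\<lambda>f. \<Sum>i\<in>I. k i * E i f) = (\<Sum>i\<in>I. k i * metric S p w (E i))"
proof -
  have "metric S p w (\<lambda>f. \<Sum>i\<in>I. k i * E i f) = metric S p (\<lambda>f. \<Sum>i\<in>I. k i * E i f) w"
    by (rule metric_sym[OF p w w tangent_space_sum[OF Q p E]])
  also have "\<dots> = (\<Sum>i\<in>I. k i * metric S p w (E i))"
  proof -
    have "metric S p (\<lambda>f. \<Sum>i\<in>I. k i * E i f) w = (\<Sum>i\<in>I. k i * metric S p (E i) w)"
      by (rule metric_sum_left[OF p w E])
    also have "\<dots> = (\<Sum>i\<in>I. k i * metric S p w (E i))"
      by (intro sum.cong refl arg_cong2[where f="(*)"] metric_sym[OF p _ w w] E)
    finally show ?thesis .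
  qed
  finally show ?thesis .
qed

lemma metric_smooth:
  assumes "smooth_vfield_on Q W Y" "smooth_vfield_on Q W Z" "p \<in> W"
  shows "smooth_at Q (\<lambda>q. metric S q (Y q) (Z q)) p"
  using riem assms unfolding riemannian_metric_def by blast

end

section \<open>The curvature and its descent to the base\<close>

context chaplygin
begin

text \<open>The \<open>E\<close> of the overview: the curvature of the connection with its value
  paired with a lift by the metric. Unlike the frame coefficients it does not refer to the Lie
  algebra basis.\<close>

definition curv :: "('q set, real^'m) chart \<Rightarrow> 'm \<Rightarrow> 'm \<Rightarrow> 'm \<Rightarrow> 'q \<Rightarrow> real" where
  "curv c a b d p = metric S p (Xhor S c a p) (lie_bracket Q (Xhor S c b) (Xhor S c d) p)"

lemma Gmat_nth: "Gmat S c p $ a $ b = metric S p (Xhor S c a p) (Xhor S c b p)"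
  by (simp add: Gmat_def)

lemma descend_eq:
  assumes p: "p \<in> mcarrier Q" and inv: "\<And>g. g \<in> carrier G \<Longrightarrow> h (act S g p) = h p"
  shows "descend h (pr p) = h p"
  unfolding descend_def
proof (rule the_equality)
  show "\<forall>q\<in>pr p. h q = h p" using pr_memD[OF p] inv by blast
  fix r assume "\<forall>q\<in>pr p. h q = r"
  from bspec[OF this pr_mem[OF p]] show "r = h p" by simp
qed

context
  fixes c :: "('q set, real^'m) chart"
  assumes c: "c \<in> charts B"
begin

lemma Gmat_sym: assumes p: "p \<in> over c" shows "Gmat S c p $ a $ b = Gmat S c p $ b $ a"
  unfolding Gmat_nth by (rule metric_sym[OF overD(1)[OF p]]) (rule Xhor_tangent[OF c p])+

text \<open>A kernel vector gives a combination of the lifts orthogonal to every lift, hence to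
  itself, and therefore zero. Applying it to the base coordinates recovers the entries of the kernel
  vector.\<close>

lemma Gmat_invertible: assumes p: "p \<in> over c" shows "invertible (Gmat S c p)"
proof -
  note pQ = overD(1)[OF p]
  have "\<forall>x. Gmat S c p *v x = 0 \<longrightarrow> x = 0"
  proof (intro allI impI)
    fix x assume "Gmat S c p *v x = 0"
    then have 0: "(\<Sum>b\<in>UNIV. x $ b * Gmat S c p $ a $ b) = 0" for a
      by (simp add: vec_eq_iff matrix_vector_mult_def mult.commute)
    define u where "u = (\<lambda>f. \<Sum>b\<in>UNIV. x $ b * Xhor S c b p f)"
    have uT: "u \<in> tangent_space Q p"
      unfolding u_def by (rule tangent_space_sum[OF Q pQ, where k="\<lambda>b. x $ b"]) (rule Xhor_tangent[OF c p])
    have "metric S p (Xhor S c a p) u = (\<Sum>b\<in>UNIV. x $ b * metric S p (Xhor S c a p) (Xhor S c b p))" for a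
      unfolding u_def by (rule metric_sum_right[OF pQ Xhor_tangent[OF c p] Xhor_tangent[OF c p]])
    then have "metric S p (Xhor S c a p) u = 0" for a
      by (simp add: Gmat_nth[symmetric] 0)
    then have "metric S p u u = 0"
      by (subst (1) u_def) (simp add: metric_sum_left[OF pQ uT Xhor_tangent[OF c p]])
    then have "u = (\<lambda>f. 0)" using metric_pos[OF pQ uT uT uT] by force
    then have "(\<Sum>b\<in>UNIV. x $ b * Xhor S c b p (\<lambda>q. coord c a (pr q))) = 0" for a
      using fun_cong[of u "\<lambda>f. 0" "\<lambda>q. coord c a (pr q)"] unfolding u_def by simp
    then show "x = 0" by (simp add: vec_eq_iff Xhor_coord[OF c p] if_distrib cong: if_cong)
  qed
  then show ?thesis by (simp add: matrix_left_invertible_ker[symmetric] invertible_left_inverse)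
qed

lemma Gmat_invariant:
  assumes g: "g \<in> carrier G" and p: "p \<in> over c"
  shows "Gmat S c (act S g p) = Gmat S c p"
  using metric_invariant[OF g overD(1)[OF p] Xhor_tangent[OF c p] Xhor_tangent[OF c p]]
  by (simp add: vec_eq_iff Gmat_nth Xhor_equivariant[OF c g p])

lemma curv_invariant:
  assumes g: "g \<in> carrier G" and p: "p \<in> over c"
  shows "curv c a b d (act S g p) = curv c a b d p"
  using metric_invariant[OF g overD(1)[OF p] Xhor_tangent[OF c p] bracket_tangent[OF c p]]
  by (simp add: curv_def Xhor_equivariant[OF c g p] bracket_equivariant[OF c g p])

lemma Gmat_smooth: "p \<in> over c \<Longrightarrow> smooth_at Q (\<lambda>q. Gmat S c q $ a $ b) p"
  unfolding Gmat_nth by (rule metric_smooth[OF Xhor_vfield[OF c] Xhor_vfield[OF c]])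

lemma curv_smooth: "p \<in> over c \<Longrightarrow> smooth_at Q (curv c a b d) p"
  unfolding curv_def[abs_def]
  by (rule metric_smooth[OF Xhor_vfield[OF c] lie_bracket_vfield[OF Q Xhor_vfield[OF c] Xhor_vfield[OF c]]])

lemma curv_antisym:
  assumes p: "p \<in> over c" shows "curv c a d b p = - curv c a b d p"
proof -
  note pQ = overD(1)[OF p]
  \<comment> \<open>A sum over the one-element set \<open>{()}\<close> brings the sign change into
    the form to which \<open>metric_sum_right\<close> applies.\<close>
  have br: "lie_bracket Q (Xhor S c d) (Xhor S c b) p = (\<lambda>f. \<Sum>i\<in>{()}. - 1 * lie_bracket Q (Xhor S c b) (Xhor S c d) p f)"
    by (rule ext) (simp add: lie_bracket_def)
  have "curv c a d b p = (\<Sum>i\<in>{()}. - 1 * curv c a b d p)"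
    unfolding curv_def br by (rule metric_sum_right[OF pQ Xhor_tangent[OF c p] bracket_tangent[OF c p]])
  then show ?thesis by simp
qed

text \<open>Substituting V_k = X_k - K^d_k X_d into r^k V_k gives these coefficients. They have to
  be shown unique because \<open>frame_coeffs\<close> is a definite description.\<close>

lemma frame_coeffs_vertical:
  assumes p: "p \<in> over c" and v: "lin_comb r (\<lambda>k. Vgen S \<xi> k p) = v"
  shows "frame_coeffs S \<xi> c p v = (\<lambda>d. - (\<Sum>k\<in>UNIV. r k * Kcoeff S \<xi> c d k p), r)"
proof -
  note pQ = overD(1)[OF p]
  let ?X = "\<lambda>d. Xhor S c d p" and ?V = "\<lambda>k. Vgen S \<xi> k p" and ?K = "\<lambda>d k. Kcoeff S \<xi> c d k p"
  have expand: "(\<Sum>d\<in>UNIV. s d * ?X d f) + (\<Sum>k\<in>UNIV. t k * Xorth S \<xi> c k p f) =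
     (\<Sum>d\<in>UNIV. (s d + (\<Sum>k\<in>UNIV. t k * ?K d k)) * ?X d f) + (\<Sum>k\<in>UNIV. t k * ?V k f)" for s t f
  proof -
    have "(\<Sum>k\<in>UNIV. t k * Xorth S \<xi> c k p f) =
      (\<Sum>k\<in>UNIV. t k * ?V k f) + (\<Sum>k\<in>UNIV. \<Sum>d\<in>UNIV. t k * ?K d k * ?X d f)"
      by (simp add: Xorth_def distrib_left sum.distrib sum_distrib_left mult.assoc)
    also have "(\<Sum>k\<in>UNIV. \<Sum>d\<in>UNIV. t k * ?K d k * ?X d f) = (\<Sum>d\<in>UNIV. \<Sum>k\<in>UNIV. t k * ?K d k * ?X d f)"
      by (rule sum.swap)
    finally show ?thesis by (simp add: distrib_right sum.distrib sum_distrib_right)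
  qed
  have vV: "v = (\<lambda>f. \<Sum>k\<in>UNIV. r k * ?V k f)" using v by (simp add: lin_comb_def)
  show ?thesis
    unfolding frame_coeffs_def expand
  proof (rule the_equality)
    show "v = (\<lambda>f. (\<Sum>d\<in>UNIV. (fst (\<lambda>d. - (\<Sum>k\<in>UNIV. r k * ?K d k), r) d +
        (\<Sum>k\<in>UNIV. snd (\<lambda>d. - (\<Sum>k\<in>UNIV. r k * ?K d k), r) k * ?K d k)) * ?X d f) +
        (\<Sum>k\<in>UNIV. snd (\<lambda>d. - (\<Sum>k\<in>UNIV. r k * ?K d k), r) k * ?V k f))"
      by (simp add: vV)
  next
    fix rs :: "('m \<Rightarrow> real) \<times> ('k \<Rightarrow> real)"
    assume eq: "v = (\<lambda>f. (\<Sum>d\<in>UNIV. (fst rs d + (\<Sum>k\<in>UNIV. snd rs k * ?K d k)) * ?X d f) +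
        (\<Sum>k\<in>UNIV. snd rs k * ?V k f))"
    \<comment> \<open>Applying the identity to a base coordinate kills all the generators and
      singles out one lift, so the total coefficient of each lift is zero. What is left is a
      relation among the generators.\<close>
    have 0: "fst rs d + (\<Sum>k\<in>UNIV. snd rs k * ?K d k) = 0" for d
    proof -
      have V0: "?V k (\<lambda>q. coord c d (pr q)) = 0" for k
        by (rule vertical_coord[OF c p Vgen_vertical[OF pQ]])
      have "v (\<lambda>q. coord c d (pr q)) = 0" unfolding vV by (simp add: V0)
      then have "(\<Sum>e\<in>UNIV. (fst rs e + (\<Sum>k\<in>UNIV. snd rs k * ?K e k)) * ?X e (\<lambda>q. coord c d (pr q))) = 0"
        using fun_cong[OF eq, of "\<lambda>q. coord c d (pr q)"] by (simp add: V0)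
      then show ?thesis by (simp add: Xhor_coord[OF c p] if_distrib[of "\<lambda>x. _ * x"] cong: if_cong)
    qed
    have "lin_comb (\<lambda>k. snd rs k - r k) ?V f = 0" for f
      using fun_cong[OF eq, of f] fun_cong[OF vV, of f] by (simp add: 0 lin_comb_def left_diff_distrib sum_subtractf)
    then have "snd rs k - r k = 0" for k by (intro Vgen_indep[OF pQ]) blast
    then have "snd rs = r" by auto
    moreover have "fst rs = (\<lambda>d. - (\<Sum>k\<in>UNIV. snd rs k * ?K d k))"
      using 0 by (auto simp: eq_neg_iff_add_eq_0)
    ultimately show "rs = (\<lambda>d. - (\<Sum>k\<in>UNIV. r k * ?K d k), r)" by (simp add: prod_eq_iff)
  qed
qed

lemma
  assumes p: "p \<in> over c"
  shows GR_curv: "(\<Sum>k\<in>UNIV. Gmix S \<xi> c a k p * Rorth S \<xi> c k b d p) = curv c a b d p"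
    and Rhor_curv: "Rhor S \<xi> c a b d p = (\<Sum>e\<in>UNIV. matrix_inv (Gmat S c p) $ e $ a * curv c e b d p)"
proof -
  note pQ = overD(1)[OF p]
  obtain r where r: "lie_bracket Q (Xhor S c b) (Xhor S c d) p = lin_comb r (\<lambda>k. Vgen S \<xi> k p)"
    using Vgen_span[OF bracket_vertical[OF c p]] by blast
  note fc = frame_coeffs_vertical[OF p r[symmetric]]
  have cv: "curv c a b d p = (\<Sum>k\<in>UNIV. r k * Gmix S \<xi> c a k p)" for a
    unfolding curv_def r lin_comb_def Gmix_def
    by (rule metric_sum_right[OF pQ Xhor_tangent[OF c p] Vgen_tangent[OF pQ]])
  show "(\<Sum>k\<in>UNIV. Gmix S \<xi> c a k p * Rorth S \<xi> c k b d p) = curv c a b d p"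
    by (simp add: Rorth_def fc cv mult.commute)
  \<comment> \<open>The minus sign in the horizontal coefficients of a vertical vector cancels the
    one in \<open>Kcoeff\<close>.\<close>
  have "Rhor S \<xi> c a b d p = (\<Sum>k\<in>UNIV. \<Sum>e\<in>UNIV. matrix_inv (Gmat S c p) $ e $ a * (r k * Gmix S \<xi> c e k p))"
    by (simp add: Rhor_def fc Kcoeff_def sum_negf sum_distrib_left mult_ac)
  also have "\<dots> = (\<Sum>e\<in>UNIV. \<Sum>k\<in>UNIV. matrix_inv (Gmat S c p) $ e $ a * (r k * Gmix S \<xi> c e k p))"
    by (rule sum.swap)
  finally show "Rhor S \<xi> c a b d p = (\<Sum>e\<in>UNIV. matrix_inv (Gmat S c p) $ e $ a * curv c e b d p)"
    by (simp add: cv sum_distrib_left)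
qed

lemma
  assumes p: "p \<in> over c"
  shows g_base_pr: "g_base S c a b (pr p) = Gmat S c p $ a $ b"
    and GR_base_pr: "GR_base S \<xi> c a b d (pr p) = curv c a b d p"
    and R_base_pr: "R_base S \<xi> c a b d (pr p) = (\<Sum>e\<in>UNIV. matrix_inv (Gmat S c p) $ e $ a * curv c e b d p)"
proof -
  note pQ = overD(1)[OF p]
  show "g_base S c a b (pr p) = Gmat S c p $ a $ b"
    unfolding g_base_def by (rule descend_eq[OF pQ]) (simp add: Gmat_invariant p)
  have "GR_base S \<xi> c a b d (pr p) = (\<Sum>k\<in>UNIV. Gmix S \<xi> c a k p * Rorth S \<xi> c k b d p)"
    unfolding GR_base_def by (rule descend_eq[OF pQ]) (simp add: GR_curv act_over curv_invariant p)
  then show "GR_base S \<xi> c a b d (pr p) = curv c a b d p" by (simp add: GR_curv p)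
  have "R_base S \<xi> c a b d (pr p) = Rhor S \<xi> c a b d p"
    unfolding R_base_def by (rule descend_eq[OF pQ]) (simp add: Rhor_curv act_over curv_invariant Gmat_invariant p)
  then show "R_base S \<xi> c a b d (pr p) = (\<Sum>e\<in>UNIV. matrix_inv (Gmat S c p) $ e $ a * curv c e b d p)"
    by (simp add: Rhor_curv p)
qed

text \<open>Near \<open>y\<close> the function \<open>F\<close> is the composition of
  \<open>h\<close> with a smooth local section, so smoothness on the total space passes to the
  base.\<close>

lemma descend_smooth:
  assumes h: "\<And>p. p \<in> over c \<Longrightarrow> smooth_at Q h p" and F: "\<And>p. p \<in> over c \<Longrightarrow> F (pr p) = h p" and y: "y \<in> fst c"
  shows "smooth_at B F y"
proof -
  obtain p where p: "p \<in> over c" "pr p = y" using over_E[OF c y] .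
  obtain \<sigma> where s: "smap B Q \<sigma> (pr p)" "\<sigma> (pr p) = p" "eventually (\<lambda>y. pr (\<sigma> y) = y) (mnhds B (pr p))"
    using local_section[OF overD(1)[OF p(1)]] .
  have "eventually (\<lambda>y. \<sigma> y \<in> over c) (mnhds B (pr p))"
    using smap_eventually[OF s(1)] eventually_over[OF c p(1)] s(2) by simp
  then have ev: "eventually (\<lambda>y. F y = h (\<sigma> y)) (mnhds B y)"
    using s(3) unfolding p(2) by eventually_elim (metis F)
  have "smooth_at B (\<lambda>y. h (\<sigma> y)) y"
    using smapD(4)[OF s(1), of h] h[OF p(1)] s(2) p(2) by simp
  then show ?thesis by (rule iffD2[OF smooth_at_cong[OF B ev]])
qed

lemma R_base_smooth: "y \<in> fst c \<Longrightarrow> smooth_at B (R_base S \<xi> c a b d) y"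
proof (rule descend_smooth[where F="R_base S \<xi> c a b d", OF _ R_base_pr])
  fix p assume p: "p \<in> over c"
  show "smooth_at Q (\<lambda>p. \<Sum>e\<in>UNIV. matrix_inv (Gmat S c p) $ e $ a * curv c e b d p) p"
    by (intro smooth_at_sum[OF Q overD(1)[OF p]] smooth_at_mult[OF Q] smooth_at_matrix_inv[OF Q]
        Gmat_smooth[OF p] Gmat_invertible[OF p] curv_smooth[OF p])
qed

end

section \<open>Change of coordinates on the base\<close>

lemma Xhor_chart_change:
  assumes c: "c \<in> charts B" and c0: "c0 \<in> charts B" and p: "p \<in> over c" "p \<in> over c0"
  shows "Xhor S c a p = (\<lambda>f. \<Sum>d\<in>UNIV. coord_field B c a (pr p) (coord c0 d) * Xhor S c0 d p f)"
  by (subst hor_expand[OF c0 p(2) Xhor_distr[OF c p(1)]])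
    (simp add: Xhor_pr[OF c p(1) smooth_at_coord[OF B c0 overD(2)[OF p(2)]]])

lemma bracket_chart_change:
  assumes c: "c \<in> charts B" and c0: "c0 \<in> charts B" and p: "p \<in> over c" "p \<in> over c0"
  defines "J \<equiv> \<lambda>a d y. coord_field B c a y (coord c0 d)"
  shows "lie_bracket Q (Xhor S c a) (Xhor S c b) p =
    (\<lambda>f. \<Sum>i\<in>UNIV. \<Sum>j\<in>UNIV. J a i (pr p) * J b j (pr p) * lie_bracket Q (Xhor S c0 i) (Xhor S c0 j) p f)"
proof
  fix f
  let ?W = "over c \<inter> over c0"
  let ?r = "\<lambda>i. Xhor S c a p (\<lambda>q. J b i (pr q)) - Xhor S c b p (\<lambda>q. J a i (pr q))"
  have oW: "openin (mtopology Q) ?W" by (intro openin_Int openin_over c c0)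
  have sJ: "smooth_at Q (\<lambda>q. J a i (pr q)) q" if "q \<in> ?W" for a i q
    unfolding J_def using that
    by (intro smapD(4)[OF smap_pr] coord_field_smooth[OF B c] smooth_at_coord[OF B c0]) (auto simp: over_def)
  have main: "lie_bracket Q (Xhor S c a) (Xhor S c b) p f =
    (\<Sum>i\<in>UNIV. \<Sum>j\<in>UNIV. J a i (pr p) * J b j (pr p) * lie_bracket Q (Xhor S c0 i) (Xhor S c0 j) p f) +
    (\<Sum>i\<in>UNIV. ?r i * Xhor S c0 i p f)" if f: "smooth_at Q f p" for f
  proof (rule lie_bracket_sum[OF Q oW _ f, where k="\<lambda>i q. J a i (pr q)" and l="\<lambda>i q. J b i (pr q)"])
    show "p \<in> ?W" using p by simp
    show "smooth_vfield_on Q ?W (Xhor S c0 i)" for i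
      by (rule smooth_vfield_on_subset[OF Xhor_vfield[OF c0] oW]) simp
    show "Xhor S c a q f = (\<Sum>i\<in>UNIV. J a i (pr q) * Xhor S c0 i q f)" if "q \<in> ?W" for q f
      unfolding J_def using that by (intro fun_cong[OF Xhor_chart_change[OF c c0]]) auto
    show "Xhor S c b q f = (\<Sum>i\<in>UNIV. J b i (pr q) * Xhor S c0 i q f)" if "q \<in> ?W" for q f
      unfolding J_def using that by (intro fun_cong[OF Xhor_chart_change[OF c c0]]) auto
  qed (simp_all add: sJ)
  \<comment> \<open>Evaluated on the i-th coordinate of \<open>c0\<close>, all brackets in
    \<open>main\<close> give 0 because they are vertical, and the horizontal remainder gives exactly
    \<open>?r i\<close>.\<close>
  have "?r i = 0" for i
  proof -
    have 0: "lie_bracket Q (Xhor S c1 a) (Xhor S c1 b) p (\<lambda>q. coord c0 i (pr q)) = 0"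
      if "c1 \<in> charts B" "p \<in> over c1" for c1 a b
      by (rule vertical_coord[OF c0 p(2) bracket_vertical[OF that]])
    show ?thesis
      using main[OF coord_pr_smooth[OF c0 p(2), of i]]
      by (simp add: 0[OF c p(1)] 0[OF c0 p(2)] Xhor_coord[OF c0 p(2)] if_distrib[of "\<lambda>x. _ * x"] cong: if_cong)
  qed
  then show "lie_bracket Q (Xhor S c a) (Xhor S c b) p f =
    (\<Sum>i\<in>UNIV. \<Sum>j\<in>UNIV. J a i (pr p) * J b j (pr p) * lie_bracket Q (Xhor S c0 i) (Xhor S c0 j) p f)"
    using main[of f] by (cases "smooth_at Q f p") (simp_all add: lie_bracket_def)
qed

lemma
  assumes c: "c \<in> charts B" and c0: "c0 \<in> charts B" and p: "p \<in> over c" "p \<in> over c0"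
  defines "J \<equiv> \<lambda>a d. coord_field B c a (pr p) (coord c0 d)"
  shows curv_chart_change: "curv c a b d p = (\<Sum>e\<in>UNIV. \<Sum>i\<in>UNIV. \<Sum>j\<in>UNIV. J a e * J b i * J d j * curv c0 e i j p)"
    and Gmat_chart_change: "Gmat S c p $ a $ b = (\<Sum>e\<in>UNIV. \<Sum>i\<in>UNIV. J a e * J b i * Gmat S c0 p $ e $ i)"
proof -
  note pQ = overD(1)[OF p(1)]
  note XT = Xhor_tangent[OF c0 p(2)] and BT = bracket_tangent[OF c0 p(2)]
  have BT': "(\<lambda>f. \<Sum>j\<in>UNIV. J b i * J d j * lie_bracket Q (Xhor S c0 i) (Xhor S c0 j) p f) \<in> tangent_space Q p" for b d i
    by (rule tangent_space_sum[OF Q pQ BT])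
  have left: "metric S p (Xhor S c a p) w = (\<Sum>e\<in>UNIV. J a e * metric S p (Xhor S c0 e p) w)" if "w \<in> tangent_space Q p" for a w
    unfolding Xhor_chart_change[OF c c0 p] J_def by (rule metric_sum_left[OF pQ that XT])
  have outer: "curv c a b d p = (\<Sum>e\<in>UNIV. J a e * metric S p (Xhor S c0 e p) (lie_bracket Q (Xhor S c b) (Xhor S c d) p))"
    unfolding curv_def by (rule left[OF bracket_tangent[OF c p(1)]])
  have inner: "metric S p (Xhor S c0 e p) (lie_bracket Q (Xhor S c b) (Xhor S c d) p) =
     (\<Sum>i\<in>UNIV. \<Sum>j\<in>UNIV. J b i * J d j * curv c0 e i j p)" for e
  proof -
    \<comment> \<open>The coefficient 1 lets \<open>metric_sum_right\<close> act on the outer sum;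
      it is applied once more to the inner one.\<close>
    have br: "lie_bracket Q (Xhor S c b) (Xhor S c d) p =
       (\<lambda>f. \<Sum>i\<in>UNIV. 1 * (\<Sum>j\<in>UNIV. J b i * J d j * lie_bracket Q (Xhor S c0 i) (Xhor S c0 j) p f))"
      unfolding bracket_chart_change[OF c c0 p] J_def by simp
    have "metric S p (Xhor S c0 e p) (lie_bracket Q (Xhor S c b) (Xhor S c d) p) =
        (\<Sum>i\<in>UNIV. 1 * metric S p (Xhor S c0 e p) (\<lambda>f. \<Sum>j\<in>UNIV. J b i * J d j * lie_bracket Q (Xhor S c0 i) (Xhor S c0 j) p f))"
      unfolding br by (rule metric_sum_right[OF pQ XT BT'])
    also have "\<dots> = (\<Sum>i\<in>UNIV. \<Sum>j\<in>UNIV. J b i * J d j * curv c0 e i j p)"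
      by (simp add: metric_sum_right[OF pQ XT BT] curv_def)
    finally show ?thesis .
  qed
  show "curv c a b d p = (\<Sum>e\<in>UNIV. \<Sum>i\<in>UNIV. \<Sum>j\<in>UNIV. J a e * J b i * J d j * curv c0 e i j p)"
    unfolding outer inner by (simp add: sum_distrib_left mult.assoc)
  have "metric S p (Xhor S c0 e p) (Xhor S c b p) = (\<Sum>i\<in>UNIV. J b i * Gmat S c0 p $ e $ i)" for e
    unfolding Xhor_chart_change[OF c c0 p] J_def Gmat_nth by (rule metric_sum_right[OF pQ XT XT])
  then show "Gmat S c p $ a $ b = (\<Sum>e\<in>UNIV. \<Sum>i\<in>UNIV. J a e * J b i * Gmat S c0 p $ e $ i)"
    unfolding Gmat_nth[of c] left[OF Xhor_tangent[OF c p(1)]] by (simp add: sum_distrib_left mult.assoc)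
qed

end

section \<open>The tangent bundle and the algebraic conditions\<close>

definition tangent_chart :: "('a, real^'m) atlas \<Rightarrow> ('a, real^'m) chart \<Rightarrow> ('a \<times> 'a tvec, (real^'m) \<times> (real^'m)) chart" where
  "tangent_chart A c = (Sigma (fst c) (tangent_space A), \<lambda>P. (snd c (fst P), \<chi> a. velocity c a P))"

lemma tangent_atlas_charts: "tangent_atlas A = tangent_chart A ` charts A"
proof -
  have "tangent_atlas A = {tangent_chart A c | c. c \<in> charts A}"
    by (simp add: tangent_atlas_def tangent_chart_def)
  then show ?thesis by (simp only: Setcompr_eq_image)
qed

context
  fixes A :: "('a, real^'m) atlas"
  assumes A: "smooth_atlas A"
begin

lemma tangent_chart_apply:
  assumes c: "c \<in> charts A" and x: "x \<in> fst c"
  shows "snd (tangent_chart A c) (x, tangent_vector A c x v) = (snd c x, v)"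
    and "(x, tangent_vector A c x v) \<in> fst (tangent_chart A c)"
  using tangent_space_chart[OF A c x] x
  by (simp_all add: tangent_chart_def velocity_def tangent_vector_coord[OF A c x] vec_eq_iff)

lemma tangent_chart_cases:
  assumes c: "c \<in> charts A" and P: "P \<in> fst (tangent_chart A c)"
  obtains x v where "x \<in> fst c" "P = (x, tangent_vector A c x v)"
proof -
  have x: "fst P \<in> fst c" "snd P \<in> tangent_space A (fst P)" using P by (auto simp: tangent_chart_def)
  then obtain v where "snd P = tangent_vector A c (fst P) v" unfolding tangent_space_chart[OF A c x(1)] by blast
  then have "P = (fst P, tangent_vector A c (fst P) v)" by (simp add: prod_eq_iff)
  then show thesis using that x(1) by blast
qed

lemma tangent_chart_image:
  assumes c: "c \<in> charts A" and d: "d \<in> charts A"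
  shows "snd (tangent_chart A c) ` (fst (tangent_chart A c) \<inter> fst (tangent_chart A d)) = (snd c ` (fst c \<inter> fst d)) \<times> UNIV"
proof (intro equalityI subsetI)
  fix z assume "z \<in> snd (tangent_chart A c) ` (fst (tangent_chart A c) \<inter> fst (tangent_chart A d))"
  then show "z \<in> (snd c ` (fst c \<inter> fst d)) \<times> UNIV" by (auto simp: tangent_chart_def)
next
  fix z :: "(real^'m) \<times> (real^'m)" assume "z \<in> (snd c ` (fst c \<inter> fst d)) \<times> UNIV"
  then obtain x where x: "x \<in> fst c" "x \<in> fst d" "fst z = snd c x" by (auto simp: mem_Times_iff)
  let ?P = "(x, tangent_vector A c x (snd z))"
  have "?P \<in> fst (tangent_chart A c)" by (rule tangent_chart_apply(2)[OF c x(1)])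
  moreover then have "?P \<in> fst (tangent_chart A d)" using x(2) by (simp add: tangent_chart_def)
  moreover have "z = snd (tangent_chart A c) ?P"
    unfolding tangent_chart_apply(1)[OF c x(1)] using x(3) by (simp add: prod_eq_iff)
  ultimately show "z \<in> snd (tangent_chart A c) ` (fst (tangent_chart A c) \<inter> fst (tangent_chart A d))" by blast
qed

lemma tangent_chart_is_chart:
  assumes c: "c \<in> charts A" shows "is_chart (tangent_chart A c)"
  unfolding is_chart_def
proof
  show "open (snd (tangent_chart A c) ` fst (tangent_chart A c))"
    using tangent_chart_image[OF c c] is_chart_open[OF chartsD(2)[OF c]] by (simp add: open_Times)
  show "inj_on (snd (tangent_chart A c)) (fst (tangent_chart A c))"
  proof (rule inj_onI)
    fix P P' assume P: "P \<in> fst (tangent_chart A c)" and P': "P' \<in> fst (tangent_chart A c)"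
      and eq: "snd (tangent_chart A c) P = snd (tangent_chart A c) P'"
    obtain x v where x: "x \<in> fst c" "P = (x, tangent_vector A c x v)" using tangent_chart_cases[OF c P] .
    obtain y w where y: "y \<in> fst c" "P' = (y, tangent_vector A c y w)" using tangent_chart_cases[OF c P'] .
    have "snd c x = snd c y" "v = w"
      using eq unfolding x(2) y(2) tangent_chart_apply(1)[OF c x(1)] tangent_chart_apply(1)[OF c y(1)] by simp_all
    moreover from this(1) have "x = y" by (rule inj_onD[OF is_chart_inj[OF chartsD(2)[OF c]] _ x(1) y(1)])
    ultimately show "P = P'" using x y by simp
  qed
qed

text \<open>In coordinates the transition is the base transition map together with its derivative
  acting on the fibre component; \<open>tangent_vector_change\<close> supplies the second
  part.\<close>

lemma tangent_chart_transition:
  assumes c: "c \<in> charts A" and d: "d \<in> charts A" and z: "z \<in> (snd c ` (fst c \<inter> fst d)) \<times> UNIV"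
  shows "smooth_near (snd (tangent_chart A d) \<circ> chart_inv (tangent_chart A c)) z"
proof -
  let ?\<phi> = "snd d \<circ> chart_inv c"
  let ?F = "\<lambda>z. (?\<phi> (fst z), (case z of (e, v) \<Rightarrow> frechet_derivative ?\<phi> (at e) v))"
  have val: "(snd (tangent_chart A d) \<circ> chart_inv (tangent_chart A c)) z = ?F z"
    if z: "z \<in> (snd c ` (fst c \<inter> fst d)) \<times> UNIV" for z
  proof -
    obtain x where x: "x \<in> fst c" "x \<in> fst d" "fst z = snd c x" using z by (auto simp: mem_Times_iff)
    let ?P = "(x, tangent_vector A c x (snd z))"
    have "snd (tangent_chart A c) ?P = z"
      unfolding tangent_chart_apply(1)[OF c x(1)] using x(3) by (simp add: prod_eq_iff)
    then have "chart_inv (tangent_chart A c) z = ?P"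
      using chart_inv_chart[OF tangent_chart_is_chart[OF c] tangent_chart_apply(2)[OF c x(1)], of "snd z"] by simp
    moreover have "?P = (x, tangent_vector A d x (frechet_derivative ?\<phi> (at (snd c x)) (snd z)))"
      using tangent_vector_change[OF A c d x(1,2)] by simp
    ultimately show ?thesis
      using tangent_chart_apply(1)[OF d x(2)] x(3) chart_inv_chart[OF chartsD(2)[OF c] x(1)]
      by (simp add: case_prod_beta)
  qed
  have o: "open ((snd c ` (fst c \<inter> fst d)) \<times> (UNIV :: (real^'m) set))"
    by (intro open_Times open_UNIV openin_charts_image[OF A c openin_chart_domain[OF A d]])
  have ev: "eventually (\<lambda>z. (snd (tangent_chart A d) \<circ> chart_inv (tangent_chart A c)) z = ?F z) (nhds z)"
    unfolding eventually_nhds using o z val by blast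
  obtain x where x: "x \<in> fst c" "x \<in> fst d" "fst z = snd c x" using z by (auto simp: mem_Times_iff)
  have sm: "smooth_near ?\<phi> (fst z)" unfolding x(3) by (rule charts_smooth_near[OF A c d x(1,2)])
  have "smooth_near ?F z"
  proof (rule smooth_near_Pair)
    show "smooth_near (\<lambda>z. ?\<phi> (fst z)) z"
      by (rule smooth_near_compose[where f=fst and g="?\<phi>", OF smooth_near_linear[OF bounded_linear_fst] sm])
    show "smooth_near (\<lambda>z. case z of (e, v) \<Rightarrow> frechet_derivative ?\<phi> (at e) v) z"
      using smooth_near_deriv_apply[OF sm, of "snd z"] by simp
  qed
  then show ?thesis by (rule smooth_near_congI[OF ev])
qed

lemma tangent_atlas_smooth: "smooth_atlas (tangent_atlas A)"
  unfolding smooth_atlas_def tangent_atlas_charts ball_simps(9)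
proof (intro conjI ballI)
  fix c assume c: "c \<in> charts A"
  show "is_chart (tangent_chart A c)" by (rule tangent_chart_is_chart[OF c])
  fix d assume d: "d \<in> charts A"
  have o: "open ((snd c ` (fst c \<inter> fst d)) \<times> (UNIV :: (real^'m) set))" if "c \<in> charts A" "d \<in> charts A" for c d
    by (intro open_Times open_UNIV openin_charts_image[OF A that(1) openin_chart_domain[OF A that(2)]])
  show "compatible (tangent_chart A c) (tangent_chart A d)"
    unfolding compatible_def Int_commute[of "fst (tangent_chart A c)" "fst (tangent_chart A d)"]
      tangent_chart_image[OF d c]
    unfolding Int_commute[of "fst (tangent_chart A d)" "fst (tangent_chart A c)"] tangent_chart_image[OF c d]
      smooth_on_iff_near[OF o[OF c d]] smooth_on_iff_near[OF o[OF d c]]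
    using o[OF c d] o[OF d c] tangent_chart_transition[OF c d] tangent_chart_transition[OF d c] by blast
qed

text \<open>The velocity at a point over \<open>y\<close> and the dq-components of a tangent vector
  there can be chosen at will. An equality of forms in the dq with coefficients linear in the
  velocity can therefore be tested on arbitrary numbers.\<close>

lemma tangent_atlas_realize:
  assumes c: "c \<in> charts A" and y: "y \<in> fst c"
  shows "\<exists>P\<in>mcarrier (tangent_atlas A). fst P = y \<and> (\<forall>a. velocity c a P = v $ a) \<and>
    (\<forall>e. \<exists>u\<in>tangent_space (tangent_atlas A) P. \<forall>b. u (coord c b \<circ> fst) = e $ b)"
proof -
  let ?P = "(y, tangent_vector A c y v)"
  have C: "tangent_chart A c \<in> charts (tangent_atlas A)"
    using c by (intro atlas_subset_charts[OF tangent_atlas_smooth]) (simp add: tangent_atlas_charts)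
  have P: "?P \<in> fst (tangent_chart A c)" by (rule tangent_chart_apply(2)[OF c y])
  have "\<exists>u\<in>tangent_space (tangent_atlas A) ?P. \<forall>b. u (coord c b \<circ> fst) = e $ b" for e
  proof (intro bexI allI)
    fix b
    have bl: "bounded_linear (\<lambda>z :: (real^'m) \<times> (real^'m). fst z $ b)"
      by (rule bounded_linear_compose[OF bounded_linear_vec_nth bounded_linear_fst])
    have eq: "coord c b \<circ> fst = (\<lambda>P. (\<lambda>z. fst z $ b) (snd (tangent_chart A c) P))"
      by (simp add: coord_def tangent_chart_def o_def)
    \<comment> \<open>The forms to be compared contain no differentials of velocities, so the fibre
      component is put to 0.\<close>
    show "tangent_vector (tangent_atlas A) (tangent_chart A c) ?P (e, 0) (coord c b \<circ> fst) = e $ b"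
      unfolding eq tangent_vector_chart_fun[OF tangent_atlas_smooth C P smooth_near_linear[OF bl]]
      by (simp add: frechet_eqI[OF bounded_linear_imp_has_derivative[OF bl]])
  next
    show "tangent_vector (tangent_atlas A) (tangent_chart A c) ?P (e, 0) \<in> tangent_space (tangent_atlas A) ?P"
      unfolding tangent_space_chart[OF tangent_atlas_smooth C P] by blast
  qed
  moreover have "velocity c a ?P = v $ a" for a
    by (simp add: velocity_def tangent_vector_coord[OF A c y])
  ultimately show ?thesis using P chartsD(1)[OF C] by (intro bexI[of _ ?P]) auto
qed

end

text \<open>A bootstrap: the directional derivatives of \<open>f\<close> are components of the
  smooth map \<open>F\<close>, so \<open>f\<close> is differentiable to every order.\<close>

lemma smooth_near_primitive:
  fixes f :: "'a::euclidean_space \<Rightarrow> real"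
  assumes U: "open U" and f: "\<And>y. y \<in> U \<Longrightarrow> (f has_derivative (\<lambda>v. F y \<bullet> v)) (at y)"
    and F: "\<And>y. y \<in> U \<Longrightarrow> smooth_near F y" and y: "y \<in> U"
  shows "smooth_near f y"
proof -
  have "Ck_on (Suc k) U f" for k
  proof (rule Ck_on_SucI[OF U f])
    fix v
    have "smooth_on U (\<lambda>y. F y \<bullet> v)"
      unfolding smooth_on_iff_near[OF U] using F by (intro ballI smooth_near_inner smooth_near_const)
    then show "Ck_on k U (\<lambda>y. F y \<bullet> v)" by (simp only: smooth_on_def)
  qed
  then have "smooth_on U f" unfolding smooth_on_def using Ck_on_SucD by blast
  then show ?thesis using y smooth_on_iff_near[OF U] by blast
qed

section \<open>The algebra of the conditions at a single point\<close>

lemma sum_unit: "(\<Sum>i\<in>UNIV. F i * (if i = a then 1 else 0)) = (F a :: real)" for a :: "'m::finite"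
  by (simp add: if_distrib[of "\<lambda>x. _ * x"] cong: if_cong)

text \<open>Both sides are trilinear in \<open>v\<close>, \<open>u\<close>, \<open>w\<close>, so
  only coefficients matter. On the left they are antisymmetric in \<open>b\<close>, \<open>d\<close>
  by construction. On the right the two terms of the wedge contribute equally by antisymmetry of
  \<open>C\<close>, which turns 1/6 into 1/3.\<close>

lemma wedge_identity_iff:
  fixes F :: "'m::finite \<Rightarrow> real" and g :: "'m \<Rightarrow> 'm \<Rightarrow> real" and C :: "'m \<Rightarrow> 'm \<Rightarrow> 'm \<Rightarrow> real"
  assumes anti: "\<And>a b d. C a d b = - C a b d"
  shows "(\<forall>v u w. (\<Sum>b\<in>UNIV. F b * u b) * (\<Sum>a\<in>UNIV. \<Sum>d\<in>UNIV. g a d * v a * w d) -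
       (\<Sum>b\<in>UNIV. F b * w b) * (\<Sum>a\<in>UNIV. \<Sum>d\<in>UNIV. g a d * v a * u d) =
       1/6 * (\<Sum>a\<in>UNIV. \<Sum>b\<in>UNIV. \<Sum>d\<in>UNIV. C a b d * v a * (u b * w d - w b * u d))) \<longleftrightarrow>
     (\<forall>a b d. F b * g a d - F d * g a b = C a b d / 3)" (is "(\<forall>v u w. ?L v u w = ?R v u w) \<longleftrightarrow> _")
proof -
  have L: "?L v u w = (\<Sum>a\<in>UNIV. \<Sum>b\<in>UNIV. \<Sum>d\<in>UNIV. (F b * g a d - F d * g a b) * v a * u b * w d)" for v u w
  proof -
    have 1: "(\<Sum>b\<in>UNIV. F b * u b) * (\<Sum>a\<in>UNIV. \<Sum>d\<in>UNIV. g a d * v a * w d) =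
       (\<Sum>a\<in>UNIV. \<Sum>b\<in>UNIV. \<Sum>d\<in>UNIV. F b * g a d * v a * u b * w d)" for u w
    proof -
      have "(\<Sum>b\<in>UNIV. F b * u b) * (\<Sum>a\<in>UNIV. \<Sum>d\<in>UNIV. g a d * v a * w d) =
        (\<Sum>b\<in>UNIV. \<Sum>a\<in>UNIV. \<Sum>d\<in>UNIV. F b * u b * (g a d * v a * w d))"
        by (simp only: sum_distrib_right, simp only: sum_distrib_left)
      also have "\<dots> = (\<Sum>a\<in>UNIV. \<Sum>b\<in>UNIV. \<Sum>d\<in>UNIV. F b * u b * (g a d * v a * w d))" by (rule sum.swap)
      finally show ?thesis by (simp add: mult_ac)
    qed
    have 2: "(\<Sum>b\<in>UNIV. \<Sum>d\<in>UNIV. F b * g a d * v a * w b * u d) = (\<Sum>b\<in>UNIV. \<Sum>d\<in>UNIV. F d * g a b * v a * u b * w d)" for a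
      by (subst sum.swap) (simp add: mult_ac)
    show ?thesis unfolding 1 2 by (simp add: sum_subtractf left_diff_distrib)
  qed
  have R: "?R v u w = (\<Sum>a\<in>UNIV. \<Sum>b\<in>UNIV. \<Sum>d\<in>UNIV. C a b d / 3 * v a * u b * w d)" for v u w
  proof -
    have 2: "(\<Sum>b\<in>UNIV. \<Sum>d\<in>UNIV. C a b d * v a * (w b * u d)) = - (\<Sum>b\<in>UNIV. \<Sum>d\<in>UNIV. C a b d * v a * (u b * w d))" for a
    proof -
      have "(\<Sum>b\<in>UNIV. \<Sum>d\<in>UNIV. C a b d * v a * (w b * u d)) = (\<Sum>d\<in>UNIV. \<Sum>b\<in>UNIV. C a b d * v a * (w b * u d))"
        by (rule sum.swap)
      also have "\<dots> = (\<Sum>d\<in>UNIV. \<Sum>b\<in>UNIV. - (C a d b * v a * (u d * w b)))"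
        by (intro sum.cong refl) (subst anti, simp)
      finally show ?thesis by (simp add: sum_negf)
    qed
    have dbl: "(\<Sum>a\<in>UNIV. \<Sum>b\<in>UNIV. \<Sum>d\<in>UNIV. C a b d * v a * (u b * w d - w b * u d)) =
      2 * (\<Sum>a\<in>UNIV. \<Sum>b\<in>UNIV. \<Sum>d\<in>UNIV. C a b d * v a * (u b * w d))"
      by (simp add: right_diff_distrib sum_subtractf 2 sum_negf) (simp only: sum_distrib_left)
    show ?thesis unfolding dbl by (simp add: sum_distrib_left sum_divide_distrib mult_ac)
  qed
  show ?thesis
  proof
    assume eq: "\<forall>v u w. ?L v u w = ?R v u w"
    show "\<forall>a b d. F b * g a d - F d * g a b = C a b d / 3"
    proof (intro allI)
      fix a b d
      have unit: "(\<Sum>a'\<in>UNIV. \<Sum>b'\<in>UNIV. \<Sum>d'\<in>UNIV. H a' b' d' * (if a' = a then 1 else 0) * (if b' = b then 1 else 0) * (if d' = d then 1 else 0)) = H a b d"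
        for H :: "'m \<Rightarrow> 'm \<Rightarrow> 'm \<Rightarrow> real"
        by (simp add: sum_unit)
      show "F b * g a d - F d * g a b = C a b d / 3"
        using eq[unfolded L R, rule_format, of "\<lambda>i. if i = a then 1 else 0" "\<lambda>i. if i = b then 1 else 0" "\<lambda>i. if i = d then 1 else 0"]
        unfolding unit .
    qed
  next
    assume eq: "\<forall>a b d. F b * g a d - F d * g a b = C a b d / 3"
    show "\<forall>v u w. ?L v u w = ?R v u w" unfolding L R by (simp only: eq[rule_format] simp_thms)
  qed
qed

text \<open>Symmetrising the second equation in \<open>a, b\<close> gives the first one; antisymmetrising the first one in
  \<open>b, d\<close> gives the second.\<close>

lemma projective_condition_iff:
  fixes F :: "'m \<Rightarrow> real" and g :: "'m \<Rightarrow> 'm \<Rightarrow> real" and E :: "'m \<Rightarrow> 'm \<Rightarrow> 'm \<Rightarrow> real"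
  assumes anti: "\<And>a b d. E a d b = - E a b d" and sym: "\<And>a b. g a b = g b a"
  shows "(\<forall>a b d. E b a d + E a b d + g b d * F a + g a d * F b - 2 * g a b * F d = 0) \<longleftrightarrow>
    (\<forall>a b d. F b * g a d - F d * g a b = (- E b a d + E d a b - 2 * E a b d) / 3)"
proof (intro iffI allI)
  \<comment> \<open>With x, y, z for \<open>E b a d\<close>, \<open>E a b d\<close>,
    \<open>E d a b\<close> and p, q, r for \<open>g b d * F a\<close>, \<open>g a d * F b\<close>,
    \<open>g a b * F d\<close>, the premises are the condition at (a, b, d) and at (a, d, b);
    subtracting them removes p.\<close>
  have lin: "q - r = (- x + z - 2 * y) / 3" if "x + y + p + q - 2 * r = 0" "z - y + p + r - 2 * q = 0" for x y z p q r :: real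
    using that by argo
  fix a b d
  assume *: "\<forall>a b d. E b a d + E a b d + g b d * F a + g a d * F b - 2 * g a b * F d = 0"
  have 1: "E b a d + E a b d + g b d * F a + g a d * F b - 2 * (g a b * F d) = 0"
    using * by (simp add: mult.assoc)
  have 2: "E d a b - E a b d + g b d * F a + g a b * F d - 2 * (g a d * F b) = 0"
    using spec[OF spec[OF spec[OF *, of a], of d], of b] anti[of a d b] sym[of d b] by (simp add: mult.assoc)
  show "F b * g a d - F d * g a b = (- E b a d + E d a b - 2 * E a b d) / 3"
    using lin[OF 1 2] by (simp add: mult.commute)
next
  \<comment> \<open>Now x, y, z stand for \<open>E a b d\<close>, \<open>E b a d\<close>,
    \<open>E d a b\<close>. Adding the two premises, which differ by exchanging a and b, cancels
    z.\<close>
  have lin: "y + x + q' + q - 2 * r = 0" if "q - r = (- y + z - 2 * x) / 3" "q' - r = (- x - z - 2 * y) / 3" for x y z q q' r :: real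
    using that by argo
  fix a b d
  assume *: "\<forall>a b d. F b * g a d - F d * g a b = (- E b a d + E d a b - 2 * E a b d) / 3"
  have 1: "g a d * F b - g a b * F d = (- E b a d + E d a b - 2 * E a b d) / 3"
    using * by (simp add: mult.commute)
  have 2: "g b d * F a - g a b * F d = (- E a b d - E d a b - 2 * E b a d) / 3"
    using spec[OF spec[OF spec[OF *, of b], of a], of d] anti[of d a b] sym[of b a] by (simp add: mult.commute)
  show "E b a d + E a b d + g b d * F a + g a d * F b - 2 * g a b * F d = 0"
    using lin[OF 1 2] by (simp add: mult.assoc)
qed

text \<open>Contraction over \<open>a\<close>, \<open>b\<close> with the inverse metric
  \<open>N\<close>: each \<open>E\<close> term gives the trace on the left of the conclusion, the
  next two terms give \<open>F d\<close> each, and the last gives minus twice the dimension times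
  \<open>F d\<close>.\<close>

lemma projective_condition_trace:
  fixes F :: "'m::finite \<Rightarrow> real" and g N :: "real^'m^'m" and E :: "'m \<Rightarrow> 'm \<Rightarrow> 'm \<Rightarrow> real"
  assumes *: "\<And>a b. E b a d + E a b d + g $ b $ d * F a + g $ a $ d * F b - 2 * g $ a $ b * F d = 0"
    and N: "N ** g = mat 1" and symN: "\<And>a b. N $ a $ b = N $ b $ a" and symg: "\<And>a b. g $ a $ b = g $ b $ a"
  shows "(\<Sum>a\<in>UNIV. \<Sum>e\<in>UNIV. N $ e $ a * E e a d) = (real CARD('m) - 1) * F d"
proof -
  have Ng: "(\<Sum>b\<in>UNIV. N $ a $ b * g $ b $ e) = (if a = e then 1 else 0)" for a e
    using arg_cong[OF N, of "\<lambda>M. M $ a $ e"] by (simp add: matrix_matrix_mult_def mat_def)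
  let ?b = "\<Sum>a\<in>UNIV. \<Sum>e\<in>UNIV. N $ e $ a * E e a d"
  have 1: "(\<Sum>a\<in>UNIV. \<Sum>b\<in>UNIV. N $ a $ b * E b a d) = ?b"
    by (intro sum.cong refl) (simp add: symN)
  have 2: "(\<Sum>a\<in>UNIV. \<Sum>b\<in>UNIV. N $ a $ b * E a b d) = ?b" by (rule sum.swap)
  have 3: "(\<Sum>a\<in>UNIV. \<Sum>b\<in>UNIV. N $ a $ b * (g $ b $ d * F a)) = F d"
  proof -
    have "(\<Sum>a\<in>UNIV. \<Sum>b\<in>UNIV. N $ a $ b * (g $ b $ d * F a)) = (\<Sum>a\<in>UNIV. (\<Sum>b\<in>UNIV. N $ a $ b * g $ b $ d) * F a)"
      by (simp add: sum_distrib_right mult.assoc)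
    then show ?thesis unfolding Ng by (simp add: if_distrib[of "\<lambda>x. x * _"] cong: if_cong)
  qed
  have 4: "(\<Sum>a\<in>UNIV. \<Sum>b\<in>UNIV. N $ a $ b * (g $ a $ d * F b)) = F d"
  proof -
    have "(\<Sum>a\<in>UNIV. \<Sum>b\<in>UNIV. N $ a $ b * (g $ a $ d * F b)) = (\<Sum>b\<in>UNIV. \<Sum>a\<in>UNIV. N $ a $ b * (g $ a $ d * F b))"
      by (rule sum.swap)
    also have "\<dots> = (\<Sum>b\<in>UNIV. \<Sum>a\<in>UNIV. N $ b $ a * (g $ a $ d * F b))"
      by (intro sum.cong refl) (subst symN, rule refl)
    finally show ?thesis unfolding 3 .
  qed
  have 5: "(\<Sum>a\<in>UNIV. \<Sum>b\<in>UNIV. N $ a $ b * (2 * g $ a $ b * F d)) = 2 * real CARD('m) * F d"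
  proof -
    have "(\<Sum>a\<in>UNIV. \<Sum>b\<in>UNIV. N $ a $ b * (2 * g $ a $ b * F d)) =
      (\<Sum>a\<in>UNIV. (\<Sum>b\<in>UNIV. N $ a $ b * g $ b $ a) * (2 * F d))"
      unfolding sum_distrib_right by (intro sum.cong refl) (subst symg, simp)
    then show ?thesis unfolding Ng by simp
  qed
  have "(\<Sum>a\<in>UNIV. \<Sum>b\<in>UNIV. N $ a $ b * (E b a d + E a b d + g $ b $ d * F a + g $ a $ d * F b - 2 * g $ a $ b * F d)) = 0"
    unfolding * by simp
  then have "?b + ?b + F d + F d - 2 * real CARD('m) * F d = 0"
    unfolding distrib_left right_diff_distrib sum.distrib sum_subtractf 1 2 3 4 5 .
  then show ?thesis by (simp add: algebra_simps)
qed

text \<open>Every term is a component of a (0,3)-tensor, so the new expression is the transform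
  \<open>T\<close> of the old one, which vanishes in all components.\<close>

lemma projective_condition_transform:
  fixes F0 F :: "'m::finite \<Rightarrow> real" and g0 g J :: "'m \<Rightarrow> 'm \<Rightarrow> real" and E0 E :: "'m \<Rightarrow> 'm \<Rightarrow> 'm \<Rightarrow> real"
  assumes 0: "\<And>a b d. E0 b a d + E0 a b d + g0 b d * F0 a + g0 a d * F0 b - 2 * g0 a b * F0 d = 0"
    and F: "\<And>a. F a = (\<Sum>e\<in>UNIV. J a e * F0 e)"
    and g: "\<And>a b. g a b = (\<Sum>e\<in>UNIV. \<Sum>i\<in>UNIV. J a e * J b i * g0 e i)"
    and E: "\<And>a b d. E a b d = (\<Sum>e\<in>UNIV. \<Sum>i\<in>UNIV. \<Sum>j\<in>UNIV. J a e * J b i * J d j * E0 e i j)"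
  shows "E b a d + E a b d + g b d * F a + g a d * F b - 2 * g a b * F d = 0"
proof -
  define T where "T h = (\<Sum>e\<in>UNIV. \<Sum>i\<in>UNIV. \<Sum>j\<in>UNIV. J a e * J b i * J d j * h e i j)" for h :: "'m \<Rightarrow> 'm \<Rightarrow> 'm \<Rightarrow> real"
  have 1: "E b a d = T (\<lambda>e i j. E0 i e j)"
    unfolding E T_def by (subst sum.swap) (simp add: mult_ac)
  have 2: "E a b d = T E0" unfolding E T_def ..
  have 3: "g b d * F a = T (\<lambda>e i j. g0 i j * F0 e)"
  proof -
    have "g b d * F a = F a * g b d" by simp
    also have "\<dots> = (\<Sum>e\<in>UNIV. \<Sum>i\<in>UNIV. \<Sum>j\<in>UNIV. (J a e * F0 e) * (J b i * J d j * g0 i j))"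
      unfolding F g by (simp only: sum_distrib_right, simp only: sum_distrib_left)
    finally show ?thesis unfolding T_def by (simp add: mult_ac)
  qed
  have 4: "g a d * F b = T (\<lambda>e i j. g0 e j * F0 i)"
  proof -
    have "g a d * F b = F b * g a d" by simp
    also have "\<dots> = (\<Sum>i\<in>UNIV. \<Sum>e\<in>UNIV. \<Sum>j\<in>UNIV. (J b i * F0 i) * (J a e * J d j * g0 e j))"
      unfolding F g by (simp only: sum_distrib_right, simp only: sum_distrib_left)
    also have "\<dots> = (\<Sum>e\<in>UNIV. \<Sum>i\<in>UNIV. \<Sum>j\<in>UNIV. (J b i * F0 i) * (J a e * J d j * g0 e j))" by (rule sum.swap)
    finally show ?thesis unfolding T_def by (simp add: mult_ac)
  qed
  have 5: "2 * g a b * F d = T (\<lambda>e i j. 2 * g0 e i * F0 j)"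
  proof -
    have "g a b * F d = (\<Sum>e\<in>UNIV. \<Sum>i\<in>UNIV. \<Sum>j\<in>UNIV. (J a e * J b i * g0 e i) * (J d j * F0 j))"
      unfolding F g by (simp only: sum_distrib_right, simp only: sum_distrib_left)
    then have "2 * g a b * F d = 2 * (\<Sum>e\<in>UNIV. \<Sum>i\<in>UNIV. \<Sum>j\<in>UNIV. (J a e * J b i * g0 e i) * (J d j * F0 j))"
      by simp
    then show ?thesis unfolding T_def by (simp add: sum_distrib_left mult_ac)
  qed
  have add: "T h + T k = T (\<lambda>e i j. h e i j + k e i j)" and diff: "T h - T k = T (\<lambda>e i j. h e i j - k e i j)" for h k
    unfolding T_def by (simp_all add: distrib_left right_diff_distrib sum.distrib sum_subtractf)
  show ?thesis unfolding 1 2 3 4 5 add diff unfolding T_def 0 by simp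
qed

section \<open>The equivalence\<close>

context chaplygin
begin

definition beta_coeff :: "('q set, real^'m) chart \<Rightarrow> 'm \<Rightarrow> 'q set \<Rightarrow> real" where
  "beta_coeff c b y = (\<Sum>a\<in>UNIV. R_base S \<xi> c a a b y)"

text \<open>The condition (A') at one point with an arbitrary covector \<open>F\<close> in place of
  df. It serves both for a given f and for the multiple of beta, without presupposing that the
  latter has a potential.\<close>

definition projective_condition :: "('q set, real^'m) chart \<Rightarrow> 'q set \<Rightarrow> ('m \<Rightarrow> real) \<Rightarrow> bool" where
  "projective_condition c y F \<longleftrightarrow> (\<forall>a b d.
     GR_base S \<xi> c b a d y + GR_base S \<xi> c a b d y + g_base S c b d y * F a + g_base S c a d y * F b
     - 2 * g_base S c a b y * F d = 0)"

text \<open>Statement 1 speaks of all charts, while a potential is obtained in one; this carries the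
  condition over to the others. The hypothesis \<open>F\<close> says that the two families are
  components of the same covector.\<close>

lemma projective_condition_chart_change:
  assumes c: "c \<in> charts B" and c0: "c0 \<in> charts B" and y: "y \<in> fst c" "y \<in> fst c0"
    and P: "projective_condition c0 y F0"
    and F: "\<And>a. F a = (\<Sum>e\<in>UNIV. coord_field B c a y (coord c0 e) * F0 e)"
  shows "projective_condition c y F"
proof -
  obtain p where p: "p \<in> over c" "pr p = y" using over_E[OF c y(1)] .
  have p0: "p \<in> over c0" using p y(2) by (simp add: over_def)
  show ?thesis unfolding projective_condition_def
  proof (intro allI)
    fix a b d
    show "GR_base S \<xi> c b a d y + GR_base S \<xi> c a b d y + g_base S c b d y * F a + g_base S c a d y * F b
     - 2 * g_base S c a b y * F d = 0"
    proof (rule projective_condition_transform[where J="\<lambda>a e. coord_field B c a y (coord c0 e)"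
          and ?F0.0=F0 and F=F and ?g0.0="\<lambda>a b. g_base S c0 a b y" and ?E0.0="\<lambda>a b d. GR_base S \<xi> c0 a b d y"
          and g="\<lambda>a b. g_base S c a b y" and E="\<lambda>a b d. GR_base S \<xi> c a b d y"])
      show "g_base S c a b y = (\<Sum>e\<in>UNIV. \<Sum>i\<in>UNIV. coord_field B c a y (coord c0 e) * coord_field B c b y (coord c0 i) * g_base S c0 e i y)" for a b
        using Gmat_chart_change[OF c c0 p(1) p0, of a b]
        by (simp add: p(2)[symmetric] g_base_pr[OF c p(1)] g_base_pr[OF c0 p0])
      show "GR_base S \<xi> c a b d y = (\<Sum>e\<in>UNIV. \<Sum>i\<in>UNIV. \<Sum>j\<in>UNIV. coord_field B c a y (coord c0 e) *
          coord_field B c b y (coord c0 i) * coord_field B c d y (coord c0 j) * GR_base S \<xi> c0 e i j y)" for a b d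
        using curv_chart_change[OF c c0 p(1) p0, of a b d]
        by (simp add: p(2)[symmetric] GR_base_pr[OF c p(1)] GR_base_pr[OF c0 p0])
    qed (use P F in \<open>simp_all add: projective_condition_def\<close>)
  qed
qed

context
  fixes c :: "('q set, real^'m) chart"
  assumes c: "c \<in> charts B"
begin

lemma GR_base_antisym: "y \<in> fst c \<Longrightarrow> GR_base S \<xi> c a d b y = - GR_base S \<xi> c a b d y"
  by (rule over_E[OF c]) (auto simp: GR_base_pr[OF c] curv_antisym[OF c, of _ _ d b])

lemma g_base_sym: assumes "y \<in> fst c" shows "g_base S c a b y = g_base S c b a y"
proof -
  obtain p where p: "p \<in> over c" "pr p = y" using over_E[OF c assms] .
  show ?thesis using Gmat_sym[OF c p(1), of a b] g_base_pr[OF c p(1)] p(2) by simp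
qed

lemma projective_condition_beta:
  assumes y: "y \<in> fst c" and P: "projective_condition c y F"
  shows "beta_coeff c d y = (real CARD('m) - 1) * F d"
proof -
  obtain p where p: "p \<in> over c" "pr p = y" using over_E[OF c y] .
  note inv = Gmat_invertible[OF c p(1)]
  have "beta_coeff c d y = (\<Sum>a\<in>UNIV. \<Sum>e\<in>UNIV. matrix_inv (Gmat S c p) $ e $ a * GR_base S \<xi> c e a d y)"
    by (simp add: beta_coeff_def p(2)[symmetric] R_base_pr[OF c p(1)] GR_base_pr[OF c p(1)])
  also have "\<dots> = (real CARD('m) - 1) * F d"
  proof (rule projective_condition_trace[where g="Gmat S c p" and E="\<lambda>a b d. GR_base S \<xi> c a b d y"])
    show "GR_base S \<xi> c b a d y + GR_base S \<xi> c a b d y + Gmat S c p $ b $ d * F a + Gmat S c p $ a $ d * F b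
     - 2 * Gmat S c p $ a $ b * F d = 0" for a b
      using P by (simp add: projective_condition_def p(2)[symmetric] g_base_pr[OF c p(1)])
    show "matrix_inv (Gmat S c p) $ a $ b = matrix_inv (Gmat S c p) $ b $ a" for a b
      by (rule matrix_inv_sym[OF inv Gmat_sym[OF c p(1)]])
  qed (rule matrix_inv_matrix_mul[OF inv], rule Gmat_sym[OF c p(1)])
  finally show ?thesis .
qed

lemma beta_coeff_smooth: "y \<in> fst c \<Longrightarrow> smooth_at B (beta_coeff c b) y"
  unfolding beta_coeff_def[abs_def] using chartsD(1)[OF c]
  by (intro smooth_at_sum[OF B] R_base_smooth[OF c]) auto

lemma beta_eq:
  assumes y: "y \<in> fst c"
  shows "beta S \<xi> c y w = (\<Sum>b\<in>UNIV. beta_coeff c b y * w (coord c b))"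
proof -
  have "dfun (coord c a) y (gyroscopic_tensor S \<xi> c y (coord_field B c a y) w) =
     (\<Sum>b\<in>UNIV. R_base S \<xi> c a a b y * w (coord c b))" for a
  proof -
    have "dfun (coord c a) y (gyroscopic_tensor S \<xi> c y (coord_field B c a y) w) =
      (\<Sum>d\<in>UNIV. \<Sum>a'\<in>UNIV. \<Sum>b\<in>UNIV. R_base S \<xi> c d a' b y * w (coord c b) *
        (if a' = a then 1 else 0) * (if d = a then 1 else 0))"
      unfolding dfun_def gyroscopic_tensor_def coord_field_coord[OF B c y]
      by (intro sum.cong refl) auto
    then show ?thesis by (simp only: sum_distrib_right[symmetric] sum_unit)
  qed
  then have "beta S \<xi> c y w = (\<Sum>a\<in>UNIV. \<Sum>b\<in>UNIV. R_base S \<xi> c a a b y * w (coord c b))"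
    by (simp add: beta_def)
  also have "\<dots> = (\<Sum>b\<in>UNIV. \<Sum>a\<in>UNIV. R_base S \<xi> c a a b y * w (coord c b))" by (rule sum.swap)
  finally show ?thesis by (simp add: beta_coeff_def sum_distrib_right)
qed

lemma ext_deriv_beta:
  assumes y: "y \<in> fst c" and u: "u \<in> tangent_space B y" and w: "w \<in> tangent_space B y"
  shows "ext_deriv B c (beta S \<xi> c) y u w =
    (\<Sum>b\<in>UNIV. u (beta_coeff c b) * w (coord c b) - w (beta_coeff c b) * u (coord c b))"
proof -
  \<comment> \<open>The coefficient functions differentiated by \<open>ext_deriv\<close> are
    identified with \<open>beta_coeff\<close> only on the domain of \<open>c\<close>; as germs at
    \<open>y\<close> this is enough for \<open>tv_cong\<close>.\<close>
  have "eventually (\<lambda>y. beta S \<xi> c y (coord_field B c b y) = beta_coeff c b y) (mnhds B y)" for b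
    using eventually_mnhds_openin[OF B openin_chart_domain[OF B c] y]
  proof eventually_elim
    case (elim y)
    have "beta S \<xi> c y (coord_field B c b y) = (\<Sum>a\<in>UNIV. beta_coeff c a y * (if a = b then 1 else 0))"
      unfolding beta_eq[OF elim] coord_field_coord[OF B c elim] by (intro sum.cong refl) auto
    then show ?case by (simp only: sum_unit)
  qed
  then have "v (\<lambda>y. beta S \<xi> c y (coord_field B c b y)) = v (beta_coeff c b)" if "v \<in> tangent_space B y" for v b
    by (rule tv_cong[OF B that])
  note this[OF u] this[OF w]
  then show ?thesis by (simp add: ext_deriv_def wedge_def dfun_def)
qed

lemma wedge_beta_theta:
  assumes y: "fst P \<in> fst c"
  defines "F \<equiv> \<lambda>b. beta_coeff c b (fst P) / (real CARD('m) - 1)"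
  shows "wedge (pullback B fst (\<lambda>x v. beta S \<xi> c x v / (real CARD('m) - 1))) (theta_l S c) P u w =
    (\<Sum>b\<in>UNIV. F b * u (coord c b \<circ> fst)) * (\<Sum>a\<in>UNIV. \<Sum>d\<in>UNIV. g_base S c a d (fst P) * velocity c a P * w (coord c d \<circ> fst)) -
    (\<Sum>b\<in>UNIV. F b * w (coord c b \<circ> fst)) * (\<Sum>a\<in>UNIV. \<Sum>d\<in>UNIV. g_base S c a d (fst P) * velocity c a P * u (coord c d \<circ> fst))"
proof -
  have "pullback B fst (\<lambda>x v. beta S \<xi> c x v / (real CARD('m) - 1)) P u = (\<Sum>b\<in>UNIV. F b * u (coord c b \<circ> fst))" for u
    unfolding pullback_def beta_eq[OF y] F_def
    by (simp add: tangent_map_def smooth_at_coord[OF B c y] sum_divide_distrib)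
  then show ?thesis by (simp add: wedge_def theta_l_def dfun_def)
qed

lemma gamma_G_eq:
  "gamma_G S \<xi> c P u w = 1/6 * (\<Sum>a\<in>UNIV. \<Sum>b\<in>UNIV. \<Sum>d\<in>UNIV.
     (- GR_base S \<xi> c b a d (fst P) + GR_base S \<xi> c d a b (fst P) - 2 * GR_base S \<xi> c a b d (fst P)) * velocity c a P *
     (u (coord c b \<circ> fst) * w (coord c d \<circ> fst) - w (coord c b \<circ> fst) * u (coord c d \<circ> fst)))"
  by (simp add: gamma_G_def wedge_def dfun_def)

text \<open>The forms on the whole fibre of T(Q/G) over \<open>y\<close> are compared. At a point
  both sides depend only on the velocity and on the dq-components of the two tangent vectors.
  \<open>tangent_atlas_realize\<close> makes these arbitrary, and the algebraic equivalences finish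
  the comparison.\<close>

lemma wedge_condition_iff:
  assumes y: "y \<in> fst c"
  shows "(\<forall>P\<in>mcarrier (tangent_atlas B). fst P = y \<longrightarrow>
      (\<forall>u\<in>tangent_space (tangent_atlas B) P. \<forall>w\<in>tangent_space (tangent_atlas B) P.
         wedge (pullback B fst (\<lambda>x v. beta S \<xi> c x v / (real CARD('m) - 1))) (theta_l S c) P u w = gamma_G S \<xi> c P u w)) \<longleftrightarrow>
    projective_condition c y (\<lambda>b. beta_coeff c b y / (real CARD('m) - 1))" (is "?L \<longleftrightarrow> ?R")
proof -
  let ?F = "\<lambda>b. beta_coeff c b y / (real CARD('m) - 1)"
  let ?g = "\<lambda>a b. g_base S c a b y"
  let ?E = "\<lambda>a b d. GR_base S \<xi> c a b d y"
  let ?C = "\<lambda>a b d. - ?E b a d + ?E d a b - 2 * ?E a b d"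
  let ?I = "\<lambda>v u w. (\<Sum>b\<in>UNIV. ?F b * u b) * (\<Sum>a\<in>UNIV. \<Sum>d\<in>UNIV. ?g a d * v a * w d) -
       (\<Sum>b\<in>UNIV. ?F b * w b) * (\<Sum>a\<in>UNIV. \<Sum>d\<in>UNIV. ?g a d * v a * u d) =
       1/6 * (\<Sum>a\<in>UNIV. \<Sum>b\<in>UNIV. \<Sum>d\<in>UNIV. ?C a b d * v a * (u b * w d - w b * u d))"
  have "?C a d b = - ?C a b d" for a b d using GR_base_antisym[OF y, of a d b] by simp
  then have "(\<forall>v u w. ?I v u w) \<longleftrightarrow> (\<forall>a b d. ?F b * ?g a d - ?F d * ?g a b = ?C a b d / 3)"
    by (rule wedge_identity_iff)
  also have "\<dots> \<longleftrightarrow> ?R"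
    unfolding projective_condition_def
    by (rule projective_condition_iff[symmetric]) (rule GR_base_antisym[OF y], rule g_base_sym[OF y])
  finally have R: "?R \<longleftrightarrow> (\<forall>v u w. ?I v u w)" by blast
  have pt: "wedge (pullback B fst (\<lambda>x v. beta S \<xi> c x v / (real CARD('m) - 1))) (theta_l S c) P u w = gamma_G S \<xi> c P u w \<longleftrightarrow>
      ?I (\<lambda>a. velocity c a P) (\<lambda>b. u (coord c b \<circ> fst)) (\<lambda>b. w (coord c b \<circ> fst))" if "fst P = y" for P u w
  proof -
    have y': "fst P \<in> fst c" using that y by simp
    show ?thesis unfolding wedge_beta_theta[OF y'] gamma_G_eq that by (rule refl)
  qed
  show ?thesis unfolding R
  proof
    assume I: "\<forall>v u w. ?I v u w"
    show ?L
    proof (intro ballI impI)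
      fix P :: "'q set \<times> 'q set tvec" and u w assume "fst P = y"
      then show "wedge (pullback B fst (\<lambda>x v. beta S \<xi> c x v / (real CARD('m) - 1))) (theta_l S c) P u w = gamma_G S \<xi> c P u w"
        by (rule iffD2[OF pt]) (rule spec[OF spec[OF spec[OF I]]])
    qed
  next
    assume L: ?L
    show "\<forall>v u w. ?I v u w"
    proof (intro allI)
      fix v u w :: "'m \<Rightarrow> real"
      from tangent_atlas_realize[OF B c y, of "\<chi> a. v a"]
      obtain P where P: "P \<in> mcarrier (tangent_atlas B)" "fst P = y" "\<forall>a. velocity c a P = (\<chi> a. v a) $ a"
        and ex: "\<forall>e :: real^'m. \<exists>u\<in>tangent_space (tangent_atlas B) P. \<forall>b. u (coord c b \<circ> fst) = e $ b"
        by (elim bexE conjE)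
      from spec[OF ex, of "\<chi> a. u a"] obtain u'
        where u': "u' \<in> tangent_space (tangent_atlas B) P" "\<forall>b. u' (coord c b \<circ> fst) = (\<chi> a. u a) $ b" by (elim bexE)
      from spec[OF ex, of "\<chi> a. w a"] obtain w'
        where w': "w' \<in> tangent_space (tangent_atlas B) P" "\<forall>b. w' (coord c b \<circ> fst) = (\<chi> a. w a) $ b" by (elim bexE)
      have vals: "velocity c a P = v a" "u' (coord c b \<circ> fst) = u b" "w' (coord c b \<circ> fst) = w b" for a b
        using P(3) u'(2) w'(2) by simp_all
      have "wedge (pullback B fst (\<lambda>x v. beta S \<xi> c x v / (real CARD('m) - 1))) (theta_l S c) P u' w' = gamma_G S \<xi> c P u' w'"
        by (rule L[rule_format, OF P(1) P(2) u'(1) w'(1)])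
      then show "?I v u w" unfolding pt[OF P(2)] vals .
    qed
  qed
qed

text \<open>This is d(k df) = 0: the terms of \<open>ext_deriv_beta\<close> are contractions of
  \<open>k\<close> times the Hessian of \<open>f\<close>, symmetric by
  \<open>coord_field_commute\<close>. The relation to \<open>f\<close> is needed near
  \<open>y\<close>, since the coefficients of beta are differentiated.\<close>

lemma beta_closed:
  assumes y: "y \<in> fst c" and f: "smooth_at B f y"
    and bf: "eventually (\<lambda>y. \<forall>b. beta_coeff c b y = k * coord_field B c b y f) (mnhds B y)"
    and u: "u \<in> tangent_space B y" and w: "w \<in> tangent_space B y"
  shows "ext_deriv B c (beta S \<xi> c) y u w = 0"
proof -
  let ?H = "\<lambda>a b. coord_field B c a y (\<lambda>y. coord_field B c b y f)"
  have v: "v (beta_coeff c b) = (\<Sum>a\<in>UNIV. k * v (coord c a) * ?H a b)" if v: "v \<in> tangent_space B y" for v b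
  proof -
    have "v (beta_coeff c b) = v (\<lambda>y. k * coord_field B c b y f)"
      by (rule tv_cong[OF B v]) (use bf in eventually_elim, simp)
    also have "\<dots> = k * v (\<lambda>y. coord_field B c b y f)"
      by (rule tv_cmult[OF B v coord_field_smooth[OF B c y f]])
    also have "v (\<lambda>y. coord_field B c b y f) = (\<Sum>a\<in>UNIV. v (coord c a) * ?H a b)"
      by (rule fun_cong[OF tv_expand_vec[OF B c y v]])
    finally show ?thesis by (simp add: sum_distrib_left mult.assoc)
  qed
  have "(\<Sum>b\<in>UNIV. \<Sum>a\<in>UNIV. k * u (coord c a) * ?H a b * w (coord c b)) =
    (\<Sum>a\<in>UNIV. \<Sum>b\<in>UNIV. k * u (coord c a) * ?H a b * w (coord c b))" by (rule sum.swap)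
  also have "\<dots> = (\<Sum>b\<in>UNIV. \<Sum>a\<in>UNIV. k * w (coord c a) * ?H a b * u (coord c b))"
    by (intro sum.cong refl) (subst coord_field_commute[OF B c y f], simp)
  finally show ?thesis
    by (simp add: ext_deriv_beta[OF y u w] v[OF u] v[OF w] sum_subtractf sum_distrib_right)
qed

text \<open>In coordinates closedness says that the Jacobian of the vector of coefficients is
  symmetric, so \<open>poincare_ball\<close> applies on a ball inside the chart image. The factor
  \<open>k\<close> is carried along because it will be 1/(m - 1).\<close>

lemma beta_potential:
  assumes x: "x \<in> fst c"
    and closed: "\<And>y u w. y \<in> fst c \<Longrightarrow> u \<in> tangent_space B y \<Longrightarrow> w \<in> tangent_space B y \<Longrightarrow>
      ext_deriv B c (beta S \<xi> c) y u w = 0"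
  shows "\<exists>W f. openin (mtopology B) W \<and> x \<in> W \<and> W \<subseteq> fst c \<and>
    (\<forall>y\<in>W. smooth_at B f y \<and> (\<forall>a. coord_field B c a y f = k * beta_coeff c a y))"
proof -
  have ic: "is_chart c" by (rule chartsD(2)[OF c])
  have "open (snd c ` fst c)" by (rule is_chart_open[OF ic])
  from openE[OF this imageI[OF x]] obtain r where r: "r > 0" "ball (snd c x) r \<subseteq> snd c ` fst c" .
  let ?b = "\<lambda>b. beta_coeff c b \<circ> chart_inv c"
  define F where "F z = (\<chi> b. k * ?b b z)" for z
  have sb: "smooth_near (?b b) (snd c q)" if "q \<in> fst c" for b q
    by (rule iffD1[OF smooth_at_iff[OF B c that] beta_coeff_smooth[OF that]])
  have sF: "smooth_near F (snd c q)" if "q \<in> fst c" for q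
  proof (rule smooth_near_vec_lambda)
    show "smooth_near (\<lambda>z. F z $ b) (snd c q)" for b
      unfolding F_def using smooth_near_mult[OF smooth_near_const sb[OF that, of b]] by simp
  qed
  have DF: "frechet_derivative F (at (snd c q)) u = (\<chi> b. k * frechet_derivative (?b b) (at (snd c q)) u)"
    if "q \<in> fst c" for q u
  proof (rule frechet_eqI)
    have comp: "((\<lambda>z. k * ?b b z) has_derivative (\<lambda>u. k * frechet_derivative (?b b) (at (snd c q)) u)) (at (snd c q))" for b
      by (intro has_derivative_mult_right smooth_near_has_derivative sb that)
    show "(F has_derivative (\<lambda>u. \<chi> b. k * frechet_derivative (?b b) (at (snd c q)) u)) (at (snd c q))"
    proof (subst has_derivative_componentwise_within, intro ballI)
      fix i :: "real^'m" assume "i \<in> Basis"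
      then obtain j where i: "i = axis j 1" by (auto simp: Basis_vec_def)
      show "((\<lambda>z. F z \<bullet> i) has_derivative (\<lambda>u. (\<chi> b. k * frechet_derivative (?b b) (at (snd c q)) u) \<bullet> i)) (at (snd c q))"
        using comp[of j] by (simp add: F_def i inner_axis)
    qed
  qed
  have sym: "frechet_derivative F (at (snd c q)) u \<bullet> w = frechet_derivative F (at (snd c q)) w \<bullet> u"
    if q: "q \<in> fst c" for q u w
  proof -
    have T: "tangent_vector B c q v \<in> tangent_space B q" for v using tangent_space_chart[OF B c q] by blast
    have "(\<Sum>b\<in>UNIV. frechet_derivative (?b b) (at (snd c q)) u * w $ b - frechet_derivative (?b b) (at (snd c q)) w * u $ b) = 0"
      using closed[OF q T[of u] T[of w]]
      by (simp add: ext_deriv_beta[OF q T T] tangent_vector_coord[OF B c q] tangent_vector_smooth[OF beta_coeff_smooth[OF q]])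
    then have "k * (\<Sum>b\<in>UNIV. frechet_derivative (?b b) (at (snd c q)) u * w $ b) = k * (\<Sum>b\<in>UNIV. frechet_derivative (?b b) (at (snd c q)) w * u $ b)"
      by (simp add: sum_subtractf)
    then show ?thesis unfolding DF[OF q] by (simp add: inner_vec_def sum_distrib_left mult.assoc)
  qed
  have "\<exists>f. \<forall>z\<in>ball (snd c x) r. (f has_derivative (\<lambda>v. F z \<bullet> v)) (at z)"
  proof (rule poincare_ball)
    fix z assume "z \<in> ball (snd c x) r"
    then obtain q where q: "q \<in> fst c" "z = snd c q" using r(2) by blast
    show "smooth_near F z" unfolding q(2) by (rule sF[OF q(1)])
    show "frechet_derivative F (at z) u \<bullet> w = frechet_derivative F (at z) w \<bullet> u" for u w
      unfolding q(2) by (rule sym[OF q(1)])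
  qed
  then obtain f where f: "\<And>z. z \<in> ball (snd c x) r \<Longrightarrow> (f has_derivative (\<lambda>v. F z \<bullet> v)) (at z)" by blast
  let ?W = "fst c \<inter> snd c -` ball (snd c x) r"
  show ?thesis
  proof (intro exI conjI ballI allI)
    show "openin (mtopology B) ?W" by (rule openin_chart_preimage[OF B c open_ball])
    show "x \<in> ?W" using x r(1) by simp
    fix y assume y: "y \<in> ?W"
    have "smooth_near f (snd c y)"
    proof (rule smooth_near_primitive[OF open_ball f])
      fix z assume "z \<in> ball (snd c x) r"
      then obtain q where q: "q \<in> fst c" "z = snd c q" using r(2) by blast
      show "smooth_near F z" unfolding q(2) by (rule sF[OF q(1)])
    qed (use y in auto)
    then have sf: "smooth_near f (snd c y)" .
    have yc: "y \<in> fst c" using y by simp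
    show "smooth_at B (\<lambda>q. f (snd c q)) y" by (rule smooth_at_chart_fun[OF B c yc sf])
    fix a
    have "coord_field B c a y (\<lambda>q. f (snd c q)) = F (snd c y) \<bullet> axis a 1"
      unfolding coord_field_def tangent_vector_chart_fun[OF B c yc sf] by (rule frechet_eqI[OF f]) (use y in simp)
    then show "coord_field B c a y (\<lambda>q. f (snd c q)) = k * beta_coeff c a y"
      by (simp add: F_def inner_axis chart_inv_chart[OF ic yc])
  qed simp
qed

end

lemma projective_extension_iff:
  assumes m: "CARD('m) \<ge> 2"
  shows "(\<forall>x\<in>mcarrier B. \<exists>W f. openin (mtopology B) W \<and> x \<in> W \<and> (\<forall>y\<in>W. smooth_at B f y) \<and>
       (\<forall>c\<in>charts B. \<forall>y\<in>W \<inter> fst c. projective_condition c y (\<lambda>a. coord_field B c a y f))) \<longleftrightarrow>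
    (\<forall>c\<in>charts B. (\<forall>x\<in>fst c. \<forall>u\<in>tangent_space B x. \<forall>w\<in>tangent_space B x. ext_deriv B c (beta S \<xi> c) x u w = 0) \<and>
       (\<forall>y\<in>fst c. projective_condition c y (\<lambda>b. beta_coeff c b y / (real CARD('m) - 1))))"
    (is "?L \<longleftrightarrow> ?R")
proof
  have m1: "real CARD('m) - 1 \<noteq> 0" using m by simp
  {
    assume L: ?L
    show ?R
    proof
      fix c assume c: "c \<in> charts B"
      have main: "(\<forall>u\<in>tangent_space B x. \<forall>w\<in>tangent_space B x. ext_deriv B c (beta S \<xi> c) x u w = 0) \<and>
        projective_condition c x (\<lambda>b. beta_coeff c b x / (real CARD('m) - 1))" if x: "x \<in> fst c" for x
      proof -
        have "x \<in> mcarrier B" using chartsD(1)[OF c] x by blast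
        then obtain W f where W: "openin (mtopology B) W" "x \<in> W" and f: "\<forall>y\<in>W. smooth_at B f y"
          and P: "\<And>y. y \<in> W \<inter> fst c \<Longrightarrow> projective_condition c y (\<lambda>a. coord_field B c a y f)"
          using L c by meson
        \<comment> \<open>Obtained at all points of the neighbourhood and not just at
          \<open>x\<close>, because \<open>beta_closed\<close> differentiates this relation.\<close>
        have b: "beta_coeff c b y = (real CARD('m) - 1) * coord_field B c b y f" if "y \<in> W \<inter> fst c" for b y
          using projective_condition_beta[OF c _ P[OF that]] that by simp
        have "eventually (\<lambda>y. y \<in> W \<inter> fst c) (mnhds B x)"
          using W x by (intro eventually_mnhds_openin[OF B] openin_Int openin_chart_domain[OF B c]) auto
        then have "eventually (\<lambda>y. \<forall>b. beta_coeff c b y = (real CARD('m) - 1) * coord_field B c b y f) (mnhds B x)"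
          by eventually_elim (use b in blast)
        from beta_closed[OF c x _ this] f W(2)
        have "\<forall>u\<in>tangent_space B x. \<forall>w\<in>tangent_space B x. ext_deriv B c (beta S \<xi> c) x u w = 0" by blast
        moreover have "(\<lambda>b. beta_coeff c b x / (real CARD('m) - 1)) = (\<lambda>a. coord_field B c a x f)"
          using b[of x] W(2) x m1 by simp
        ultimately show ?thesis using P[of x] W(2) x by simp
      qed
      then show "(\<forall>x\<in>fst c. \<forall>u\<in>tangent_space B x. \<forall>w\<in>tangent_space B x. ext_deriv B c (beta S \<xi> c) x u w = 0) \<and>
       (\<forall>y\<in>fst c. projective_condition c y (\<lambda>b. beta_coeff c b y / (real CARD('m) - 1)))" by blast
    qed
  }
  {
    assume R: ?R
    show ?L
    proof
      fix x assume "x \<in> mcarrier B"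
      then obtain c where c: "c \<in> charts B" "x \<in> fst c" using mcarrier_charts[OF _ B] by blast
      obtain W f where W: "openin (mtopology B) W" "x \<in> W" "W \<subseteq> fst c"
        and f: "\<forall>y\<in>W. smooth_at B f y \<and> (\<forall>a. coord_field B c a y f = 1 / (real CARD('m) - 1) * beta_coeff c a y)"
        using beta_potential[OF c, of "1 / (real CARD('m) - 1)"] R c(1) by meson
      \<comment> \<open>\<open>f\<close> was found in the chart \<open>c\<close>, where its
        differential is the required multiple of beta; any other chart \<open>c'\<close> is reached
        by tensoriality, the components of df changing by \<open>tv_expand_vec\<close>.\<close>
      have "projective_condition c' y (\<lambda>a. coord_field B c' a y f)" if c': "c' \<in> charts B" and y: "y \<in> W \<inter> fst c'" for c' y
      proof (rule projective_condition_chart_change[OF c' c(1)])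
        show "y \<in> fst c'" "y \<in> fst c" using y W(3) by auto
        show "projective_condition c y (\<lambda>b. beta_coeff c b y / (real CARD('m) - 1))"
          using R c(1) y W(3) by blast
        have yc: "y \<in> fst c" and yc': "y \<in> fst c'" using y W(3) by auto
        have "coord_field B c' a y f = (\<Sum>e\<in>UNIV. coord_field B c' a y (coord c e) * coord_field B c e y f)" for a
          by (rule fun_cong[OF tv_expand_vec[OF B c(1) yc coord_field_tangent[OF B c' yc']]])
        then show "coord_field B c' a y f = (\<Sum>e\<in>UNIV. coord_field B c' a y (coord c e) * (beta_coeff c e y / (real CARD('m) - 1)))" for a
          using f y by simp
      qed
      then show "\<exists>W f. openin (mtopology B) W \<and> x \<in> W \<and> (\<forall>y\<in>W. smooth_at B f y) \<and>
       (\<forall>c\<in>charts B. \<forall>y\<in>W \<inter> fst c. projective_condition c y (\<lambda>a. coord_field B c a y f))"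
        using W f by blast
    qed
  }
qed

end

theorem proposition10:
  fixes S :: "('q, 'g, 'n::finite, 'm::finite, 'k::finite) chaplygin_data"
    and \<xi> :: "'k \<Rightarrow> 'g tvec"
  assumes "chaplygin_system S"
    and "lie_algebra_basis S \<xi>"
    and "CARD('m) \<ge> 2"
  shows
    "(\<forall>x\<in>mcarrier (Bman S). \<exists>W f. openin (mtopology (Bman S)) W \<and> x \<in> W \<and>
        (\<forall>y\<in>W. smooth_at (Bman S) f y) \<and>
        (\<forall>c\<in>charts (Bman S). \<forall>y\<in>W \<inter> fst c. \<forall>a b d.
           GR_base S \<xi> c b a d y + GR_base S \<xi> c a b d y
           + g_base S c b d y * coord_field (Bman S) c a y f
           + g_base S c a d y * coord_field (Bman S) c b y f
           - 2 * g_base S c a b y * coord_field (Bman S) c d y f = 0))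
     \<longleftrightarrow>
     (\<forall>c\<in>charts (Bman S).
        (\<forall>x\<in>fst c. \<forall>u\<in>tangent_space (Bman S) x. \<forall>w\<in>tangent_space (Bman S) x.
           ext_deriv (Bman S) c (beta S \<xi> c) x u w = 0) \<and>
        (\<forall>P\<in>mcarrier (tangent_atlas (Bman S)). fst P \<in> fst c \<longrightarrow>
           (\<forall>u\<in>tangent_space (tangent_atlas (Bman S)) P. \<forall>w\<in>tangent_space (tangent_atlas (Bman S)) P.
              wedge (pullback (Bman S) fst (\<lambda>x v. beta S \<xi> c x v / (real CARD('m) - 1))) (theta_l S c) P u w
              = gamma_G S \<xi> c P u w)))"
proof -
  interpret chaplygin S \<xi> using assms(1,2) by unfold_locales
  have "(\<forall>P\<in>mcarrier (tangent_atlas (Bman S)). fst P \<in> fst c \<longrightarrow>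
           (\<forall>u\<in>tangent_space (tangent_atlas (Bman S)) P. \<forall>w\<in>tangent_space (tangent_atlas (Bman S)) P.
              wedge (pullback (Bman S) fst (\<lambda>x v. beta S \<xi> c x v / (real CARD('m) - 1))) (theta_l S c) P u w
              = gamma_G S \<xi> c P u w)) \<longleftrightarrow>
     (\<forall>y\<in>fst c. projective_condition c y (\<lambda>b. beta_coeff c b y / (real CARD('m) - 1)))" (is "?W c \<longleftrightarrow> _")
    if c: "c \<in> charts (Bman S)" for c
  proof -
    \<comment> \<open>The points of T(Q/G) are grouped by their base point, the form in which
      \<open>wedge_condition_iff\<close> applies.\<close>
    have "?W c \<longleftrightarrow> (\<forall>y\<in>fst c. \<forall>P\<in>mcarrier (tangent_atlas (Bman S)). fst P = y \<longrightarrow>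
           (\<forall>u\<in>tangent_space (tangent_atlas (Bman S)) P. \<forall>w\<in>tangent_space (tangent_atlas (Bman S)) P.
              wedge (pullback (Bman S) fst (\<lambda>x v. beta S \<xi> c x v / (real CARD('m) - 1))) (theta_l S c) P u w
              = gamma_G S \<xi> c P u w))" by blast
    also have "\<dots> \<longleftrightarrow> (\<forall>y\<in>fst c. projective_condition c y (\<lambda>b. beta_coeff c b y / (real CARD('m) - 1)))"
      by (intro ball_cong refl wedge_condition_iff[OF c])
    finally show ?thesis .
  qed
  then have "(\<forall>c\<in>charts (Bman S).
        (\<forall>x\<in>fst c. \<forall>u\<in>tangent_space (Bman S) x. \<forall>w\<in>tangent_space (Bman S) x.
           ext_deriv (Bman S) c (beta S \<xi> c) x u w = 0) \<and> ?W c) \<longleftrightarrow>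
     (\<forall>c\<in>charts (Bman S).
        (\<forall>x\<in>fst c. \<forall>u\<in>tangent_space (Bman S) x. \<forall>w\<in>tangent_space (Bman S) x.
           ext_deriv (Bman S) c (beta S \<xi> c) x u w = 0) \<and>
        (\<forall>y\<in>fst c. projective_condition c y (\<lambda>b. beta_coeff c b y / (real CARD('m) - 1))))"
    by (intro ball_cong refl) simp
  then show ?thesis
    using projective_extension_iff[OF assms(3)] unfolding projective_condition_def by (simp only:)
qed

end
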